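(* Let $M$ be an orientable smooth manifold of dimension $m=k+2r$, let $\mathcal{F}$ be a regular foliation of $M$ generated by $k$ independent global $1$-forms $\alpha_1,\ldots,\alpha_k$, and put $\mu=\alpha_1\wedge\cdots\wedge\alpha_k$. Let $X^1,\ldots,X^k$ be dual vector fields, $\alpha_i(X^j)=\delta_{ij}$, let $\omega$ be a $2$-form compatible with $\mathcal{F}$ such that $\mathrm{i}_{X^j}\omega=0$ for $j=1,\ldots,k$, and let $\Pi$ be the regular Poisson tensor with characteristic foliation $\mathcal{F}$ determined by $\omega$ through $\mathrm{i}_\Pi(\mu\wedge\omega^r)=r\,\mu\wedge\omega^{r-1}$. Suppose that the vector fields $X^j$, $j=1,\ldots,k$, satisfy (a) $\mathrm{i}_{X_f}L_{X^j}\mu=0$ for all $f\in C^\infty(M)$, and (b) $(\mathrm{i}_{X^j}\mu)\wedge\mathrm{d}\omega=0$. Then each vector field $X^j$ is a Poisson vector field of $\Pi$, and the Poisson structure $\Pi$ is transversally constant.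
   Context: Generators of a foliation: $\alpha_1,\ldots,\alpha_k$ are $1$-forms globally defined on $M$, linearly independent at every point, satisfying $\mathrm{d}\alpha_i\wedge\mu=0$ for all $i$; $\mathcal{F}$ is the codimension $k$ foliation whose tangent distribution is $\{X:\alpha_i(X)=0,\ i=1,\ldots,k\}$. The dual vector fields $X^1,\ldots,X^k$ span a distribution transversal (complementary) to $\mathcal{F}$. A $2$-form $\omega$ is compatible with $\mathcal{F}$ if $\mathrm{d}\omega\wedge\mu=0$ and $\mu\wedge\omega^r$ is a volume form on $M$. Poisson notions: a Poisson tensor is a contravariant antisymmetric $2$-tensor $\Pi$ with $[\Pi,\Pi]=0$ (Schouten bracket). $\Pi^\#:T^*M\to TM$ is given by $\beta(\Pi^\#(\eta))=\Pi(\eta,\beta)$, and $X_f=\Pi^\#(\mathrm{d}f)$ is the Hamiltonian vector field of $f$. The characteristic foliation of a constant rank (regular) Poisson tensor is the foliation tangent to $\Pi^\#(T^*M)$. Contraction with bivectors uses the convention $\mathrm{i}_{X\wedge Y}=\mathrm{i}_Y\mathrm{i}_X$ (so $\mathrm{i}_{X_f}\Omega=-\mathrm{d}f\wedge\mathrm{i}_\Pi\Omega$ for a volume form $\Omega$). A Poisson vector field is a vector field $X$ with $[\Pi,X]=0$. A regular Poisson tensor $\Pi$ with characteristic foliation $\mathcal{F}$ is transversally constant if $\mathcal{F}$ has a transversal distribution $\mathcal{T}$ such that every local vector field $X$ in $\mathcal{T}$ which preserves $\mathcal{F}$ (i.e. $[X,Y]$ is tangent to $\mathcal{F}$ for every $Y$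 tangent to $\mathcal{F}$) is a (local) Poisson vector field. *)

theory Defs
  imports "HOL-Analysis.Analysis"
begin

section \<open>Smooth manifolds\<close>

abbreviation fderiv ::
  "('v::real_normed_vector \<Rightarrow> 'w::real_normed_vector) \<Rightarrow> 'v \<Rightarrow> 'v \<Rightarrow> 'w" where
  "fderiv f x \<equiv> frechet_derivative f (at x)"

text \<open>For open \<open>S\<close> only.\<close>

fun Ck_on ::
  "nat \<Rightarrow> 'v::real_normed_vector set \<Rightarrow> ('v \<Rightarrow> 'w::real_normed_vector) \<Rightarrow> bool" where
  "Ck_on 0 S f \<longleftrightarrow> continuous_on S f"
| "Ck_on (Suc k) S f \<longleftrightarrow>
     (\<forall>x\<in>S. f differentiable (at x)) \<and> (\<forall>v. Ck_on k S (\<lambda>x. fderiv f x v))"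

definition smooth_on ::
  "'v::real_normed_vector set \<Rightarrow> ('v \<Rightarrow> 'w::real_normed_vector) \<Rightarrow> bool" where
  "smooth_on S f \<longleftrightarrow> (\<forall>k. Ck_on k S f)"

text \<open>
  The manifold is the whole type \<open>'a\<close>, with the smooth structure given by an atlas.
  A chart is a pair of its domain and its coordinate map; the values of the coordinate
  map outside the domain are irrelevant.
\<close>

type_synonym ('a, 'n) chart = "'a set \<times> ('a \<Rightarrow> real^'n)"

definition is_chart :: "('a::topological_space, 'n::finite) chart \<Rightarrow> bool" where
  "is_chart c \<longleftrightarrow> open (fst c) \<and> open (snd c ` fst c) \<and>
     homeomorphism (fst c) (snd c ` fst c) (snd c) (inv_into (fst c) (snd c))"

definition coords :: "('a, 'n::finite) chart \<Rightarrow> 'a set \<Rightarrow> (real^'n) set" where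
  "coords c W = snd c ` (fst c \<inter> W)"

definition transition ::
  "('a, 'n::finite) chart \<Rightarrow> ('a, 'n) chart \<Rightarrow> real^'n \<Rightarrow> real^'n" where
  "transition c d = snd d \<circ> inv_into (fst c) (snd c)"

abbreviation jac ::
  "('a, 'n::finite) chart \<Rightarrow> ('a, 'n) chart \<Rightarrow> real^'n \<Rightarrow> real^'n \<Rightarrow> real^'n" where
  "jac c d x \<equiv> fderiv (transition c d) x"

definition charts_compatible :: "('a, 'n::finite) chart \<Rightarrow> ('a, 'n) chart \<Rightarrow> bool" where
  "charts_compatible c d \<longleftrightarrow>
     smooth_on (coords c (fst d)) (transition c d) \<and>
     smooth_on (coords d (fst c)) (transition d c)"

definition smooth_atlas :: "('a::topological_space, 'n::finite) chart set \<Rightarrow> bool" where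
  "smooth_atlas A \<longleftrightarrow>
     (\<forall>c\<in>A. is_chart c) \<and> (\<Union>c\<in>A. fst c) = UNIV \<and> (\<forall>c\<in>A. \<forall>d\<in>A. charts_compatible c d)"

definition orientable :: "('a::topological_space, 'n::finite) chart set \<Rightarrow> bool" where
  "orientable A \<longleftrightarrow>
     (\<exists>B. smooth_atlas B \<and> (\<forall>c\<in>A. \<forall>d\<in>B. charts_compatible c d) \<and>
        (\<forall>c\<in>B. \<forall>d\<in>B. \<forall>x\<in>coords c (fst d). det (matrix (jac c d x)) > 0))"

definition smooth_function ::
  "('a::topological_space, 'n::finite) chart set \<Rightarrow> ('a \<Rightarrow> real) \<Rightarrow> bool" where
  "smooth_function A f \<longleftrightarrow> (\<forall>c\<in>A. smooth_on (coords c UNIV) (f \<circ> inv_into (fst c) (snd c)))"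

section \<open>Tensor fields\<close>

text \<open>
  A tensor field on an open set \<open>W\<close> is the family of its coordinate expressions in the charts
  of the atlas, subject to the transformation law; the coordinate expression in the chart \<open>c\<close> is
  a function on \<open>coords c W\<close>.  Values at charts outside the atlas and at points outside
  \<open>coords c W\<close> carry no information, so fields are compared with \<open>tensor_eq\<close>.

  An alternating \<open>p\<close>-linear map takes a sequence of vectors, of which it uses the
  entries with index less than \<open>p\<close>.
\<close>

type_synonym 'v altmap = "(nat \<Rightarrow> 'v) \<Rightarrow> real"
type_synonym ('a, 'n) vfield = "('a, 'n) chart \<Rightarrow> real^'n \<Rightarrow> real^'n"
type_synonym ('a, 'n) tfield = "('a, 'n) chart \<Rightarrow> real^'n \<Rightarrow> (real^'n) altmap"

definition alternating :: "nat \<Rightarrow> 'v::real_vector altmap \<Rightarrow> bool" where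
  "alternating p a \<longleftrightarrow>
     (\<forall>v w. (\<forall>i<p. v i = w i) \<longrightarrow> a v = a w) \<and>
     (\<forall>v. \<forall>i<p. linear (\<lambda>u. a (v(i := u)))) \<and>
     (\<forall>v. \<forall>i<p. \<forall>j<p. i \<noteq> j \<and> v i = v j \<longrightarrow> a v = 0)"

definition tensor_eq ::
  "('a, 'n::finite) chart set \<Rightarrow> 'a set \<Rightarrow> ('a, 'n) tfield \<Rightarrow> ('a, 'n) tfield \<Rightarrow> bool" where
  "tensor_eq A W S T \<longleftrightarrow> (\<forall>c\<in>A. \<forall>x\<in>coords c W. S c x = T c x)"

abbreviation zero_tensor :: "('a, 'n::finite) tfield" where
  "zero_tensor \<equiv> \<lambda>c x v. 0"

definition vector_field ::
  "('a::topological_space, 'n::finite) chart set \<Rightarrow> 'a set \<Rightarrow> ('a, 'n) vfield \<Rightarrow> bool" where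
  "vector_field A W X \<longleftrightarrow>
     (\<forall>c\<in>A. smooth_on (coords c W) (X c)) \<and>
     (\<forall>c\<in>A. \<forall>d\<in>A. \<forall>x\<in>coords c (fst d \<inter> W). X d (transition c d x) = jac c d x (X c x))"

definition form ::
  "('a::topological_space, 'n::finite) chart set \<Rightarrow> nat \<Rightarrow> ('a, 'n) tfield \<Rightarrow> bool" where
  "form A p \<alpha> \<longleftrightarrow>
     (\<forall>c\<in>A. \<forall>x\<in>coords c UNIV. alternating p (\<alpha> c x)) \<and>
     (\<forall>c\<in>A. \<forall>v. smooth_on (coords c UNIV) (\<lambda>x. \<alpha> c x v)) \<and>
     (\<forall>c\<in>A. \<forall>d\<in>A. \<forall>x\<in>coords c (fst d). \<forall>v.
        \<alpha> c x v = \<alpha> d (transition c d x) (\<lambda>i. jac c d x (v i)))"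

text \<open>
  Covectors are identified with elements of \<open>real^'n\<close> through the coordinate basis:
  \<open>\<xi>\<close> stands for the linear form \<open>\<lambda>v. \<xi> \<bullet> v\<close>, so that pulling back along a linear
  map \<open>J\<close> is \<open>adjoint J\<close>.
\<close>

definition multivector_field ::
  "('a::topological_space, 'n::finite) chart set \<Rightarrow> nat \<Rightarrow> ('a, 'n) tfield \<Rightarrow> bool" where
  "multivector_field A p P \<longleftrightarrow>
     (\<forall>c\<in>A. \<forall>x\<in>coords c UNIV. alternating p (P c x)) \<and>
     (\<forall>c\<in>A. \<forall>\<xi>. smooth_on (coords c UNIV) (\<lambda>x. P c x \<xi>)) \<and>
     (\<forall>c\<in>A. \<forall>d\<in>A. \<forall>x\<in>coords c (fst d). \<forall>\<xi>.
        P d (transition c d x) \<xi> = P c x (\<lambda>i. adjoint (jac c d x) (\<xi> i)))"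

definition vfield_multivector :: "('a, 'n::finite) vfield \<Rightarrow> ('a, 'n) tfield" where
  "vfield_multivector X = (\<lambda>c x \<xi>. \<xi> 0 \<bullet> X c x)"

section \<open>Exterior calculus\<close>

text \<open>
  The wedge product is normalised so that
  \<open>(\<alpha> \<and> \<beta>)(v, w) = \<alpha>(v) \<beta>(w) - \<alpha>(w) \<beta>(v)\<close> for \<open>1\<close>-forms.
\<close>

definition wedge_alt :: "nat \<Rightarrow> nat \<Rightarrow> 'v altmap \<Rightarrow> 'v altmap \<Rightarrow> 'v altmap" where
  "wedge_alt p q a b = (\<lambda>v.
     (\<Sum>\<sigma> | \<sigma> permutes {..<p + q}.
        of_int (sign \<sigma>) * a (\<lambda>i. v (\<sigma> i)) * b (\<lambda>i. v (\<sigma> (p + i)))) / (fact p * fact q))"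

definition wedge ::
  "nat \<Rightarrow> nat \<Rightarrow> ('a, 'n::finite) tfield \<Rightarrow> ('a, 'n) tfield \<Rightarrow> ('a, 'n) tfield" where
  "wedge p q \<alpha> \<beta> = (\<lambda>c x. wedge_alt p q (\<alpha> c x) (\<beta> c x))"

fun wedge_family :: "nat \<Rightarrow> (nat \<Rightarrow> ('a, 'n::finite) tfield) \<Rightarrow> ('a, 'n) tfield" where
  "wedge_family 0 \<alpha> = (\<lambda>c x v. 1)"
| "wedge_family (Suc k) \<alpha> = wedge k 1 (wedge_family k \<alpha>) (\<alpha> k)"

fun wedge_power :: "nat \<Rightarrow> ('a, 'n::finite) tfield \<Rightarrow> ('a, 'n) tfield" where
  "wedge_power 0 \<omega> = (\<lambda>c x v. 1)"
| "wedge_power (Suc r) \<omega> = wedge (2 * r) 2 (wedge_power r \<omega>) \<omega>"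

text \<open>Only meant for arguments \<open>a\<close> of degree at least \<open>1\<close>.\<close>

definition contract_alt :: "'v \<Rightarrow> 'v altmap \<Rightarrow> 'v altmap" where
  "contract_alt u a = (\<lambda>v. a (case_nat u v))"

definition contract ::
  "('a, 'n::finite) vfield \<Rightarrow> ('a, 'n) tfield \<Rightarrow> ('a, 'n) tfield" where
  "contract X \<alpha> = (\<lambda>c x. contract_alt (X c x) (\<alpha> c x))"

text \<open>
  In coordinates \<open>\<Lambda> = 1/2 (\<Sum>i j. \<Lambda>(dx\<^sup>i, dx\<^sup>j) e\<^sub>i \<and> e\<^sub>j)\<close>, and contraction with
  \<open>u \<and> v\<close> is contraction with \<open>u\<close> followed by contraction with \<open>v\<close>.
\<close>

definition contract_bivector ::
  "('a, 'n::finite) tfield \<Rightarrow> ('a, 'n) tfield \<Rightarrow> ('a, 'n) tfield" where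
  "contract_bivector \<Lambda> \<alpha> = (\<lambda>c x v. 1 / 2 * (\<Sum>i\<in>UNIV. \<Sum>j\<in>UNIV.
     \<Lambda> c x (case_nat (axis i 1) (\<lambda>_. axis j 1)) *
     contract_alt (axis j 1) (contract_alt (axis i 1) (\<alpha> c x)) v))"

definition ext_deriv :: "nat \<Rightarrow> ('a, 'n::finite) tfield \<Rightarrow> ('a, 'n) tfield" where
  "ext_deriv p \<alpha> = (\<lambda>c x v. \<Sum>i\<le>p. (-1) ^ i *
     fderiv (\<lambda>y. \<alpha> c y (\<lambda>j. if j < i then v j else v (Suc j))) x (v i))"

text \<open>
  This is \<open>(L\<^sub>X \<alpha>)(v\<^sub>0, \<dots>) = X(\<alpha>(v\<^sub>0, \<dots>)) - (\<Sum>i. \<alpha>(\<dots>, [X, v\<^sub>i], \<dots>))\<close> for vector fields \<open>v\<^sub>i\<close> with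
  constant coordinates.
\<close>

definition lie_deriv ::
  "nat \<Rightarrow> ('a, 'n::finite) vfield \<Rightarrow> ('a, 'n) tfield \<Rightarrow> ('a, 'n) tfield" where
  "lie_deriv p X \<alpha> = (\<lambda>c x v. fderiv (\<lambda>y. \<alpha> c y v) x (X c x) +
     (\<Sum>i<p. \<alpha> c x (v(i := fderiv (X c) x (v i)))))"

definition lie_bracket ::
  "('a, 'n::finite) vfield \<Rightarrow> ('a, 'n) vfield \<Rightarrow> ('a, 'n) vfield" where
  "lie_bracket X Y = (\<lambda>c x. fderiv (Y c) x (X c x) - fderiv (X c) x (Y c x))"

text \<open>
  The Schouten bracket of multivector fields of degrees \<open>p, q \<ge> 1\<close>, in coordinates
  \[ [P, Q] = \sum_l (-1)^{p-1} (i_{dx^l} P) \wedge \partial_l Q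
      - (-1)^{(p-1)(q-1)} (-1)^{q-1} (i_{dx^l} Q) \wedge \partial_l P, \]
  where \<open>i\<close> inserts a covector in the first slot.  For \<open>p = q = 1\<close> it is the Lie bracket, and for
  \<open>p = 1\<close> it is the Lie derivative of \<open>Q\<close> along \<open>P\<close>.
\<close>

definition schouten ::
  "nat \<Rightarrow> nat \<Rightarrow> ('a, 'n::finite) tfield \<Rightarrow> ('a, 'n) tfield \<Rightarrow> ('a, 'n) tfield" where
  "schouten p q P Q = (\<lambda>c x \<xi>. \<Sum>l\<in>UNIV.
     (-1) ^ (p - 1) *
       wedge_alt (p - 1) q (contract_alt (axis l 1) (P c x))
         (\<lambda>\<eta>. fderiv (\<lambda>y. Q c y \<eta>) x (axis l 1)) \<xi>
     - (-1) ^ ((p - 1) * (q - 1)) * (-1) ^ (q - 1) *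
       wedge_alt (q - 1) p (contract_alt (axis l 1) (Q c x))
         (\<lambda>\<eta>. fderiv (\<lambda>y. P c y \<eta>) x (axis l 1)) \<xi>)"

definition volume_form ::
  "('a::topological_space, 'n::finite) chart set \<Rightarrow> ('a, 'n) tfield \<Rightarrow> bool" where
  "volume_form A \<Omega> \<longleftrightarrow>
     form A CARD('n) \<Omega> \<and> (\<forall>c\<in>A. \<forall>x\<in>coords c UNIV. \<exists>v. \<Omega> c x v \<noteq> 0)"

section \<open>Foliations\<close>

text \<open>A foliation is represented by its tangent distribution.\<close>

type_synonym ('a, 'n) distr = "('a, 'n) chart \<Rightarrow> real^'n \<Rightarrow> (real^'n) set"

definition distribution ::
  "('a::topological_space, 'n::finite) chart set \<Rightarrow> ('a, 'n) distr \<Rightarrow> bool" where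
  "distribution A D \<longleftrightarrow>
     (\<exists>q. \<forall>p. \<exists>W Y. open W \<and> p \<in> W \<and> (\<forall>i<q. vector_field A W (Y i)) \<and>
        (\<forall>c\<in>A. \<forall>x\<in>coords c W.
           D c x = span ((\<lambda>i. Y i c x) ` {..<q}) \<and> dim (D c x) = q))"

definition transversal ::
  "('a::topological_space, 'n::finite) chart set \<Rightarrow> ('a, 'n) distr \<Rightarrow> ('a, 'n) distr \<Rightarrow> bool" where
  "transversal A F T \<longleftrightarrow> distribution A T \<and>
     (\<forall>c\<in>A. \<forall>x\<in>coords c UNIV. F c x \<inter> T c x = {0} \<and> {u + v | u v. u \<in> F c x \<and> v \<in> T c x} = UNIV)"

definition vfield_in ::
  "('a, 'n::finite) chart set \<Rightarrow> 'a set \<Rightarrow> ('a, 'n) vfield \<Rightarrow> ('a, 'n) distr \<Rightarrow> bool" where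
  "vfield_in A W X D \<longleftrightarrow> (\<forall>c\<in>A. \<forall>x\<in>coords c W. X c x \<in> D c x)"

definition preserves ::
  "('a::topological_space, 'n::finite) chart set \<Rightarrow> 'a set \<Rightarrow> ('a, 'n) vfield \<Rightarrow>
     ('a, 'n) distr \<Rightarrow> bool" where
  "preserves A W X F \<longleftrightarrow>
     (\<forall>Y. vector_field A W Y \<and> vfield_in A W Y F \<longrightarrow> vfield_in A W (lie_bracket X Y) F)"

definition foliation_generators ::
  "('a::topological_space, 'n::finite) chart set \<Rightarrow> nat \<Rightarrow> (nat \<Rightarrow> ('a, 'n) tfield) \<Rightarrow> bool" where
  "foliation_generators A k \<alpha> \<longleftrightarrow>
     (\<forall>i<k. form A 1 (\<alpha> i)) \<and>
     (\<forall>c\<in>A. \<forall>x\<in>coords c UNIV. \<forall>a. (\<forall>v. (\<Sum>i<k. a i * \<alpha> i c x v) = 0) \<longrightarrow> (\<forall>i<k. a i = 0)) \<and>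
     (\<forall>i<k. tensor_eq A UNIV (wedge 2 k (ext_deriv 1 (\<alpha> i)) (wedge_family k \<alpha>)) zero_tensor)"

definition kernel_distr :: "nat \<Rightarrow> (nat \<Rightarrow> ('a, 'n::finite) tfield) \<Rightarrow> ('a, 'n) distr" where
  "kernel_distr k \<alpha> = (\<lambda>c x. {v. \<forall>i<k. \<alpha> i c x (\<lambda>_. v) = 0})"

definition compatible_form ::
  "('a::topological_space, 'n::finite) chart set \<Rightarrow> nat \<Rightarrow> nat \<Rightarrow> ('a, 'n) tfield \<Rightarrow>
     ('a, 'n) tfield \<Rightarrow> bool" where
  "compatible_form A k r \<mu> \<omega> \<longleftrightarrow>
     form A 2 \<omega> \<and>
     tensor_eq A UNIV (wedge 3 k (ext_deriv 2 \<omega>) \<mu>) zero_tensor \<and>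
     volume_form A (wedge k (2 * r) \<mu> (wedge_power r \<omega>))"

section \<open>Poisson tensors\<close>

definition poisson_tensor ::
  "('a::topological_space, 'n::finite) chart set \<Rightarrow> ('a, 'n) tfield \<Rightarrow> bool" where
  "poisson_tensor A \<Lambda> \<longleftrightarrow>
     multivector_field A 2 \<Lambda> \<and> tensor_eq A UNIV (schouten 2 2 \<Lambda> \<Lambda>) zero_tensor"

text \<open>The components are those forced by \<open>\<beta>(sharp \<Lambda> \<eta>) = \<Lambda>(\<eta>, \<beta>)\<close>.\<close>

definition sharp :: "(real^'n::finite) altmap \<Rightarrow> real^'n \<Rightarrow> real^'n" where
  "sharp P \<eta> = (\<chi> j. P (case_nat \<eta> (\<lambda>_. axis j 1)))"

definition differential :: "('a \<Rightarrow> real) \<Rightarrow> ('a, 'n::finite) chart \<Rightarrow> real^'n \<Rightarrow> real^'n" where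
  "differential f c x = (\<chi> i. fderiv (f \<circ> inv_into (fst c) (snd c)) x (axis i 1))"

definition hamiltonian_vf ::
  "('a, 'n::finite) tfield \<Rightarrow> ('a \<Rightarrow> real) \<Rightarrow> ('a, 'n) vfield" where
  "hamiltonian_vf \<Lambda> f = (\<lambda>c x. sharp (\<Lambda> c x) (differential f c x))"

definition characteristic_distr :: "('a, 'n::finite) tfield \<Rightarrow> ('a, 'n) distr" where
  "characteristic_distr \<Lambda> = (\<lambda>c x. range (sharp (\<Lambda> c x)))"

definition regular_poisson_tensor ::
  "('a::topological_space, 'n::finite) chart set \<Rightarrow> ('a, 'n) tfield \<Rightarrow> bool" where
  "regular_poisson_tensor A \<Lambda> \<longleftrightarrow> poisson_tensor A \<Lambda> \<and>
     (\<exists>q. \<forall>c\<in>A. \<forall>x\<in>coords c UNIV. dim (characteristic_distr \<Lambda> c x) = q)"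

definition poisson_vector_field ::
  "('a::topological_space, 'n::finite) chart set \<Rightarrow> 'a set \<Rightarrow> ('a, 'n) tfield \<Rightarrow>
     ('a, 'n) vfield \<Rightarrow> bool" where
  "poisson_vector_field A W \<Lambda> X \<longleftrightarrow> vector_field A W X \<and>
     tensor_eq A W (schouten 2 1 \<Lambda> (vfield_multivector X)) zero_tensor"

definition transversally_constant ::
  "('a::topological_space, 'n::finite) chart set \<Rightarrow> ('a, 'n) tfield \<Rightarrow> bool" where
  "transversally_constant A \<Lambda> \<longleftrightarrow> regular_poisson_tensor A \<Lambda> \<and>
     (\<exists>T. transversal A (characteristic_distr \<Lambda>) T \<and>
        (\<forall>W X. open W \<and> vector_field A W X \<and> vfield_in A W X T \<and>
           preserves A W X (characteristic_distr \<Lambda>) \<longrightarrow> poisson_vector_field A W \<Lambda> X))"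

end

theory Submission
  imports Defs
begin

text \<open>
The argument is pointwise in charts. Let \<open>F\<close> be the common kernel of the \<open>\<alpha>\<^sub>i\<close>, that is, the tangent
space of the leaf, and let \<open>P\<close> be the map \<open>\<Lambda>\<^sup>#\<close> from covectors to vectors, whose image is \<open>F\<close>.

The relation between \<open>\<Lambda>\<close> and \<open>\<omega>\<close> says that \<open>\<Lambda>\<close> inverts \<open>\<omega>\<close> along the leaves: \<open>\<omega>(u, P \<xi>) = \<xi>(u)\<close>
for \<open>u \<in> F\<close>. To see this, let the endomorphism \<open>B x = \<xi>(x) u\<close> act as a derivation on the volume form
\<open>\<Omega> = \<mu> \<and> \<omega>\<^sup>r\<close>. A derivation acts on forms of top degree as multiplication by the trace of \<open>B\<close>, which
is \<open>\<xi>(u)\<close>; it annihilates \<open>\<mu>\<close> because \<open>u \<in> F\<close>; and it maps \<open>\<omega>\<close> to \<open>\<theta> = \<xi> \<and> i\<^sub>u\<omega>\<close>. Hence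
\<open>\<xi>(u) \<Omega> = r \<mu> \<and> \<omega>\<^sup>r\<^sup>-\<^sup>1 \<and> \<theta> = i\<^sub>\<Lambda>\<Omega> \<and> \<theta> = \<Lambda>(\<xi>, i\<^sub>u\<omega>) \<Omega> = \<omega>(u, P \<xi>) \<Omega>\<close>. This is the lemma
\<open>inverse_on_kernel\<close>.

Let \<open>Y\<close> be a vector field with values in the span of the \<open>X\<^sup>j\<close>, and suppose that the forms
\<open>L\<^sub>Y\<alpha>\<^sub>i\<close> vanish on \<open>F\<close> and that \<open>L\<^sub>Y\<omega>\<close> vanishes on pairs of vectors of \<open>F\<close>. Then \<open>L\<^sub>Y\<Lambda> = 0\<close>
(\<open>lie_derivative_of_inverse_zero\<close>). Indeed, let \<open>Q = L\<^sub>YP\<close>, so that \<open>\<beta>(Q \<eta>) = (L\<^sub>Y\<Lambda>)(\<eta>, \<beta>)\<close>. Since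
\<open>\<alpha>\<^sub>i(P \<eta>) = 0\<close>, the first assumption puts \<open>Q \<eta>\<close> into \<open>F\<close>. Applying \<open>L\<^sub>Y\<close> to
\<open>\<Lambda>(\<eta>, \<beta>) = \<omega>(P \<eta>, P \<beta>)\<close> and using the second assumption yields
\<open>(L\<^sub>Y\<Lambda>)(\<eta>, \<beta>) = \<omega>(Q \<eta>, P \<beta>) + \<omega>(P \<eta>, Q \<beta>) = 2 (L\<^sub>Y\<Lambda>)(\<eta>, \<beta>)\<close>.

The two assumptions hold in both cases of interest. Since \<open>i\<^sub>Y\<omega> = 0\<close>, Cartan's formula gives
\<open>L\<^sub>Y\<omega> = i\<^sub>Yd\<omega>\<close>, and condition (b), evaluated on the \<open>X\<^sup>l\<close> with \<open>l \<noteq> j\<close> followed by \<open>X\<^sup>j, u, v\<close>, says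
that \<open>d\<omega>(X\<^sup>j, u, v) = 0\<close> for \<open>u, v \<in> F\<close>. For \<open>Y = X\<^sup>j\<close>, condition (a) makes \<open>L\<^sub>Y\<mu>\<close> vanish as soon as one
argument is a Hamiltonian vector; these exhaust \<open>F\<close>, because bump functions realise every covector
as the differential of a global function, and evaluation on the frame \<open>X\<^sup>l\<close> with one member replaced
by \<open>u \<in> F\<close> isolates \<open>(L\<^sub>Y\<alpha>\<^sub>i)(u)\<close>. If \<open>Y\<close> preserves the foliation, then extending \<open>u\<close> to a Hamiltonian
field \<open>Z\<close> gives \<open>(L\<^sub>Y\<alpha>\<^sub>i)(Z) = Y(\<alpha>\<^sub>i(Z)) - \<alpha>\<^sub>i([Y, Z]) = 0\<close>. So the span of the \<open>X\<^sup>j\<close> is a transversal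
distribution that shows \<open>\<Lambda>\<close> to be transversally constant.
\<close>

section \<open>Alternation over permutations\<close>

text \<open>
The wedge product of two alternations is again one (see \<open>wedge_alternate\<close> below), so that iterated
wedge products collapse to a single sum over permutations. There is no factor \<open>1 / N!\<close>: with the
normalisation of \<^const>\<open>wedge_alt\<close>, alternating a product of \<open>N\<close> one-forms, each applied to its own
argument, gives exactly their wedge product.
\<close>

definition alternate :: "nat \<Rightarrow> 'v altmap \<Rightarrow> 'v altmap" where
  "alternate N g = (\<lambda>v. \<Sum>\<sigma> | \<sigma> permutes {..<N}. of_int (sign \<sigma>) * g (\<lambda>i. v (\<sigma> i)))"

lemma sign_sq: "real_of_int (sign \<sigma>) * (real_of_int (sign \<sigma>) * c) = c"
  by (simp add: sign_def)

lemma sign_perm_compose: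
  assumes "\<sigma> permutes {..<N::nat}" "\<tau> permutes {..<N}"
  shows "sign (\<sigma> \<circ> \<tau>) = sign \<sigma> * sign \<tau>"
  using assms by (meson finite_lessThan permutes_imp_permutation sign_compose)

lemma alternate_permute:
  assumes "\<tau> permutes {..<N}"
  shows "alternate N g (\<lambda>i. v (\<tau> i)) = of_int (sign \<tau>) * alternate N g v"
proof -
  have "alternate N g v = (\<Sum>\<sigma> | \<sigma> permutes {..<N}. of_int (sign (\<tau> \<circ> \<sigma>)) * g (\<lambda>i. v ((\<tau> \<circ> \<sigma>) i)))"
    unfolding alternate_def by (rule setum_permutations_compose_left[OF assms])
  also have "\<dots> = (\<Sum>\<sigma> | \<sigma> permutes {..<N}. of_int (sign \<tau>) * (of_int (sign \<sigma>) * g (\<lambda>i. v (\<tau> (\<sigma> i)))))"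
    by (rule sum.cong) (auto simp: sign_perm_compose[OF assms])
  also have "\<dots> = of_int (sign \<tau>) * alternate N g (\<lambda>i. v (\<tau> i))"
    unfolding alternate_def by (simp add: sum_distrib_left)
  finally show ?thesis by (simp add: sign_sq)
qed

lemma alternate_repeated:
  assumes "i < N" "j < N" "i \<noteq> j" "v i = v j"
  shows "alternate N g v = 0"
proof -
  have "(\<lambda>m. v (Transposition.transpose i j m)) = v"
    using assms(4) by (auto simp: Transposition.transpose_def)
  moreover have "alternate N g (\<lambda>m. v (Transposition.transpose i j m)) = - alternate N g v"
    using assms by (subst alternate_permute) (auto intro!: permutes_swap_id simp: sign_swap_id)
  ultimately show ?thesis by simp
qed

lemma alternate_cong:
  assumes "\<And>w. g w = h w"
  shows "alternate N g v = alternate N h v"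
  using assms by (simp add: alternate_def)

lemma alternate_local:
  assumes "\<And>w w'. (\<And>i. i < N \<Longrightarrow> w i = w' i) \<Longrightarrow> g w = g w'"
    and "\<And>i. i < N \<Longrightarrow> v i = v' i"
  shows "alternate N g v = alternate N g v'"
  unfolding alternate_def
  by (intro sum.cong refl arg_cong2[where f="(*)"] assms) (use permutes_in_image in fastforce)

lemma alternate_cmult: "alternate N (\<lambda>w. c * g w) v = c * alternate N g v"
  unfolding alternate_def by (simp add: sum_distrib_left mult.left_commute)

lemma alternate_sum: "alternate N (\<lambda>w. \<Sum>i\<in>I. g i w) v = (\<Sum>i\<in>I. alternate N (g i) v)"
  unfolding alternate_def by (simp add: sum_distrib_left) (rule sum.swap)

lemma alternate_slots:
  assumes "\<tau> permutes {..<N}"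
  shows "alternate N (\<lambda>w. g (\<lambda>i. w (\<tau> i))) v = of_int (sign \<tau>) * alternate N g v"
proof -
  have "alternate N g v = (\<Sum>\<sigma> | \<sigma> permutes {..<N}. of_int (sign (\<sigma> \<circ> \<tau>)) * g (\<lambda>i. v ((\<sigma> \<circ> \<tau>) i)))"
    unfolding alternate_def by (rule sum_permutations_compose_right[OF assms])
  also have "\<dots> = (\<Sum>\<sigma> | \<sigma> permutes {..<N}. of_int (sign \<tau>) * (of_int (sign \<sigma>) * g (\<lambda>i. v (\<sigma> (\<tau> i)))))"
    by (rule sum.cong) (auto simp: sign_perm_compose[OF _ assms])
  also have "\<dots> = of_int (sign \<tau>) * alternate N (\<lambda>w. g (\<lambda>i. w (\<tau> i))) v"
    unfolding alternate_def by (simp add: sum_distrib_left)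
  finally show ?thesis by (simp add: sign_sq)
qed

text \<open>
An endomorphism acts on multilinear forms as a derivation, one slot at a time. This commutes with
alternation because a permutation only reorders the slots over which the derivation sums.
\<close>

lemma alternate_derivation:
  "(\<Sum>i<N. alternate N g (v(i := B (v i)))) = alternate N (\<lambda>w. \<Sum>i<N. g (w(i := B (w i)))) v"
proof -
  have "(\<Sum>i<N. g (\<lambda>m. (v(i := B (v i))) (\<sigma> m))) = (\<Sum>i<N. g ((\<lambda>m. v (\<sigma> m))(i := B (v (\<sigma> i)))))"
    if \<sigma>: "\<sigma> permutes {..<N}" for \<sigma>
  proof -
    have "(\<lambda>m. (v(\<sigma> i := B (v (\<sigma> i)))) (\<sigma> m)) = (\<lambda>m. v (\<sigma> m))(i := B (v (\<sigma> i)))" for i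
      using permutes_inj[OF \<sigma>] by (auto simp: inj_eq)
    then show ?thesis
      using sum.reindex_bij_betw[OF permutes_imp_bij[OF \<sigma>],
          of "\<lambda>i. g (\<lambda>m. (v(i := B (v i))) (\<sigma> m))"] by simp
  qed
  then show ?thesis
    unfolding alternate_def
    by (subst sum.swap) (simp add: sum_distrib_left[symmetric])
qed

text \<open>
A permutation of the arguments of the second factor of a wedge product, seen as a permutation of all
arguments.
\<close>

definition shift_perm :: "nat \<Rightarrow> (nat \<Rightarrow> nat) \<Rightarrow> nat \<Rightarrow> nat" where
  "shift_perm p \<tau> i = (if i < p then i else p + \<tau> (i - p))"

lemma shift_perm_compose: "shift_perm p (\<sigma> \<circ> \<tau>) = shift_perm p \<sigma> \<circ> shift_perm p \<tau>"
  by (auto simp: shift_perm_def)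

lemma shift_perm_transpose: "shift_perm p (Transposition.transpose i j) = Transposition.transpose (p + i) (p + j)"
  by (auto simp: shift_perm_def Transposition.transpose_def fun_eq_iff)

lemma shift_perm:
  assumes "\<tau> permutes {..<q}"
  shows "shift_perm p \<tau> permutes {..<p + q}" "sign (shift_perm p \<tau>) = sign \<tau>"
proof -
  have "shift_perm p \<tau> permutes {..<p + q} \<and> sign (shift_perm p \<tau>) = sign \<tau>"
    using assms
  proof (induction rule: permutes_rev_induct[OF finite_lessThan, consumes 1])
    case 1
    have "shift_perm p id = id" by (auto simp: shift_perm_def)
    then show ?case by (simp add: id_def permutes_id[unfolded id_def])
  next
    case (2 a b f)
    have 1: "Transposition.transpose a b permutes {..<q}"
      "Transposition.transpose (p + a) (p + b) permutes {..<p + q}"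
      using 2 by (auto intro!: permutes_swap_id)
    have "sign (shift_perm p f \<circ> Transposition.transpose (p + a) (p + b)) = sign (f \<circ> Transposition.transpose a b)"
      using 2 1 by (simp add: sign_perm_compose[of _ "p + q"] sign_perm_compose[of _ q] sign_swap_id del: o_apply)
    then show ?case
      using 2 1 unfolding shift_perm_compose shift_perm_transpose by (auto intro: permutes_compose simp del: o_apply)
  qed
  then show "shift_perm p \<tau> permutes {..<p + q}" "sign (shift_perm p \<tau>) = sign \<tau>" by auto
qed

lemma permutes_lessThan_mono: "\<tau> permutes {..<p} \<Longrightarrow> \<tau> permutes {..<p + q::nat}"
  by (erule permutes_subset) auto

lemma sum_times_two_sums:
  fixes c :: "'x \<Rightarrow> real"
  shows "(\<Sum>a\<in>A. c a * (\<Sum>b\<in>B. f a b) * (\<Sum>d\<in>D. g a d))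
    = (\<Sum>b\<in>B. \<Sum>d\<in>D. \<Sum>a\<in>A. c a * f a b * g a d)"
proof -
  have "(\<Sum>a\<in>A. c a * (\<Sum>b\<in>B. f a b) * (\<Sum>d\<in>D. g a d)) = (\<Sum>a\<in>A. \<Sum>b\<in>B. \<Sum>d\<in>D. c a * f a b * g a d)"
    unfolding mult.assoc sum_product by (simp add: sum_distrib_left mult.assoc)
  also have "\<dots> = (\<Sum>b\<in>B. \<Sum>a\<in>A. \<Sum>d\<in>D. c a * f a b * g a d)" by (rule sum.swap)
  also have "\<dots> = (\<Sum>b\<in>B. \<Sum>d\<in>D. \<Sum>a\<in>A. c a * f a b * g a d)"
    by (intro sum.cong refl sum.swap)
  finally show ?thesis .
qed

text \<open>
Alternating the factors first only repeats the outer alternation: the inner permutations extend to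
permutations of all slots, which the outer sum absorbs together with their signs. So the outer sum
is counted \<open>p! q!\<close> times, which is the normalising factor of \<^const>\<open>wedge_alt\<close>.
\<close>

lemma wedge_alternate:
  assumes local_a: "\<And>w w'. (\<And>i. i < p \<Longrightarrow> w i = w' i) \<Longrightarrow> a w = a w'"
  shows "wedge_alt p q (alternate p a) (alternate q b) = alternate (p + q) (\<lambda>w. a w * b (\<lambda>i. w (p + i)))"
proof
  fix v
  let ?S = "\<lambda>n. {\<sigma>. \<sigma> permutes {..<n::nat}}"
  let ?h = "\<lambda>w. a w * b (\<lambda>i. w (p + i))"
  have slot: "alternate (p + q) (\<lambda>w. a (\<lambda>i. w (\<tau> i)) * b (\<lambda>i. w (p + \<rho> i))) v
      = of_int (sign \<tau>) * (of_int (sign \<rho>) * alternate (p + q) ?h v)"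
    if \<tau>: "\<tau> permutes {..<p}" and \<rho>: "\<rho> permutes {..<q}" for \<tau> \<rho>
  proof -
    let ?t = "shift_perm p \<rho>"
    have "?t i = i" if "i < p" for i using that by (simp add: shift_perm_def)
    have perm: "\<tau> \<circ> ?t permutes {..<p + q}"
      using shift_perm[OF \<rho>] permutes_lessThan_mono[OF \<tau>] by (auto intro: permutes_compose)
    have t1: "\<tau> (p + i) = p + i" for i using \<tau> by (auto simp: permutes_def)
    have t2: "(\<tau> \<circ> ?t) (p + i) = p + \<rho> i" for i by (simp add: shift_perm_def t1)
    have t3: "\<tau> (?t (\<tau> i)) = \<tau> (\<tau> i)" if "i < p" for i
      using permutes_in_image[OF \<tau>] that by (simp add: shift_perm_def)
    have "alternate (p + q) (\<lambda>w. a (\<lambda>i. w (\<tau> i)) * b (\<lambda>i. w (p + \<rho> i))) v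
        = alternate (p + q) (\<lambda>w. (\<lambda>w. a w * b (\<lambda>i. w (p + \<rho> i))) (\<lambda>i. w (\<tau> i))) v"
      by (simp add: t1)
    also have "\<dots> = of_int (sign \<tau>) * alternate (p + q) (\<lambda>w. a w * b (\<lambda>i. w (p + \<rho> i))) v"
      by (rule alternate_slots) (rule permutes_lessThan_mono[OF \<tau>])
    also have "alternate (p + q) (\<lambda>w. a w * b (\<lambda>i. w (p + \<rho> i))) v
        = alternate (p + q) (\<lambda>w. ?h (\<lambda>i. w (?t i))) v"
      unfolding alternate_def
    proof (intro sum.cong refl arg_cong2[where f="(*)"])
      fix \<sigma>
      show "a (\<lambda>i. v (\<sigma> i)) = a (\<lambda>i. v (\<sigma> (?t i)))"
        by (rule local_a) (simp add: shift_perm_def)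
      show "b (\<lambda>i. v (\<sigma> (p + \<rho> i))) = b (\<lambda>i. v (\<sigma> (?t (p + i))))"
        by (simp add: shift_perm_def)
    qed
    also have "\<dots> = of_int (sign \<rho>) * alternate (p + q) ?h v"
      using alternate_slots[OF shift_perm(1)[OF \<rho>]] by (simp add: shift_perm(2)[OF \<rho>])
    finally show ?thesis .
  qed
  have "wedge_alt p q (alternate p a) (alternate q b) v * (fact p * fact q)
      = (\<Sum>\<sigma>\<in>?S (p + q). of_int (sign \<sigma>) * (\<Sum>\<tau>\<in>?S p. of_int (sign \<tau>) * a (\<lambda>i. v (\<sigma> (\<tau> i))))
          * (\<Sum>\<rho>\<in>?S q. of_int (sign \<rho>) * b (\<lambda>i. v (\<sigma> (p + \<rho> i)))))"
    by (simp add: wedge_alt_def alternate_def)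
  also have "\<dots> = (\<Sum>\<tau>\<in>?S p. \<Sum>\<rho>\<in>?S q. of_int (sign \<tau>) * (of_int (sign \<rho>) *
      alternate (p + q) (\<lambda>w. a (\<lambda>i. w (\<tau> i)) * b (\<lambda>i. w (p + \<rho> i))) v))"
    unfolding alternate_def sum_times_two_sums by (simp add: sum_distrib_left mult_ac)
  also have "\<dots> = (\<Sum>\<tau>\<in>?S p. \<Sum>\<rho>\<in>?S q. alternate (p + q) ?h v)"
    by (intro sum.cong refl) (simp add: slot sign_def)
  also have "\<dots> = fact p * fact q * alternate (p + q) ?h v"
    by (simp add: card_permutations)
  finally show "wedge_alt p q (alternate p a) (alternate q b) v = alternate (p + q) ?h v"
    by simp
qed

section \<open>Wedge products as single alternations\<close>

abbreviation eval2 :: "'v altmap \<Rightarrow> 'v \<Rightarrow> 'v \<Rightarrow> real" where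
  "eval2 a u v \<equiv> a (case_nat u (\<lambda>_. v))"

lemma alternating_local: "alternating p a \<Longrightarrow> (\<And>i. i < p \<Longrightarrow> v i = w i) \<Longrightarrow> a v = a w"
  by (simp add: alternating_def)

lemma alternating_linear: "alternating p a \<Longrightarrow> i < p \<Longrightarrow> linear (\<lambda>u. a (v(i := u)))"
  unfolding alternating_def by blast

lemma alternating_1_linear:
  assumes "alternating 1 a" shows "linear (\<lambda>u. a (\<lambda>_. u))"
proof -
  have "(\<lambda>u. a ((\<lambda>_. 0)(0 := u))) = (\<lambda>u. a (\<lambda>_. u))"
    by (intro ext alternating_local[OF assms]) auto
  then show ?thesis using alternating_linear[OF assms, of 0 "\<lambda>_. 0"] by simp
qed

lemma alternating_2_eval: "alternating 2 a \<Longrightarrow> a w = eval2 a (w 0) (w 1)"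
  by (rule alternating_local[of 2]) (auto simp: less_2_cases_iff)

lemma alternating_2_linear:
  assumes "alternating 2 a"
  shows "linear (\<lambda>u. eval2 a u v)" "linear (eval2 a u)"
proof -
  have "(\<lambda>u. a ((\<lambda>_. v)(0 := u))) = (\<lambda>u. eval2 a u v)"
    by (intro ext alternating_local[OF assms]) (auto simp: less_2_cases_iff)
  then show "linear (\<lambda>u. eval2 a u v)" using alternating_linear[OF assms, of 0 "\<lambda>_. v"] by simp
  have "(\<lambda>v. a ((\<lambda>_. u)(1 := v))) = eval2 a u"
    by (intro ext alternating_local[OF assms]) (auto simp: less_2_cases_iff)
  then show "linear (eval2 a u)" using alternating_linear[OF assms, of 1 "\<lambda>_. u"] by simp
qed

lemma alternating_2_swap:
  assumes "alternating 2 a" shows "eval2 a v u = - eval2 a u v"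
proof -
  have z: "eval2 a x x = 0" for x
    using assms unfolding alternating_def
    by (metis One_nat_def old.nat.simps(4,5) less_2_cases_iff zero_neq_one)
  have "eval2 a (u + v) (u + v) = 0" by (rule z)
  then show ?thesis
    by (simp add: linear_add[OF alternating_2_linear(1)[OF assms]]
        linear_add[OF alternating_2_linear(2)[OF assms]] z)
qed

lemma alternate_1: "alternate (Suc 0) g = g"
  by (simp add: alternate_def lessThan_Suc)

lemma alternate_2: "alternate 2 g v = g v - g (\<lambda>i. v (Transposition.transpose 0 1 i))"
proof -
  have "{\<sigma>. \<sigma> permutes {..<2::nat}} = {id, Transposition.transpose 0 1}"
    by (auto simp: numeral_2_eq_2 lessThan_Suc permutes_doubleton_iff insert_commute)
  moreover have "id \<noteq> Transposition.transpose 0 (1::nat)"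
    by (metis id_apply transpose_apply_first zero_neq_one)
  ultimately show ?thesis by (simp add: alternate_def sign_swap_id)
qed

text \<open>
This writes a two-form as an alternation, as \<open>wedge_alternate\<close> needs it, and is the source of the
halves that accompany two-forms below.
\<close>

lemma alternate_2_antisym:
  assumes "\<And>u v. f v u = - f u (v::'v)"
  shows "alternate 2 (\<lambda>w. f (w 0) (w 1) / 2) = (\<lambda>w. f (w 0) (w 1))"
  by (rule ext) (simp add: alternate_2 assms[of "_ (Suc 0)" "_ 0"])

lemma wedge_family_alternate:
  assumes "\<And>i. i < k \<Longrightarrow> alternating 1 (\<alpha> i c x)"
  shows "wedge_family k \<alpha> c x = alternate k (\<lambda>w. \<Prod>i<k. \<alpha> i c x (\<lambda>_. w i))"
  using assms
proof (induction k)
  case 0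
  show ?case by (simp add: alternate_def)
next
  case (Suc k)
  have "wedge_family (Suc k) \<alpha> c x
      = wedge_alt k 1 (alternate k (\<lambda>w. \<Prod>i<k. \<alpha> i c x (\<lambda>_. w i))) (alternate 1 (\<alpha> k c x))"
    using Suc by (simp add: wedge_def alternate_1)
  also have "\<dots> = alternate (k + 1) (\<lambda>w. (\<Prod>i<k. \<alpha> i c x (\<lambda>_. w i)) * \<alpha> k c x (\<lambda>i. w (k + i)))"
    by (rule wedge_alternate) simp
  finally have *: "wedge_family (Suc k) \<alpha> c x
      = alternate (k + 1) (\<lambda>w. (\<Prod>i<k. \<alpha> i c x (\<lambda>_. w i)) * \<alpha> k c x (\<lambda>i. w (k + i)))" .
  have "\<alpha> k c x (\<lambda>i. w (k + i)) = \<alpha> k c x (\<lambda>_. w k)" for w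
    by (rule alternating_local[OF Suc.prems[of k]]) auto
  then show ?case using * by (simp only: prod.lessThan_Suc Suc_eq_plus1[symmetric])
qed

lemma wedge_power_alternate:
  assumes "alternating 2 (\<omega> c x)"
  shows "wedge_power r \<omega> c x
    = alternate (2 * r) (\<lambda>w. \<Prod>s<r. eval2 (\<omega> c x) (w (2 * s)) (w (2 * s + 1)) / 2)"
proof (induction r)
  case 0
  show ?case by (simp add: alternate_def)
next
  case (Suc r)
  have \<omega>: "\<omega> c x = alternate 2 (\<lambda>w. eval2 (\<omega> c x) (w 0) (w 1) / 2)"
    using alternate_2_antisym[of "eval2 (\<omega> c x)", OF alternating_2_swap[OF assms]]
      alternating_2_eval[OF assms] by (auto simp: fun_eq_iff)
  have "wedge_power (Suc r) \<omega> c x = wedge_alt (2 * r) 2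
      (alternate (2 * r) (\<lambda>w. \<Prod>s<r. eval2 (\<omega> c x) (w (2 * s)) (w (2 * s + 1)) / 2))
      (alternate 2 (\<lambda>w. eval2 (\<omega> c x) (w 0) (w 1) / 2))"
    unfolding \<omega>[symmetric] Suc[symmetric] by (simp add: wedge_def)
  also have "\<dots> = alternate (2 * r + 2) (\<lambda>w. (\<Prod>s<r. eval2 (\<omega> c x) (w (2 * s)) (w (2 * s + 1)) / 2)
      * (eval2 (\<omega> c x) (w (2 * r)) (w (2 * r + 1)) / 2))"
    by (subst wedge_alternate) auto
  finally show ?case by simp
qed

text \<open>
The product whose alternation is \<open>a\<^sub>0 \<and> \<dots> \<and> a\<^sub>k\<^sub>-\<^sub>1 \<and> \<omega>\<^sup>r\<close> when \<open>b\<close> is half of \<open>\<omega>\<close>.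
\<close>

definition block ::
  "nat \<Rightarrow> nat \<Rightarrow> (nat \<Rightarrow> 'v \<Rightarrow> real) \<Rightarrow> ('v \<Rightarrow> 'v \<Rightarrow> real) \<Rightarrow> 'v altmap" where
  "block k r a b w = (\<Prod>i<k. a i (w i)) * (\<Prod>s<r. b (w (k + 2 * s)) (w (k + 2 * s + 1)))"

lemma block_local: "(\<And>i. i < k + 2 * r \<Longrightarrow> w i = w' i) \<Longrightarrow> block k r a b w = block k r a b w'"
  unfolding block_def by (intro arg_cong2[where f="(*)"] prod.cong refl) auto

lemma top_form_alternate:
  assumes "\<And>i. i < k \<Longrightarrow> alternating 1 (\<alpha> i c x)" "alternating 2 (\<omega> c x)"
  shows "wedge k (2 * r) (wedge_family k \<alpha>) (wedge_power r \<omega>) c x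
    = alternate (k + 2 * r) (block k r (\<lambda>i u. \<alpha> i c x (\<lambda>_. u)) (\<lambda>u v. eval2 (\<omega> c x) u v / 2))"
proof -
  have 1: "wedge_family k \<alpha> c x = alternate k (\<lambda>w. \<Prod>i<k. \<alpha> i c x (\<lambda>_. w i))"
    by (rule wedge_family_alternate) (rule assms(1))
  have 2: "wedge_power r \<omega> c x
      = alternate (2 * r) (\<lambda>w. \<Prod>s<r. eval2 (\<omega> c x) (w (2 * s)) (w (2 * s + 1)) / 2)"
    by (rule wedge_power_alternate) (rule assms(2))
  show ?thesis
    unfolding wedge_def 1 2 by (subst wedge_alternate) (auto simp: block_def[abs_def] add.assoc)
qed

section \<open>Bivectors determined by contracting a volume form\<close>

text \<open>
Expanding the arguments one after the other in the basis reduces every value to values on basis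
vectors, which vanish if a vector is repeated and otherwise agree up to sign with the value on the
basis itself.
\<close>

lemma top_form_nonzero_on_basis:
  fixes \<phi> :: "nat \<Rightarrow> 'n::finite"
  assumes \<phi>: "bij_betw \<phi> {..<N} UNIV"
    and alt: "alternating N (alternate N g)" and nz: "alternate N g v \<noteq> 0"
  shows "alternate N g (\<lambda>i. axis (\<phi> i) (1::real)) \<noteq> 0"
proof
  let ?e = "\<lambda>i. axis (\<phi> i) (1::real)"
  assume z: "alternate N g ?e = 0"
  have "alternate N g v = 0" if "m \<le> N" "\<And>i. m \<le> i \<Longrightarrow> i < N \<Longrightarrow> \<exists>j<N. v i = ?e j" for m v
    using that
  proof (induction m arbitrary: v)
    case 0
    then obtain f where f: "\<And>i. i < N \<Longrightarrow> f i < N \<and> v i = ?e (f i)" by (metis le0)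
    show ?case
    proof (cases "inj_on f {..<N}")
      case True
      define \<sigma> where "\<sigma> i = (if i < N then f i else i)" for i
      have "\<sigma> permutes {..<N}"
      proof (rule bij_imp_permutes)
        have "inj_on \<sigma> {..<N}" using True by (auto simp: \<sigma>_def inj_on_def)
        moreover have "\<sigma> ` {..<N} \<subseteq> {..<N}" using f by (auto simp: \<sigma>_def)
        ultimately show "bij_betw \<sigma> {..<N} {..<N}"
          by (simp add: bij_betw_def endo_inj_surj)
      qed (simp add: \<sigma>_def)
      moreover have "alternate N g v = alternate N g (\<lambda>i. ?e (\<sigma> i))"
        by (rule alternating_local[OF alt]) (use f in \<open>auto simp: \<sigma>_def\<close>)
      ultimately show ?thesis using z by (simp add: alternate_permute[of \<sigma> N g ?e])
    next
      case False
      then obtain i j where "i < N" "j < N" "i \<noteq> j" "f i = f j" by (auto simp: inj_on_def)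
      then show ?thesis using f by (intro alternate_repeated[of i N j]) auto
    qed
  next
    case (Suc m)
    let ?L = "\<lambda>u. alternate N g (v(m := u))"
    have lin: "linear ?L" using Suc by (intro alternating_linear[OF alt]) auto
    have "v m = (\<Sum>j\<in>UNIV. (v m $ j) *\<^sub>R axis j 1)"
      by (metis (no_types) basis_expansion scalar_mult_eq_scaleR)
    then have "?L (v m) = ?L (\<Sum>j\<in>UNIV. (v m $ j) *\<^sub>R axis j 1)" by simp
    also have "\<dots> = (\<Sum>j\<in>UNIV. (v m $ j) * ?L (axis j 1))"
      by (simp add: linear_sum[OF lin] linear_scale[OF lin])
    also have "\<dots> = 0"
    proof (intro sum.neutral ballI)
      fix j
      obtain j' where j': "j' < N" "j = \<phi> j'" using \<phi> by (metis UNIV_I bij_betw_iff_bijections lessThan_iff)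
      have "?L (axis j 1) = 0"
      proof (rule Suc.IH)
        show "\<exists>ja<N. (v(m := axis j 1)) i = ?e ja" if "m \<le> i" "i < N" for i
          using that j' Suc.prems(2)[of i] by (cases "i = m") auto
      qed (use Suc in auto)
      then show "v m $ j * ?L (axis j 1) = 0" by simp
    qed
    finally show ?case by simp
  qed
  from this[of N v] nz show False by simp
qed

text \<open>
A derivation acts on a form of top degree as multiplication by its trace; the endomorphism
\<open>x \<mapsto> (\<xi> \<bullet> x) u\<close> has trace \<open>\<xi> \<bullet> u\<close>.
\<close>

lemma top_form_trace:
  fixes \<phi> :: "nat \<Rightarrow> 'n::finite"
  assumes \<phi>: "bij_betw \<phi> {..<N} UNIV" and alt: "alternating N (alternate N g)"
  defines "e \<equiv> \<lambda>i. axis (\<phi> i) (1::real)"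
  shows "(\<Sum>i<N. alternate N g (e(i := (\<xi> \<bullet> e i) *\<^sub>R u))) = (\<xi> \<bullet> u) * alternate N g e"
proof -
  have "alternate N g (e(i := (\<xi> \<bullet> e i) *\<^sub>R u)) = \<xi> $ \<phi> i * u $ \<phi> i * alternate N g e" if i: "i < N" for i
  proof -
    let ?L = "\<lambda>u. alternate N g (e(i := u))"
    have lin: "linear ?L" using i by (intro alternating_linear[OF alt]) auto
    have "?L (e j) = 0" if "j < N" "j \<noteq> i" for j
      using i that by (intro alternate_repeated[of i N j]) auto
    then have L: "?L (e j) = (if j = i then alternate N g e else 0)" if "j < N" for j
      using that by simp
    have "u = (\<Sum>j\<in>UNIV. (u $ j) *\<^sub>R axis j 1)"
      by (metis (no_types) basis_expansion scalar_mult_eq_scaleR)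
    also have "\<dots> = (\<Sum>j<N. (u $ \<phi> j) *\<^sub>R e j)"
      unfolding e_def by (rule sum.reindex_bij_betw[OF \<phi>, symmetric])
    finally have "?L u = ?L (\<Sum>j<N. (u $ \<phi> j) *\<^sub>R e j)" by simp
    also have "\<dots> = (\<Sum>j<N. (u $ \<phi> j) * ?L (e j))"
      by (simp add: linear_sum[OF lin] linear_scale[OF lin])
    also have "\<dots> = (\<Sum>j<N. if j = i then u $ \<phi> j * alternate N g e else 0)"
      by (rule sum.cong) (simp_all add: L)
    also have "\<dots> = u $ \<phi> i * alternate N g e" using i by simp
    finally have "?L u = u $ \<phi> i * alternate N g e" .
    moreover have "\<xi> \<bullet> e i = \<xi> $ \<phi> i" by (simp add: inner_axis e_def)
    ultimately show ?thesis using linear_scale[OF lin, of "\<xi> \<bullet> e i" u] by simp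
  qed
  then have "(\<Sum>i<N. alternate N g (e(i := (\<xi> \<bullet> e i) *\<^sub>R u))) = (\<Sum>i<N. \<xi> $ \<phi> i * u $ \<phi> i) * alternate N g e"
    by (simp add: sum_distrib_right)
  also have "(\<Sum>i<N. \<xi> $ \<phi> i * u $ \<phi> i) = (\<Sum>j\<in>UNIV. \<xi> $ j * u $ j)"
    by (rule sum.reindex_bij_betw[OF \<phi>])
  also have "\<dots> = \<xi> \<bullet> u" by (simp add: inner_vec_def)
  finally show ?thesis .
qed

text \<open>
A contraction with a bivector, tested on the first \<open>p\<close> of \<open>p + 2\<close> vectors: a term survives only if the
two inserted vectors are the remaining ones, and the two orders of these contribute equally.
\<close>

lemma alternate_double_contraction:
  assumes alt: "\<And>w w'. (\<And>i. i < p + 2 \<Longrightarrow> w i = w' i) \<Longrightarrow> g w = g w'"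
    and f: "\<And>i j. f j i = - f i (j::nat)"
  shows "(\<Sum>i<p+2. \<Sum>j<p+2. f i j * alternate (p + 2) g (case_nat (w i) (case_nat (w j) w)))
    = 2 * (f p (p + 1) * alternate (p + 2) g w)"
proof -
  let ?E = "\<lambda>i j. alternate (p + 2) g (case_nat (w i) (case_nat (w j) w))"
  have z: "?E i j = 0" if "i < p \<or> j < p \<or> i = j" for i j
  proof -
    have "?E i j = 0" if "i < p" using that by (intro alternate_repeated[of 0 _ "i + 2"]) auto
    moreover have "?E i j = 0" if "j < p" using that by (intro alternate_repeated[of 1 _ "j + 2"]) auto
    moreover have "?E i j = 0" if "i = j" using that by (intro alternate_repeated[of 0 _ 1]) auto
    ultimately show ?thesis using that by blast
  qed
  \<comment> \<open>\<open>\<kappa>\<close> shifts the indices cyclically; applied twice it brings the last two to the front, and a square is even.\<close>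
  define \<kappa> where "\<kappa> i = (if i = 0 then p + 1 else if i < p + 2 then i - 1 else i)" for i
  have \<kappa>: "\<kappa> permutes {..<p+2}"
  proof (rule bij_imp_permutes)
    have "inj_on \<kappa> {..<p+2}" by (auto simp: \<kappa>_def inj_on_def)
    moreover have "\<kappa> ` {..<p+2} \<subseteq> {..<p+2}" by (auto simp: \<kappa>_def)
    ultimately show "bij_betw \<kappa> {..<p+2} {..<p+2}" by (simp add: bij_betw_def endo_inj_surj)
  qed (simp add: \<kappa>_def)
  have "case_nat (w p) (case_nat (w (p + 1)) w) i = w ((\<kappa> \<circ> \<kappa>) i)" if "i < p + 2" for i
    using that by (auto simp: \<kappa>_def split: nat.split)
  then have "?E p (p + 1) = alternate (p + 2) g (\<lambda>i. w ((\<kappa> \<circ> \<kappa>) i))"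
    by (intro alternate_local alt)
  also have "\<dots> = alternate (p + 2) g w"
    using alternate_permute[OF permutes_compose[OF \<kappa> \<kappa>]] by (simp add: sign_perm_compose[OF \<kappa> \<kappa>])
  finally have E1: "?E p (p + 1) = alternate (p + 2) g w" .
  have "?E (p + 1) p = alternate (p + 2) g
      (\<lambda>i. case_nat (w p) (case_nat (w (p + 1)) w) (Transposition.transpose 0 1 i))"
    by (rule arg_cong[where f="alternate (p + 2) g"])
      (auto simp: Transposition.transpose_def fun_eq_iff split: nat.split)
  also have "\<dots> = - ?E p (p + 1)"
    by (subst alternate_permute) (auto intro!: permutes_swap_id simp: sign_swap_id)
  finally have E2: "?E (p + 1) p = - alternate (p + 2) g w" using E1 by simp
  show ?thesis using E1 E2 f[of "p+1" p] by (simp add: z[simplified])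
qed

text \<open>
Each pair of distinct values is taken equally often, because composition with a permutation moves
any such pair to any other, and fixing the last two indices leaves \<open>p!\<close> permutations.
\<close>

lemma sum_permutations_two_values:
  "(\<Sum>\<sigma> | \<sigma> permutes {..<p+2}. f (\<sigma> p) (\<sigma> (p + 1)))
    = fact p * (\<Sum>i<p+2. \<Sum>j<p+2. if i = j then 0 else f i (j::nat) :: real)"
proof -
  let ?N = "{..<p+2}"
  let ?S = "{\<sigma>. \<sigma> permutes ?N}"
  let ?C = "\<lambda>y. {\<sigma>. \<sigma> \<in> ?S \<and> (\<sigma> p, \<sigma> (p + 1)) = y}"
  let ?D = "{(i, j). i \<in> ?N \<and> j \<in> ?N \<and> i \<noteq> j}"
  have card: "card (?C (i, j)) = fact p" if ij: "i < p + 2" "j < p + 2" "i \<noteq> j" for i j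
  proof -
    \<comment> \<open>\<open>\<rho>\<close> carries the pair \<open>(i, j)\<close> to \<open>(p, p + 1)\<close>; the first transposition may have moved \<open>j\<close>.\<close>
    define \<rho> where "\<rho> = Transposition.transpose (Transposition.transpose i p j) (p + 1) \<circ> Transposition.transpose i p"
    have \<rho>: "\<rho> permutes ?N" "\<rho> i = p" "\<rho> j = p + 1"
      unfolding \<rho>_def using ij
      by (auto intro!: permutes_compose permutes_swap_id simp: Transposition.transpose_def)
    have "bij_betw ((\<circ>) \<rho>) (?C (i, j)) (?C (p, p + 1))"
    proof (rule bij_betw_byWitness[where f'="(\<circ>) (inv \<rho>)"])
      have "inv \<rho> p = i" "inv \<rho> (p + 1) = j"
        using \<rho> by (metis permutes_inverses(2))+
      then show "(\<circ>) (inv \<rho>) ` ?C (p, p + 1) \<subseteq> ?C (i, j)"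
        using permutes_inv[OF \<rho>(1)] by (auto intro: permutes_compose)
      show "(\<circ>) \<rho> ` ?C (i, j) \<subseteq> ?C (p, p + 1)" using \<rho> by (auto intro: permutes_compose)
    qed (use \<rho>(1) in \<open>auto simp: o_assoc permutes_inv_o\<close>)
    moreover have "?C (p, p + 1) = {\<sigma>. \<sigma> permutes {..<p}}"
    proof (rule set_eqI)
      fix \<sigma>
      have "\<sigma> permutes ?N \<and> \<sigma> p = p \<and> \<sigma> (p + 1) = p + 1 \<longleftrightarrow> \<sigma> permutes {..<p}"
      proof (intro iffI conjI; (elim conjE)?)
        assume \<sigma>: "\<sigma> permutes ?N" "\<sigma> p = p" "\<sigma> (p + 1) = p + 1"
        have "\<sigma> i = i" if "i \<in> ?N - {..<p}" for i
        proof -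
          from that have "i = p \<or> i = p + 1" by auto
          then show ?thesis using \<sigma>(2,3) by (elim disjE) simp_all
        qed
        then show "\<sigma> permutes {..<p}" by (rule permutes_superset[OF \<sigma>(1)])
      next
        assume \<sigma>: "\<sigma> permutes {..<p}"
        show "\<sigma> permutes ?N" by (rule permutes_lessThan_mono[OF \<sigma>])
        show "\<sigma> p = p" "\<sigma> (p + 1) = p + 1" by (rule permutes_not_in[OF \<sigma>]; simp)+
      qed
      then show "\<sigma> \<in> ?C (p, p + 1) \<longleftrightarrow> \<sigma> \<in> {\<sigma>. \<sigma> permutes {..<p}}" by simp
    qed
    ultimately show ?thesis by (auto dest!: bij_betw_same_card simp: card_permutations)
  qed
  have fin: "finite ?S" "finite ?D"
    by (auto intro: finite_permutations finite_subset[of _ "?N \<times> ?N"])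
  have "(\<Sum>\<sigma>\<in>?S. f (\<sigma> p) (\<sigma> (p + 1))) = (\<Sum>y\<in>?D. \<Sum>\<sigma>\<in>?C y. f (\<sigma> p) (\<sigma> (p + 1)))"
  proof -
    have "(\<lambda>\<sigma>. (\<sigma> p, \<sigma> (p + 1))) ` ?S \<subseteq> ?D"
    proof (rule image_subsetI)
      fix \<sigma> assume "\<sigma> \<in> ?S"
      then have \<sigma>: "\<sigma> permutes ?N" by simp
      show "(\<sigma> p, \<sigma> (p + 1)) \<in> ?D"
        using permutes_in_image[OF \<sigma>, of p] permutes_in_image[OF \<sigma>, of "p + 1"]
          inj_eq[OF permutes_inj[OF \<sigma>], of p "p + 1"] by simp
    qed
    from sum.group[OF fin this, of "\<lambda>\<sigma>. f (\<sigma> p) (\<sigma> (p + 1))"] show ?thesis by (rule sym)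
  qed
  also have "\<dots> = (\<Sum>(i, j)\<in>?D. \<Sum>\<sigma>\<in>?C (i, j). f i j)"
    by (intro sum.cong refl) auto
  also have "\<dots> = (\<Sum>(i, j)\<in>?D. fact p * f i j)"
    by (intro sum.cong refl) (auto simp: card[simplified])
  also have "\<dots> = (\<Sum>(i, j)\<in>?N \<times> ?N. if i = j then 0 else fact p * f i j)"
    by (intro sum.mono_neutral_cong_left) auto
  also have "\<dots> = (\<Sum>i\<in>?N. \<Sum>j\<in>?N. if i = j then 0 else fact p * f i j)"
    by (rule sum.cartesian_product[symmetric])
  also have "\<dots> = fact p * (\<Sum>i\<in>?N. \<Sum>j\<in>?N. if i = j then 0 else f i j)"
    unfolding sum_distrib_left by (intro sum.cong refl) simp
  finally show ?thesis .
qed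

lemma sum_lessThan_pairs:
  fixes f :: "nat \<Rightarrow> real"
  shows "(\<Sum>i<k + 2 * r. f i) = (\<Sum>i<k. f i) + (\<Sum>s<r. f (k + 2 * s) + f (k + 2 * s + 1))"
  by (induction r) (simp_all add: add.assoc)

definition block_with ::
  "nat \<Rightarrow> nat \<Rightarrow> (nat \<Rightarrow> 'v \<Rightarrow> real) \<Rightarrow> ('v \<Rightarrow> 'v \<Rightarrow> real) \<Rightarrow> nat \<Rightarrow> ('v \<Rightarrow> 'v \<Rightarrow> real) \<Rightarrow> 'v altmap" where
  "block_with k r a b s \<theta> w = (\<Prod>i<k. a i (w i)) *
     (\<Prod>t\<in>{..<r} - {s}. b (w (k + 2 * t)) (w (k + 2 * t + 1))) * \<theta> (w (k + 2 * s)) (w (k + 2 * s + 1))"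

text \<open>
The Leibniz rule: the terms in which \<open>B\<close> acts on a one-form vanish, and each two-form yields two.
\<close>

lemma block_derivation:
  assumes a: "\<And>i x. i < k \<Longrightarrow> a i (B x) = 0"
  shows "(\<Sum>i<k + 2 * r. block k r a b (w(i := B (w i))))
    = (\<Sum>s<r. block_with k r a b s (\<lambda>x y. b (B x) y + b x (B y)) w)"
proof -
  have 0: "block k r a b (w(i := B (w i))) = 0" if "i < k" for i
    unfolding block_def using that a by (intro mult_eq_0_iff[THEN iffD2] disjI1 prod_zero) auto
  have pair: "block k r a b (w(k + 2 * s := B (w (k + 2 * s)))) + block k r a b (w(k + 2 * s + 1 := B (w (k + 2 * s + 1))))
      = block_with k r a b s (\<lambda>x y. b (B x) y + b x (B y)) w" if s: "s < r" for s
  proof -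
    have split: "block k r a b v = (\<Prod>i<k. a i (w i)) *
        (\<Prod>t\<in>{..<r} - {s}. b (w (k + 2 * t)) (w (k + 2 * t + 1))) * b (v (k + 2 * s)) (v (k + 2 * s + 1))"
      if "\<And>i. i \<noteq> k + 2 * s \<Longrightarrow> i \<noteq> k + 2 * s + 1 \<Longrightarrow> v i = w i" for v
    proof -
      have "(\<Prod>t<r. b (v (k + 2 * t)) (v (k + 2 * t + 1)))
          = b (v (k + 2 * s)) (v (k + 2 * s + 1)) * (\<Prod>t\<in>{..<r} - {s}. b (v (k + 2 * t)) (v (k + 2 * t + 1)))"
        using s by (intro prod.remove) auto
      moreover have "(\<Prod>t\<in>{..<r} - {s}. b (v (k + 2 * t)) (v (k + 2 * t + 1)))
          = (\<Prod>t\<in>{..<r} - {s}. b (w (k + 2 * t)) (w (k + 2 * t + 1)))"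
        by (intro prod.cong refl arg_cong2[where f=b] that) auto
      moreover have "(\<Prod>i<k. a i (v i)) = (\<Prod>i<k. a i (w i))"
        by (intro prod.cong refl arg_cong[where f="a _"] that) auto
      ultimately show ?thesis by (simp add: block_def)
    qed
    have "block k r a b (w(k + 2 * s := B (w (k + 2 * s)))) = (\<Prod>i<k. a i (w i)) *
        (\<Prod>t\<in>{..<r} - {s}. b (w (k + 2 * t)) (w (k + 2 * t + 1))) * b (B (w (k + 2 * s))) (w (k + 2 * s + 1))"
      by (subst split) auto
    moreover have "block k r a b (w(k + 2 * s + 1 := B (w (k + 2 * s + 1)))) = (\<Prod>i<k. a i (w i)) *
        (\<Prod>t\<in>{..<r} - {s}. b (w (k + 2 * t)) (w (k + 2 * t + 1))) * b (w (k + 2 * s)) (B (w (k + 2 * s + 1)))"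
      by (subst split) auto
    ultimately show ?thesis by (simp add: block_with_def distrib_left)
  qed
  have "(\<Sum>s<r. block k r a b (w(k + 2 * s := B (w (k + 2 * s)))) + block k r a b (w(k + 2 * s + 1 := B (w (k + 2 * s + 1)))))
      = (\<Sum>s<r. block_with k r a b s (\<lambda>x y. b (B x) y + b x (B y)) w)"
    by (intro sum.cong refl pair) simp
  moreover have "(\<Sum>i<k. block k r a b (w(i := B (w i)))) = 0" by (intro sum.neutral ballI 0) simp
  ultimately show ?thesis unfolding sum_lessThan_pairs by simp
qed

text \<open>
Exchanging two pairs of slots is an even permutation, so it does not matter which factor \<open>b\<close> was
replaced by \<open>\<theta>\<close>. This is the commutativity of two-forms that produces the factor \<open>r\<close> in the derivative
of an \<open>r\<close>-th power.
\<close>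

lemma alternate_block_with:
  assumes s: "s \<le> m"
  shows "alternate (k + 2 * Suc m) (block_with k (Suc m) a b s \<theta>) v
    = alternate (k + 2 * Suc m) (\<lambda>w. block k m a b w * \<theta> (w (k + 2 * m)) (w (k + 2 * m + 1))) v"
proof (cases "s = m")
  case True
  have "{..<Suc m} - {m} = {..<m}" by auto
  then show ?thesis by (simp add: True block_with_def[abs_def] block_def)
next
  case False
  let ?N = "k + 2 * Suc m"
  let ?\<tau> = "Transposition.transpose (k + 2 * s) (k + 2 * m) \<circ> Transposition.transpose (k + 2 * s + 1) (k + 2 * m + 1)"
  have perm: "Transposition.transpose (k + 2 * s) (k + 2 * m) permutes {..<?N}"
    "Transposition.transpose (k + 2 * s + 1) (k + 2 * m + 1) permutes {..<?N}"
    using s by (auto intro!: permutes_swap_id)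
  then have sgn: "sign ?\<tau> = 1" using False by (simp only: sign_perm_compose) (simp add: sign_swap_id)
  have \<tau>: "?\<tau> permutes {..<?N}" using perm by (intro permutes_compose)
  have pairs: "?\<tau> (k + 2 * t) = k + 2 * Transposition.transpose s m t"
    "?\<tau> (k + 2 * t + 1) = k + 2 * Transposition.transpose s m t + 1" for t
    by (auto simp: Transposition.transpose_def)
  have low: "?\<tau> i = i" if "i < k" for i using that by (auto simp: Transposition.transpose_def)
  have bij: "bij_betw (Transposition.transpose s m) {..<m} ({..<Suc m} - {s})"
    by (rule bij_betw_byWitness[where f'="Transposition.transpose s m"])
      (use s False in \<open>auto simp: Transposition.transpose_def\<close>)
  have "block_with k (Suc m) a b s \<theta> = (\<lambda>w. (\<lambda>w. block k m a b w * \<theta> (w (k + 2 * m)) (w (k + 2 * m + 1))) (\<lambda>i. w (?\<tau> i)))"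
  proof
    fix w
    have "(\<Prod>t<m. b (w (?\<tau> (k + 2 * t))) (w (?\<tau> (k + 2 * t + 1))))
        = (\<Prod>t\<in>{..<Suc m} - {s}. b (w (k + 2 * t)) (w (k + 2 * t + 1)))"
      unfolding pairs
      by (rule prod.reindex_bij_betw[OF bij, of "\<lambda>t. b (w (k + 2 * t)) (w (k + 2 * t + 1))"])
    moreover have "(\<Prod>i<k. a i (w (?\<tau> i))) = (\<Prod>i<k. a i (w i))"
      by (rule prod.cong[OF refl]) (simp only: low lessThan_iff)
    moreover have "?\<tau> (k + 2 * m) = k + 2 * s" "?\<tau> (k + 2 * m + 1) = k + 2 * s + 1"
      unfolding pairs by simp_all
    ultimately show "block_with k (Suc m) a b s \<theta> w
        = block k m a b (\<lambda>i. w (?\<tau> i)) * \<theta> (w (?\<tau> (k + 2 * m))) (w (?\<tau> (k + 2 * m + 1)))"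
      unfolding block_with_def block_def by (simp only:)
  qed
  then show ?thesis
    using alternate_slots[OF \<tau>, of "\<lambda>w. block k m a b w * \<theta> (w (k + 2 * m)) (w (k + 2 * m + 1))" v]
    by (simp only: sgn)
qed

text \<open>
The endomorphism \<open>x \<mapsto> (\<xi> \<bullet> x) u\<close> maps into the common kernel of the \<open>a i\<close>, and acting as a derivation it
turns \<open>b\<close> into a two-form \<open>\<theta>\<close>. Both sides of the contraction identity are wedged with \<open>\<theta>\<close> and evaluated
on the standard basis: one side gives the trace \<open>\<xi> \<bullet> u\<close>, the other pairs \<open>P\<close> with \<open>\<theta>\<close>. The factor \<open>2\<close>
appears because \<open>b\<close> stands for half of a two-form.
\<close>

lemma inverse_on_kernel:
  fixes P b :: "real^'n::finite \<Rightarrow> real^'n \<Rightarrow> real"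
  assumes N: "CARD('n) = k + 2 * r"
    and alt: "alternating (k + 2 * r) (alternate (k + 2 * r) (block k r a b))"
    and nz: "alternate (k + 2 * r) (block k r a b) v \<noteq> 0"
    and b: "\<And>u. linear (b u)" "\<And>u v. b v u = - b u v"
    and P: "\<And>\<eta>. linear (P \<eta>)" "\<And>\<eta> \<beta>. P \<beta> \<eta> = - P \<eta> \<beta>"
    and a: "\<And>i. i < k \<Longrightarrow> linear (a i)"
    and contraction: "\<And>v. (\<Sum>i\<in>UNIV. \<Sum>j\<in>UNIV. P (axis i 1) (axis j 1) *
        alternate (k + 2 * r) (block k r a b) (case_nat (axis i 1) (case_nat (axis j 1) v)))
      = 2 * (real r * alternate (k + 2 * (r - 1)) (block k (r - 1) a b) v)"
    and u: "\<And>i. i < k \<Longrightarrow> a i u = 0"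
  shows "2 * (\<Sum>j\<in>UNIV. P \<xi> (axis j 1) * b u (axis j 1)) = \<xi> \<bullet> u"
proof -
  obtain \<phi> :: "nat \<Rightarrow> 'n" where \<phi>: "bij_betw \<phi> {..<k + 2 * r} UNIV"
    using ex_bij_betw_nat_finite[of "UNIV :: 'n set"] N by (auto simp: atLeast0LessThan)
  define e where "e = (\<lambda>i. axis (\<phi> i) (1::real))"
  define \<Omega> where "\<Omega> = alternate (k + 2 * r) (block k r a b)"
  have \<Omega>e: "\<Omega> e \<noteq> 0"
    unfolding \<Omega>_def e_def by (rule top_form_nonzero_on_basis[OF \<phi> alt nz])
  define \<theta> where "\<theta> \<xi> x y = b ((\<xi> \<bullet> x) *\<^sub>R u) y + b x ((\<xi> \<bullet> y) *\<^sub>R u)" for \<xi> x y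
  have trace: "(\<xi> \<bullet> u) * \<Omega> e = (\<Sum>s<r. alternate (k + 2 * r) (block_with k r a b s (\<theta> \<xi>)) e)" for \<xi>
  proof -
    have "(\<xi> \<bullet> u) * \<Omega> e = (\<Sum>i<k + 2 * r. \<Omega> (e(i := (\<xi> \<bullet> e i) *\<^sub>R u)))"
      unfolding \<Omega>_def e_def using top_form_trace[OF \<phi> alt] by simp
    also have "\<dots> = alternate (k + 2 * r) (\<lambda>w. \<Sum>i<k + 2 * r. block k r a b (w(i := (\<xi> \<bullet> w i) *\<^sub>R u))) e"
      unfolding \<Omega>_def by (rule alternate_derivation)
    also have "\<dots> = alternate (k + 2 * r) (\<lambda>w. \<Sum>s<r. block_with k r a b s (\<theta> \<xi>) w) e"
    proof (rule alternate_cong)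
      fix w
      show "(\<Sum>i<k + 2 * r. block k r a b (w(i := (\<xi> \<bullet> w i) *\<^sub>R u))) = (\<Sum>s<r. block_with k r a b s (\<theta> \<xi>) w)"
        unfolding \<theta>_def
        by (rule block_derivation[where B="\<lambda>x. (\<xi> \<bullet> x) *\<^sub>R u"]) (simp add: linear_scale[OF a] u)
    qed
    finally show ?thesis by (simp add: alternate_sum)
  qed
  show ?thesis
  proof (cases r)
    case 0
    \<comment> \<open>For \<open>r = 0\<close> there is no two-form to act on, so that all \<open>\<xi> \<bullet> u\<close> vanish.\<close>
    then have "u \<bullet> u = 0" using trace[of u] \<Omega>e by simp
    then have "u = 0" by simp
    moreover have "b 0 y = 0" for y using b(2)[of y 0] linear_0[OF b(1)[of y]] by simp
    ultimately show ?thesis by simp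
  next
    case (Suc m)
    let ?p = "k + 2 * m"
    have N2: "k + 2 * r = ?p + 2" by (simp add: Suc)
    have \<theta>_antisym: "\<theta> \<xi> y x = - \<theta> \<xi> x y" for x y
      unfolding \<theta>_def using b(2)[of "(\<xi> \<bullet> y) *\<^sub>R u" x] b(2)[of y "(\<xi> \<bullet> x) *\<^sub>R u"] by simp
    define \<Psi> where "\<Psi> = alternate ?p (block k m a b)"
    define c where "c = (\<lambda>v. \<Sum>i\<in>UNIV. \<Sum>j\<in>UNIV. P (axis i 1) (axis j 1) * \<Omega> (case_nat (axis i 1) (case_nat (axis j 1) v)))"
    have c: "c w = 2 * (real r * \<Psi> w)" for w
      using contraction[of w] unfolding c_def \<Omega>_def \<Psi>_def by (simp add: Suc)
    let ?\<theta> = "\<lambda>w. \<theta> \<xi> (w 0) (w 1)"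
    have "real r * (2 * wedge_alt ?p 2 \<Psi> ?\<theta> e) = (\<xi> \<bullet> u) * \<Omega> e"
    proof -
      have "wedge_alt ?p 2 \<Psi> ?\<theta> = wedge_alt ?p 2 \<Psi> (alternate 2 (\<lambda>w. \<theta> \<xi> (w 0) (w 1) / 2))"
        by (simp only: alternate_2_antisym[of "\<theta> \<xi>", OF \<theta>_antisym])
      also have "\<dots> = alternate (?p + 2) (\<lambda>w. block k m a b w * (\<theta> \<xi> (w ?p) (w (?p + 1)) / 2))"
        unfolding \<Psi>_def by (subst wedge_alternate) (auto intro: block_local)
      finally have A: "2 * wedge_alt ?p 2 \<Psi> ?\<theta> e
          = alternate (k + 2 * r) (\<lambda>w. block k m a b w * \<theta> \<xi> (w ?p) (w (?p + 1))) e"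
        unfolding N2
        using alternate_cmult[of "?p + 2" 2 "\<lambda>w. block k m a b w * (\<theta> \<xi> (w ?p) (w (?p + 1)) / 2)" e] by simp
      have "(\<xi> \<bullet> u) * \<Omega> e
          = (\<Sum>s<r. alternate (k + 2 * r) (\<lambda>w. block k m a b w * \<theta> \<xi> (w ?p) (w (?p + 1))) e)"
        unfolding trace Suc by (intro sum.cong refl alternate_block_with) simp
      then show ?thesis unfolding A by simp
    qed
    then have "wedge_alt ?p 2 c ?\<theta> e = (\<xi> \<bullet> u) * \<Omega> e"
      unfolding wedge_alt_def by (simp add: c sum_distrib_left sum_distrib_right sum_divide_distrib mult_ac)
    moreover have "wedge_alt ?p 2 c ?\<theta> e = (\<Sum>i<k + 2 * r. \<Sum>j<k + 2 * r. P (e i) (e j) * \<theta> \<xi> (e i) (e j)) * \<Omega> e"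
    proof -
      have cw: "of_int (sign \<sigma>) * c (\<lambda>i. e (\<sigma> i)) = 2 * (P (e (\<sigma> ?p)) (e (\<sigma> (?p + 1))) * \<Omega> e)"
        if \<sigma>: "\<sigma> permutes {..<k + 2 * r}" for \<sigma>
      proof -
        let ?w = "\<lambda>i. e (\<sigma> i)"
        have bij: "bij_betw (\<lambda>i. \<phi> (\<sigma> i)) {..<k + 2 * r} UNIV"
          using bij_betw_trans[OF permutes_imp_bij[OF \<sigma>] \<phi>] by (simp add: o_def)
        have "c ?w = (\<Sum>i<?p + 2. \<Sum>j<?p + 2. P (?w i) (?w j) * \<Omega> (case_nat (?w i) (case_nat (?w j) ?w)))"
          unfolding c_def e_def sum.reindex_bij_betw[OF bij, symmetric] N2 ..
        also have "\<dots> = 2 * (P (?w ?p) (?w (?p + 1)) * \<Omega> ?w)"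
          unfolding \<Omega>_def N2
          by (rule alternate_double_contraction) (auto intro!: block_local P(2) simp: Suc)
        also have "\<Omega> ?w = of_int (sign \<sigma>) * \<Omega> e"
          unfolding \<Omega>_def by (rule alternate_permute[OF \<sigma>])
        finally show ?thesis by (simp add: sign_def)
      qed
      have "wedge_alt ?p 2 c ?\<theta> e * (fact ?p * 2)
          = (\<Sum>\<sigma> | \<sigma> permutes {..<k + 2 * r}. of_int (sign \<sigma>) * c (\<lambda>i. e (\<sigma> i)) * \<theta> \<xi> (e (\<sigma> ?p)) (e (\<sigma> (?p + 1))))"
        unfolding wedge_alt_def N2 by simp
      also have "\<dots> = (\<Sum>\<sigma> | \<sigma> permutes {..<k + 2 * r}.
          2 * (P (e (\<sigma> ?p)) (e (\<sigma> (?p + 1))) * \<theta> \<xi> (e (\<sigma> ?p)) (e (\<sigma> (?p + 1)))) * \<Omega> e)"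
        by (rule sum.cong[OF refl]) (simp only: mem_Collect_eq cw mult_ac)
      also have "\<dots> = 2 * (\<Sum>\<sigma> | \<sigma> permutes {..<?p + 2}.
          P (e (\<sigma> ?p)) (e (\<sigma> (?p + 1))) * \<theta> \<xi> (e (\<sigma> ?p)) (e (\<sigma> (?p + 1)))) * \<Omega> e"
        unfolding N2 by (simp add: sum_distrib_left sum_distrib_right mult.assoc)
      also have "\<dots> = 2 * (fact ?p * (\<Sum>i<?p+2. \<Sum>j<?p+2. if i = j then 0 else P (e i) (e j) * \<theta> \<xi> (e i) (e j))) * \<Omega> e"
        by (subst sum_permutations_two_values[of "\<lambda>i j. P (e i) (e j) * \<theta> \<xi> (e i) (e j)" ?p]) simp
      also have "(\<Sum>i<?p+2. \<Sum>j<?p+2. if i = j then 0 else P (e i) (e j) * \<theta> \<xi> (e i) (e j))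
          = (\<Sum>i<?p+2. \<Sum>j<?p+2. P (e i) (e j) * \<theta> \<xi> (e i) (e j))"
      proof -
        have "P x x = 0" for x using P(2)[of x x] by simp
        then show ?thesis by (intro sum.cong refl) auto
      qed
      finally show ?thesis unfolding N2 by simp
    qed
    ultimately have "(\<Sum>i<k + 2 * r. \<Sum>j<k + 2 * r. P (e i) (e j) * \<theta> \<xi> (e i) (e j)) = \<xi> \<bullet> u"
      using \<Omega>e by simp
    also have "(\<Sum>i<k + 2 * r. \<Sum>j<k + 2 * r. P (e i) (e j) * \<theta> \<xi> (e i) (e j))
        = (\<Sum>i\<in>UNIV. \<Sum>j\<in>UNIV. P (axis i 1) (axis j 1) * \<theta> \<xi> (axis i 1) (axis j 1))"
      unfolding e_def sum.reindex_bij_betw[OF \<phi>, symmetric] ..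
    finally have main: "(\<Sum>i\<in>UNIV. \<Sum>j\<in>UNIV. P (axis i 1) (axis j 1) * \<theta> \<xi> (axis i 1) (axis j 1)) = \<xi> \<bullet> u" .
    have P\<xi>: "P \<xi> y = (\<Sum>i\<in>UNIV. \<xi> $ i * P (axis i 1) y)" for y
    proof -
      have "P \<xi> y = - P y (\<Sum>i\<in>UNIV. (\<xi> $ i) *\<^sub>R axis i 1)"
        using P(2)[of y \<xi>] by (metis (no_types) basis_expansion scalar_mult_eq_scaleR minus_minus)
      also have "\<dots> = (\<Sum>i\<in>UNIV. \<xi> $ i * - P y (axis i 1))"
        by (simp add: linear_sum[OF P(1)] linear_scale[OF P(1)] sum_negf)
      also have "\<dots> = (\<Sum>i\<in>UNIV. \<xi> $ i * P (axis i 1) y)" using P(2)[of _ y] by simp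
      finally show ?thesis .
    qed
    have bu: "b (t *\<^sub>R u) y = t * b u y" "b y (t *\<^sub>R u) = - (t * b u y)" for t y
      using b(2)[of y "t *\<^sub>R u"] b(2)[of y u] by (simp_all add: linear_scale[OF b(1)])
    have 1: "(\<Sum>i\<in>UNIV. \<Sum>j\<in>UNIV. P (axis i 1) (axis j 1) * (\<xi> $ i * b u (axis j 1)))
        = (\<Sum>j\<in>UNIV. P \<xi> (axis j 1) * b u (axis j 1))"
      unfolding P\<xi> sum_distrib_right by (subst sum.swap) (simp add: mult_ac)
    have 2: "(\<Sum>i\<in>UNIV. \<Sum>j\<in>UNIV. P (axis i 1) (axis j 1) * - (\<xi> $ j * b u (axis i 1)))
        = (\<Sum>j\<in>UNIV. P \<xi> (axis j 1) * b u (axis j 1))"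
      unfolding P\<xi> sum_distrib_right
      by (intro sum.cong refl) (subst P(2), simp add: mult_ac)
    have "(\<Sum>i\<in>UNIV. \<Sum>j\<in>UNIV. P (axis i 1) (axis j 1) * \<theta> \<xi> (axis i 1) (axis j 1))
        = (\<Sum>i\<in>UNIV. \<Sum>j\<in>UNIV. P (axis i 1) (axis j 1) * (\<xi> $ i * b u (axis j 1)))
        + (\<Sum>i\<in>UNIV. \<Sum>j\<in>UNIV. P (axis i 1) (axis j 1) * - (\<xi> $ j * b u (axis i 1)))"
      unfolding \<theta>_def bu sum.distrib[symmetric] by (simp add: inner_axis algebra_simps)
    then show ?thesis using main 1 2 by simp
  qed
qed

section \<open>Recovering the factors of a wedge product\<close>

text \<open>
Only permutations that do not mix the two groups of arguments contribute. Such a permutation splits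
into a permutation of either group, whose signs cancel against those of \<open>a\<close> and \<open>b\<close>, so that the wedge
product is a positive multiple of the product of the two values.
\<close>

lemma wedge_alt_zero_factor:
  assumes a: "\<And>\<sigma> w. \<sigma> permutes {..<p} \<Longrightarrow> a (\<lambda>i. w (\<sigma> i)) = of_int (sign \<sigma>) * a w"
    and a_local: "\<And>w w'. (\<And>i. i < p \<Longrightarrow> w i = w' i) \<Longrightarrow> a w = a w'"
    and b: "\<And>\<sigma> w. \<sigma> permutes {..<q} \<Longrightarrow> b (\<lambda>i. w (\<sigma> i)) = of_int (sign \<sigma>) * b w"
    and b_local: "\<And>w w'. (\<And>i. i < q \<Longrightarrow> w i = w' i) \<Longrightarrow> b w = b w'"
    and separated: "\<And>\<sigma> i. i < p \<Longrightarrow> p \<le> \<sigma> i \<Longrightarrow> \<sigma> permutes {..<p + q} \<Longrightarrow> a (\<lambda>i. w (\<sigma> i)) = 0"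
    and zero: "wedge_alt p q a b w = 0"
  shows "a w * b (\<lambda>i. w (p + i)) = 0"
proof -
  let ?c = "a w * b (\<lambda>i. w (p + i))"
  let ?S = "{\<sigma>. \<sigma> permutes {..<p + q}}"
  let ?G = "{\<sigma> \<in> ?S. \<forall>i<p. \<sigma> i < p}"
  let ?t = "\<lambda>\<sigma>. of_int (sign \<sigma>) * a (\<lambda>i. w (\<sigma> i)) * b (\<lambda>i. w (\<sigma> (p + i)))"
  have fin: "finite ?S" by (rule finite_permutations) simp
  have good: "?t \<sigma> = ?c" if \<sigma>: "\<sigma> permutes {..<p + q}" and pres: "\<And>i. i < p \<Longrightarrow> \<sigma> i < p" for \<sigma>
  proof -
    \<comment> \<open>The two parts of \<open>\<sigma>\<close>: its action on the first \<open>p\<close> arguments and on the remaining ones.\<close>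
    define \<sigma>1 where "\<sigma>1 i = (if i < p then \<sigma> i else i)" for i
    define \<sigma>2 where "\<sigma>2 i = \<sigma> (p + i) - p" for i
    have inj: "\<sigma> i = \<sigma> j \<longleftrightarrow> i = j" for i j using permutes_inj[OF \<sigma>] by (simp add: inj_eq)
    have \<sigma>1: "\<sigma>1 permutes {..<p}"
    proof (rule bij_imp_permutes)
      have "inj_on \<sigma>1 {..<p}" "\<sigma>1 ` {..<p} \<subseteq> {..<p}" using pres by (auto simp: \<sigma>1_def inj_on_def inj)
      then show "bij_betw \<sigma>1 {..<p} {..<p}" by (simp add: bij_betw_def endo_inj_surj)
    qed (simp add: \<sigma>1_def)
    have high: "p \<le> \<sigma> (p + i)" for i
    proof (rule ccontr)
      assume "\<not> p \<le> \<sigma> (p + i)"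
      then obtain j where "j < p" "\<sigma>1 j = \<sigma> (p + i)"
        using permutes_image[OF \<sigma>1] by (metis imageE lessThan_iff not_le)
      then show False by (simp add: \<sigma>1_def inj)
    qed
    have \<sigma>2: "\<sigma>2 permutes {..<q}"
    proof (rule bij_imp_permutes)
      have "inj_on \<sigma>2 {..<q}" unfolding \<sigma>2_def inj_on_def using high
        by (metis add_left_cancel eq_diff_iff inj)
      moreover have "\<sigma>2 ` {..<q} \<subseteq> {..<q}"
      proof (rule image_subsetI)
        fix i assume "i \<in> {..<q}"
        then have "\<sigma> (p + i) < p + q" using permutes_in_image[OF \<sigma>, of "p + i"] by simp
        then show "\<sigma>2 i \<in> {..<q}" using high[of i] by (simp add: \<sigma>2_def)
      qed
      ultimately show "bij_betw \<sigma>2 {..<q} {..<q}" by (simp add: bij_betw_def endo_inj_surj)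
      show "\<sigma>2 i = i" if "i \<notin> {..<q}" for i
        using that permutes_not_in[OF \<sigma>, of "p + i"] by (simp add: \<sigma>2_def)
    qed
    have "\<sigma> = \<sigma>1 \<circ> shift_perm p \<sigma>2"
    proof
      fix i
      show "\<sigma> i = (\<sigma>1 \<circ> shift_perm p \<sigma>2) i"
      proof (cases "i < p")
        case False
        then obtain j where "i = p + j" by (metis le_Suc_ex not_le)
        then show ?thesis using high[of j] by (simp add: \<sigma>1_def \<sigma>2_def shift_perm_def)
      qed (simp add: \<sigma>1_def shift_perm_def)
    qed
    then have sgn: "sign \<sigma> = sign \<sigma>1 * sign \<sigma>2"
      using sign_perm_compose[OF permutes_lessThan_mono[OF \<sigma>1] shift_perm(1)[OF \<sigma>2]] shift_perm(2)[OF \<sigma>2]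
      by metis
    have "a (\<lambda>i. w (\<sigma> i)) = a (\<lambda>i. w (\<sigma>1 i))" by (rule a_local) (simp add: \<sigma>1_def)
    moreover have "b (\<lambda>i. w (\<sigma> (p + i))) = b (\<lambda>i. w (p + \<sigma>2 i))"
      by (rule b_local) (simp add: \<sigma>2_def high)
    ultimately show ?thesis
      using a[OF \<sigma>1, of w] b[OF \<sigma>2, of "\<lambda>i. w (p + i)"] by (simp add: sgn) (simp add: sign_def)
  qed
  have "0 = (\<Sum>\<sigma>\<in>?S. ?t \<sigma>)" using zero by (simp add: wedge_alt_def)
  also have "\<dots> = (\<Sum>\<sigma>\<in>?G. ?t \<sigma>)"
  proof (rule sum.mono_neutral_right[OF fin])
    show "\<forall>\<sigma>\<in>?S - ?G. ?t \<sigma> = 0"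
    proof
      fix \<sigma> assume "\<sigma> \<in> ?S - ?G"
      then obtain i where "i < p" "p \<le> \<sigma> i" "\<sigma> permutes {..<p + q}" by (auto simp: not_less)
      then have "a (\<lambda>i. w (\<sigma> i)) = 0" by (rule separated)
      then show "?t \<sigma> = 0" by simp
    qed
  qed auto
  also have "\<dots> = (\<Sum>\<sigma>\<in>?G. ?c)" by (intro sum.cong refl good) auto
  also have "\<dots> = real (card ?G) * ?c" by simp
  finally have "real (card ?G) * ?c = 0" by simp
  moreover have "id \<in> ?G" by (simp add: permutes_id)
  then have "card ?G \<noteq> 0"
    using fin by (metis (no_types, lifting) card_0_eq empty_iff finite_subset mem_Collect_eq subsetI)
  moreover have "x = 0" if "real n * x = 0" "n \<noteq> 0" for x n using that by simp
  ultimately show ?thesis by blast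
qed

section \<open>Smooth functions on open sets\<close>

lemma Ck_on_Suc_imp: "Ck_on (Suc k) S f \<Longrightarrow> Ck_on k S f"
proof (induction k arbitrary: f)
  case 0
  then show ?case by (auto intro!: continuous_at_imp_continuous_on differentiable_imp_continuous_within)
qed auto

lemma Ck_on_cong:
  assumes "open S" "\<And>x. x \<in> S \<Longrightarrow> f x = g x" "Ck_on k S f"
  shows "Ck_on k S g"
  using assms(2,3)
proof (induction k arbitrary: f g)
  case 0
  then show ?case by (auto cong: continuous_on_cong)
next
  case (Suc k)
  have "fderiv f x = fderiv g x" if "x \<in> S" for x
    using Suc.prems that by (intro frechet_derivative_transform_within_open[OF _ assms(1)]) auto
  moreover have "g differentiable at x" if "x \<in> S" for x
  proof -
    have "(f has_derivative fderiv f x) (at x)"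
      using Suc.prems(2) that by (simp add: frechet_derivative_works)
    then have "(g has_derivative fderiv f x) (at x)"
      by (rule has_derivative_transform_within_open[OF _ assms(1) that Suc.prems(1)])
    then show ?thesis by (rule differentiableI)
  qed
  ultimately show ?case using Suc.prems Suc.IH[of "\<lambda>x. fderiv f x v" "\<lambda>x. fderiv g x v" for v] by auto
qed

lemma Ck_on_const: "Ck_on k S (\<lambda>x. c)"
  by (induction k arbitrary: c) auto

lemma Ck_on_bounded_linear:
  assumes L: "bounded_linear L" and "open S" "Ck_on k S f"
  shows "Ck_on k S (\<lambda>x. L (f x))"
  using assms(3)
proof (induction k arbitrary: f)
  case 0
  then show ?case by (simp add: bounded_linear.continuous_on[OF L])
next
  case (Suc k)
  have der: "((\<lambda>x. L (f x)) has_derivative (\<lambda>v. L (fderiv f x v))) (at x)" if "x \<in> S" for x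
    using Suc.prems that
    by (intro bounded_linear.has_derivative[OF L]) (simp add: frechet_derivative_works)
  show ?case
    unfolding Ck_on.simps
  proof (intro conjI ballI allI)
    fix v
    show "Ck_on k S (\<lambda>x. fderiv (\<lambda>x. L (f x)) x v)"
    proof (rule Ck_on_cong[OF \<open>open S\<close>])
      show "Ck_on k S (\<lambda>x. L (fderiv f x v))" by (rule Suc.IH) (use Suc.prems in simp)
    qed (simp add: frechet_derivative_at[OF der, symmetric])
  qed (use der differentiable_def in blast)
qed

lemma Ck_on_add:
  assumes "open S" "Ck_on k S f" "Ck_on k S g"
  shows "Ck_on k S (\<lambda>x. f x + g x)"
  using assms(2,3)
proof (induction k arbitrary: f g)
  case 0
  then show ?case by (simp add: continuous_on_add)
next
  case (Suc k)
  have der: "((\<lambda>x. f x + g x) has_derivative (\<lambda>v. fderiv f x v + fderiv g x v)) (at x)" if "x \<in> S" for x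
    using Suc.prems that by (intro has_derivative_add) (simp_all add: frechet_derivative_works)
  show ?case
    unfolding Ck_on.simps
  proof (intro conjI ballI allI)
    fix v
    show "Ck_on k S (\<lambda>x. fderiv (\<lambda>x. f x + g x) x v)"
    proof (rule Ck_on_cong[OF \<open>open S\<close>])
      show "Ck_on k S (\<lambda>x. fderiv f x v + fderiv g x v)" by (rule Suc.IH) (use Suc.prems in simp_all)
    qed (simp add: frechet_derivative_at[OF der, symmetric])
  qed (use der differentiable_def in blast)
qed

lemma Ck_on_scaleR:
  assumes "open S" "Ck_on k S f" "Ck_on k S g"
  shows "Ck_on k S (\<lambda>x. f x *\<^sub>R g x)"
  using assms(2,3)
proof (induction k arbitrary: f g)
  case 0
  then show ?case by (simp add: continuous_on_scaleR)
next
  case (Suc k)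
  have der: "((\<lambda>x. f x *\<^sub>R g x) has_derivative (\<lambda>v. f x *\<^sub>R fderiv g x v + fderiv f x v *\<^sub>R g x)) (at x)"
    if "x \<in> S" for x
    using Suc.prems that by (intro has_derivative_scaleR) (simp_all add: frechet_derivative_works)
  show ?case
    unfolding Ck_on.simps
  proof (intro conjI ballI allI)
    fix v
    show "Ck_on k S (\<lambda>x. fderiv (\<lambda>x. f x *\<^sub>R g x) x v)"
    proof (rule Ck_on_cong[OF \<open>open S\<close>])
      show "Ck_on k S (\<lambda>x. f x *\<^sub>R fderiv g x v + fderiv f x v *\<^sub>R g x)"
        using Suc.prems Ck_on_Suc_imp[OF Suc.prems(1)] Ck_on_Suc_imp[OF Suc.prems(2)]
        by (intro Ck_on_add[OF \<open>open S\<close>] Suc.IH) auto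
    qed (simp add: frechet_derivative_at[OF der, symmetric])
  qed (use der differentiable_def in blast)
qed

lemma Ck_on_sum:
  assumes "open S" "\<And>i. i \<in> I \<Longrightarrow> Ck_on k S (f i)"
  shows "Ck_on k S (\<lambda>x. \<Sum>i\<in>I. f i x)"
  using assms(2)
proof (induction I rule: infinite_finite_induct)
  case (insert i I)
  then show ?case by (simp add: Ck_on_add[OF \<open>open S\<close>])
qed (simp_all add: Ck_on_const)

text \<open>
By the chain rule, a directional derivative of \<open>g \<circ> f\<close> is a finite sum of products of partial
derivatives of \<open>g\<close> along \<open>f\<close> and components of a directional derivative of \<open>f\<close>; the induction
hypothesis applies to the former.
\<close>

lemma Ck_on_compose:
  fixes f :: "'v::real_normed_vector \<Rightarrow> 'w::euclidean_space"
  assumes "open S" "Ck_on k S f" "Ck_on k T g" "f ` S \<subseteq> T"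
  shows "Ck_on k S (\<lambda>x. g (f x))"
  using assms(2,3)
proof (induction k arbitrary: g)
  case 0
  then show ?case using assms(4) by (auto intro: continuous_on_compose2)
next
  case (Suc k)
  have der: "((\<lambda>x. g (f x)) has_derivative (\<lambda>v. \<Sum>b\<in>Basis. (fderiv f x v \<bullet> b) *\<^sub>R fderiv g (f x) b)) (at x)"
    if "x \<in> S" for x
  proof -
    have g': "(g has_derivative fderiv g (f x)) (at (f x))"
      using Suc.prems(2) assms(4) that by (auto simp: frechet_derivative_works)
    have "(f has_derivative fderiv f x) (at x)"
      using Suc.prems(1) that by (auto simp: frechet_derivative_works)
    then have comp: "((\<lambda>x. g (f x)) has_derivative (\<lambda>v. fderiv g (f x) (fderiv f x v))) (at x)"
      using g' by (rule has_derivative_compose)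
    have expand: "fderiv g (f x) u = (\<Sum>b\<in>Basis. (u \<bullet> b) *\<^sub>R fderiv g (f x) b)" for u
    proof -
      have "fderiv g (f x) (\<Sum>b\<in>Basis. (u \<bullet> b) *\<^sub>R b) = (\<Sum>b\<in>Basis. (u \<bullet> b) *\<^sub>R fderiv g (f x) b)"
        using has_derivative_linear[OF g'] by (simp add: linear_sum linear_scale)
      then show ?thesis by (simp only: euclidean_representation)
    qed
    have "(\<lambda>v. fderiv g (f x) (fderiv f x v)) = (\<lambda>v. \<Sum>b\<in>Basis. (fderiv f x v \<bullet> b) *\<^sub>R fderiv g (f x) b)"
      by (rule ext) (rule expand)
    with comp show ?thesis by (simp only:)
  qed
  show ?case
    unfolding Ck_on.simps
  proof (intro conjI ballI allI)
    fix v
    show "Ck_on k S (\<lambda>x. fderiv (\<lambda>x. g (f x)) x v)"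
    proof (rule Ck_on_cong[OF \<open>open S\<close>])
      show "Ck_on k S (\<lambda>x. \<Sum>b\<in>Basis. (fderiv f x v \<bullet> b) *\<^sub>R fderiv g (f x) b)"
      proof (intro Ck_on_sum Ck_on_scaleR \<open>open S\<close>)
        fix b :: 'w
        show "Ck_on k S (\<lambda>x. fderiv f x v \<bullet> b)"
          by (rule Ck_on_bounded_linear[OF bounded_linear_inner_left \<open>open S\<close>]) (use Suc.prems in simp)
        show "Ck_on k S (\<lambda>x. fderiv g (f x) b)"
          by (rule Suc.IH[OF Ck_on_Suc_imp[OF Suc.prems(1)]]) (use Suc.prems in simp)
      qed
    qed (simp add: frechet_derivative_at[OF der, symmetric])
  qed (use der differentiable_def in blast)
qed

lemma Ck_on_local:
  assumes "\<And>x. x \<in> S \<Longrightarrow> \<exists>T. open T \<and> x \<in> T \<and> Ck_on k T f"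
  shows "Ck_on k S f"
  using assms
proof (induction k arbitrary: f)
  case 0
  have "isCont f x" if "x \<in> S" for x
    using 0[OF that] by (auto simp: continuous_on_eq_continuous_at)
  then show ?case by (simp add: continuous_at_imp_continuous_on)
next
  case (Suc k)
  have "Ck_on k S (\<lambda>x. fderiv f x v)" for v
    by (rule Suc.IH) (use Suc.prems in force)
  moreover have "f differentiable at x" if "x \<in> S" for x
    using Suc.prems[OF that] by auto
  ultimately show ?case by simp
qed

lemma smooth_on_differentiable: "smooth_on S f \<Longrightarrow> x \<in> S \<Longrightarrow> f differentiable at x"
  unfolding smooth_on_def by (metis Ck_on.simps(2))

lemma smooth_on_fderiv: "smooth_on S f \<Longrightarrow> smooth_on S (\<lambda>x. fderiv f x v)"
  unfolding smooth_on_def by (metis Ck_on.simps(2))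

lemma Ck_on_subset: "Ck_on k S f \<Longrightarrow> T \<subseteq> S \<Longrightarrow> Ck_on k T f"
  by (induction k arbitrary: f) (auto intro: continuous_on_subset)

lemma smooth_on_subset: "smooth_on S f \<Longrightarrow> T \<subseteq> S \<Longrightarrow> smooth_on T f"
  unfolding smooth_on_def using Ck_on_subset by blast

text \<open>
The member \<open>m = 0\<close> is the classical smooth function that is flat at the origin. The powers of \<open>1 / s\<close> make
the span of the family closed under differentiation, so that smoothness follows by induction for all
members at once.
\<close>

definition flat :: "nat \<Rightarrow> real \<Rightarrow> real" where
  "flat m s = (if s > 0 then (1 / s) ^ m * exp (- (1 / s)) else 0)"

lemma flat_tendsto_0: "(flat m \<longlongrightarrow> 0) (at 0)"
proof -
  \<comment> \<open>Near the origin the substitution \<open>t = 1 / s\<close> turns the claim into exponential decay.\<close>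
  have "((\<lambda>t::real. t ^ m / exp t) \<longlongrightarrow> 0) at_top" by (rule tendsto_power_div_exp_0)
  then have "((\<lambda>s::real. (inverse s) ^ m / exp (inverse s)) \<longlongrightarrow> 0) (at_right 0)"
    by (rule filterlim_compose[OF _ filterlim_inverse_at_top_right])
  then have "(flat m \<longlongrightarrow> 0) (at_right 0)"
    by (rule Lim_transform_eventually)
      (auto simp: flat_def eventually_at_filter divide_inverse exp_minus)
  moreover have "(flat m \<longlongrightarrow> 0) (at_left 0)"
    by (rule Lim_transform_eventually[OF tendsto_const]) (auto simp: flat_def eventually_at_filter)
  ultimately show ?thesis by (rule filterlim_split_at[rotated])
qed

lemma flat_derivative: "(flat m has_real_derivative flat (m + 2) s - real m * flat (m + 1) s) (at s)"
proof -
  consider "s > 0" | "s < 0" | "s = 0" by linarith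
  then show ?thesis
  proof cases
    case 1
    have "((\<lambda>s. (1 / s) ^ m * exp (- (1 / s))) has_real_derivative flat (m + 2) s - real m * flat (m + 1) s) (at s)"
    proof -
      have inv: "((\<lambda>s. 1 / s) has_real_derivative - (1 / s\<^sup>2)) (at s)"
        using 1 by (auto intro!: derivative_eq_intros simp: power2_eq_square)
      have "((\<lambda>s. (1 / s) ^ m * exp (- (1 / s))) has_real_derivative
          (1 / s) ^ m * (exp (- (1 / s)) * - (- (1 / s\<^sup>2)))
          + real m * (- (1 / s\<^sup>2) * (1 / s) ^ (m - Suc 0)) * exp (- (1 / s))) (at s)"
        by (rule DERIV_mult'[OF DERIV_power[OF inv] DERIV_fun_exp[OF DERIV_minus[OF inv]]])
      moreover have "(1 / s) ^ m * (exp (- (1 / s)) * - (- (1 / s\<^sup>2)))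
          + real m * (- (1 / s\<^sup>2) * (1 / s) ^ (m - Suc 0)) * exp (- (1 / s)) = flat (m + 2) s - real m * flat (m + 1) s"
        using 1 by (cases m) (simp_all add: flat_def field_simps power2_eq_square)
      ultimately show ?thesis by simp
    qed
    then show ?thesis
      by (rule has_field_derivative_transform_within_open[where S="{0<..}"]) (use 1 in \<open>auto simp: flat_def\<close>)
  next
    case 2
    have "((\<lambda>s. 0) has_real_derivative flat (m + 2) s - real m * flat (m + 1) s) (at s)"
      using 2 by (simp add: flat_def)
    then show ?thesis
      by (rule has_field_derivative_transform_within_open[where S="{..<0}"]) (use 2 in \<open>auto simp: flat_def\<close>)
  next
    case 3
    have "(\<lambda>h. (flat m (0 + h) - flat m 0) / h) = flat (m + 1)"
      by (auto simp: flat_def fun_eq_iff)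
    then show ?thesis using flat_tendsto_0[of "m + 1"] 3 by (simp add: DERIV_def flat_def)
  qed
qed

lemma flat_smooth: "smooth_on UNIV (flat m)"
proof -
  have "Ck_on k UNIV (flat m)" for k
  proof (induction k arbitrary: m)
    case 0
    show ?case using flat_derivative DERIV_isCont by (metis Ck_on.simps(1) continuous_at_imp_continuous_on)
  next
    case (Suc k)
    have der: "(flat m has_derivative (\<lambda>v. v *\<^sub>R (flat (m + 2) s + (- real m) *\<^sub>R flat (m + 1) s))) (at s)" for s
    proof -
      have "(\<lambda>v. v *\<^sub>R (flat (m + 2) s + (- real m) *\<^sub>R flat (m + 1) s)) = (*) (flat (m + 2) s - real m * flat (m + 1) s)"
        by (rule ext) (simp add: mult.commute)
      then show ?thesis using flat_derivative[of m s] by (simp only: has_field_derivative_def)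
    qed
    then have "fderiv (flat m) s v = v *\<^sub>R (flat (m + 2) s + (- real m) *\<^sub>R flat (m + 1) s)" for s v
      by (simp add: frechet_derivative_at[OF der, symmetric])
    then show ?case
      using der Suc by (auto simp: differentiable_def intro!: Ck_on_scaleR Ck_on_add Ck_on_const
          simp del: real_scaleR_def scaleR_minus_left)
  qed
  then show ?thesis by (simp add: smooth_on_def)
qed

text \<open>
A linear function with gradient \<open>\<eta>\<close> that vanishes at \<open>x0\<close>, multiplied by a cut-off with value \<open>1\<close> there; the
product rule at \<open>x0\<close> leaves only the gradient of the linear factor.
\<close>

lemma bump_function:
  fixes x0 \<eta> :: "'v::euclidean_space"
  assumes "\<rho> > 0"
  obtains h where "smooth_on UNIV h" "\<And>y. y \<notin> cball x0 \<rho> \<Longrightarrow> h y = 0" "(h has_derivative (\<lambda>v. \<eta> \<bullet> v)) (at x0)"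
proof -
  define C where "C = flat 0 (\<rho>\<^sup>2)"
  have C: "C > 0" using assms by (simp add: C_def flat_def)
  define h where "h y = (\<eta> \<bullet> (y - x0)) *\<^sub>R ((1 / C) *\<^sub>R flat 0 (\<rho>\<^sup>2 - (y - x0) \<bullet> (y - x0)))" for y
  have "smooth_on UNIV h"
    unfolding smooth_on_def
  proof
    fix k
    have id: "Ck_on k UNIV (\<lambda>y::'v. y - x0)"
    proof -
      have "Ck_on k UNIV (\<lambda>y::'v. y)" by (cases k) (auto simp: Ck_on_const)
      then have "Ck_on k UNIV (\<lambda>y::'v. y + - x0)" by (intro Ck_on_add Ck_on_const) auto
      then show ?thesis by simp
    qed
    have lin: "Ck_on k UNIV (\<lambda>y::'v. u \<bullet> (y - x0))" for u
      by (rule Ck_on_bounded_linear[OF bounded_linear_inner_right open_UNIV id])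
    have "Ck_on k UNIV (\<lambda>y. \<rho>\<^sup>2 + (-1) *\<^sub>R (\<Sum>b\<in>Basis. (b \<bullet> (y - x0)) *\<^sub>R (b \<bullet> (y - x0))))"
      by (intro Ck_on_add Ck_on_const Ck_on_scaleR Ck_on_sum lin open_UNIV)
    moreover have "\<rho>\<^sup>2 + (-1) *\<^sub>R (\<Sum>b\<in>Basis. (b \<bullet> (y - x0)) *\<^sub>R (b \<bullet> (y - x0))) = \<rho>\<^sup>2 - (y - x0) \<bullet> (y - x0)" for y
      by (subst (3) euclidean_inner) (simp add: inner_commute)
    ultimately have "Ck_on k UNIV (\<lambda>y. \<rho>\<^sup>2 - (y - x0) \<bullet> (y - x0))" by simp
    then have "Ck_on k UNIV (\<lambda>y. flat 0 (\<rho>\<^sup>2 - (y - x0) \<bullet> (y - x0)))"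
      by (rule Ck_on_compose[OF open_UNIV _ flat_smooth[unfolded smooth_on_def, rule_format] subset_UNIV])
    then show "Ck_on k UNIV h"
      unfolding h_def[abs_def] by (intro Ck_on_scaleR Ck_on_const lin open_UNIV)
  qed
  moreover have "h y = 0" if "y \<notin> cball x0 \<rho>" for y
  proof -
    have "\<rho> < norm (y - x0)" using that by (simp add: dist_norm norm_minus_commute)
    then have "\<rho>\<^sup>2 < (norm (y - x0))\<^sup>2" using assms by (intro power_strict_mono) auto
    then show ?thesis by (simp add: h_def flat_def power2_norm_eq_inner)
  qed
  moreover have "(h has_derivative (\<lambda>v. \<eta> \<bullet> v)) (at x0)"
  proof -
    let ?g = "\<lambda>y. (1 / C) *\<^sub>R flat 0 (\<rho>\<^sup>2 - (y - x0) \<bullet> (y - x0))"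
    have "((\<lambda>y. flat 0 (\<rho>\<^sup>2 - (y - x0) \<bullet> (y - x0))) has_derivative (\<lambda>v. 0)) (at x0)"
    proof -
      have q: "((\<lambda>y. \<rho>\<^sup>2 - (y - x0) \<bullet> (y - x0)) has_derivative (\<lambda>v. 0)) (at x0)"
        by (auto intro!: derivative_eq_intros)
      have "(flat 0 has_derivative (\<lambda>v. (flat (0 + 2) (\<rho>\<^sup>2)) * v)) (at (\<rho>\<^sup>2 - (x0 - x0) \<bullet> (x0 - x0)))"
        using flat_derivative[of 0 "\<rho>\<^sup>2"] by (simp add: has_field_derivative_def numeral_2_eq_2)
      from has_derivative_compose[OF q this] show ?thesis by simp
    qed
    then have "(?g has_derivative (\<lambda>v. (1 / C) *\<^sub>R 0)) (at x0)" by (rule has_derivative_scaleR_right)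
    moreover have "((\<lambda>y. \<eta> \<bullet> (y - x0)) has_derivative (\<lambda>v. \<eta> \<bullet> v)) (at x0)"
      by (auto intro!: derivative_eq_intros)
    ultimately have "(h has_derivative (\<lambda>v. (\<eta> \<bullet> (x0 - x0)) *\<^sub>R ((1 / C) *\<^sub>R 0) + (\<eta> \<bullet> v) *\<^sub>R ?g x0)) (at x0)"
      unfolding h_def[abs_def] by (intro has_derivative_scaleR)
    moreover have "?g x0 = 1" using C by (simp add: C_def)
    ultimately show ?thesis by simp
  qed
  ultimately show thesis by (rule that)
qed

section \<open>Hamiltonian vector fields on a manifold\<close>

lemma chart_open: "is_chart c \<Longrightarrow> open (fst c)"
  by (simp add: is_chart_def)

lemma chart_inv: "is_chart c \<Longrightarrow> p \<in> fst c \<Longrightarrow> inv_into (fst c) (snd c) (snd c p) = p"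
  by (simp add: is_chart_def homeomorphism_def)

lemma coords_memD:
  assumes "is_chart c" "x \<in> coords c W"
  shows "inv_into (fst c) (snd c) x \<in> fst c \<inter> W" "snd c (inv_into (fst c) (snd c) x) = x"
  using assms chart_inv[OF assms(1)] by (auto simp: coords_def)

lemma coords_memI:
  assumes "is_chart c" "x \<in> coords c UNIV" "inv_into (fst c) (snd c) x \<in> W"
  shows "x \<in> coords c W"
  using assms chart_inv[OF assms(1)] by (auto simp: coords_def)

lemma coords_subset: "coords c W \<subseteq> coords c UNIV"
  by (auto simp: coords_def)

lemma open_coords:
  assumes "is_chart c" "open W" shows "open (coords c W)"
proof -
  have "homeomorphism (fst c) (snd c ` fst c) (snd c) (inv_into (fst c) (snd c))" "open (snd c ` fst c)"
    using assms(1) by (auto simp: is_chart_def)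
  moreover have "openin (top_of_set (fst c)) (fst c \<inter> W)" using assms(2) by auto
  ultimately have "openin (top_of_set (snd c ` fst c)) (snd c ` (fst c \<inter> W))"
    using homeomorphism_imp_open_map by blast
  then show ?thesis using \<open>open (snd c ` fst c)\<close> by (auto simp: coords_def openin_open_eq)
qed

lemma transition_in_coords:
  assumes "is_chart c" "x \<in> coords c (fst d \<inter> W)"
  shows "transition c d x \<in> coords d (fst c \<inter> W)"
  using coords_memD[OF assms] by (auto simp: transition_def coords_def)

lemma smooth_atlasD:
  assumes "smooth_atlas A" "c \<in> A"
  shows "is_chart c" "d \<in> A \<Longrightarrow> smooth_on (coords c (fst d)) (transition c d)"
  using assms by (auto simp: smooth_atlas_def charts_compatible_def)

text \<open>
A bump function of the chart, extended by zero, is smooth on the whole manifold because its support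
lies in the image of a closed ball, which is compact and therefore closed in a Hausdorff space: every
point has a neighbourhood that lies in the chart domain or avoids this image.
\<close>

lemma smooth_function_with_differential:
  fixes A :: "('a::t2_space, 'n::finite) chart set"
  assumes A: "smooth_atlas A" "c \<in> A" and x: "x \<in> coords c UNIV"
  obtains f where "smooth_function A f" "differential f c x = \<eta>"
proof -
  have c: "is_chart c" by (rule smooth_atlasD[OF A])
  let ?i = "\<lambda>d. inv_into (fst d) (snd d)"
  have op: "open (coords c UNIV)" by (rule open_coords[OF c open_UNIV])
  then obtain \<rho> where \<rho>: "\<rho> > 0" "cball x \<rho> \<subseteq> coords c UNIV"
    using x open_contains_cball by blast
  obtain h where h: "smooth_on UNIV h" "\<And>y. y \<notin> cball x \<rho> \<Longrightarrow> h y = 0"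
    "(h has_derivative (\<lambda>v. \<eta> \<bullet> v)) (at x)"
    using bump_function[OF \<rho>(1)] by blast
  define f where "f p = (if p \<in> fst c then h (snd c p) else 0)" for p
  have "closed (?i c ` cball x \<rho>)"
  proof (intro compact_imp_closed compact_continuous_image)
    have "continuous_on (snd c ` fst c) (?i c)" using c by (simp add: is_chart_def homeomorphism_def)
    then show "continuous_on (cball x \<rho>) (?i c)"
      by (rule continuous_on_subset) (use \<rho>(2) in \<open>simp add: coords_def\<close>)
  qed simp
  then have opK: "open (- ?i c ` cball x \<rho>)" by (simp add: open_Compl)
  have f0: "f p = 0" if "p \<notin> ?i c ` cball x \<rho>" for p
  proof (cases "p \<in> fst c")
    case True
    then have "snd c p \<notin> cball x \<rho>" using that chart_inv[OF c True] by (metis imageI)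
    then show ?thesis using h(2) by (simp add: f_def)
  qed (simp add: f_def)
  have "smooth_function A f"
    unfolding smooth_function_def smooth_on_def
  proof (intro ballI allI)
    fix d k assume d: "d \<in> A"
    have d_chart: "is_chart d" by (rule smooth_atlasD[OF A(1) d])
    show "Ck_on k (coords d UNIV) (f \<circ> ?i d)"
    proof (rule Ck_on_local)
      fix z assume z: "z \<in> coords d UNIV"
      show "\<exists>T. open T \<and> z \<in> T \<and> Ck_on k T (f \<circ> ?i d)"
      proof (cases "?i d z \<in> fst c")
        case True
        let ?T = "coords d (fst c)"
        have opT: "open ?T" by (rule open_coords[OF d_chart chart_open[OF c]])
        have "Ck_on k ?T (\<lambda>y. h (transition d c y))"
          using smooth_atlasD(2)[OF A(1) d A(2), unfolded smooth_on_def, rule_format]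
            h(1)[unfolded smooth_on_def, rule_format] by (rule Ck_on_compose[OF opT _ _ subset_UNIV])
        moreover have "h (transition d c y) = (f \<circ> ?i d) y" if "y \<in> ?T" for y
          using coords_memD[OF d_chart that] by (simp add: f_def transition_def)
        ultimately have "Ck_on k ?T (f \<circ> ?i d)" by (rule Ck_on_cong[OF opT, rotated])
        moreover have "z \<in> ?T" using d_chart z True by (rule coords_memI)
        ultimately show ?thesis using opT by blast
      next
        case False
        let ?T = "coords d (- ?i c ` cball x \<rho>)"
        have opT: "open ?T" by (rule open_coords[OF d_chart opK])
        have "?i c ` cball x \<rho> \<subseteq> fst c"
          using \<rho>(2) coords_memD(1)[OF c] by blast
        then have "z \<in> ?T" using False by (intro coords_memI[OF d_chart z]) auto
        moreover have "0 = (f \<circ> ?i d) y" if "y \<in> ?T" for y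
        proof -
          have "?i d y \<notin> ?i c ` cball x \<rho>" using coords_memD(1)[OF d_chart that] by blast
          from f0[OF this] show ?thesis by simp
        qed
        then have "Ck_on k ?T (f \<circ> ?i d)" by (rule Ck_on_cong[OF opT _ Ck_on_const])
        ultimately show ?thesis using opT by blast
      qed
    qed
  qed
  moreover have "fderiv (f \<circ> ?i c) x = (\<lambda>v. \<eta> \<bullet> v)"
  proof -
    have "h y = (f \<circ> ?i c) y" if "y \<in> coords c UNIV" for y
      using coords_memD[OF c that] by (simp add: f_def)
    then have "((f \<circ> ?i c) has_derivative (\<lambda>v. \<eta> \<bullet> v)) (at x)"
      by (rule has_derivative_transform_within_open[OF h(3) op x])
    then show ?thesis by (simp add: frechet_derivative_at[symmetric])
  qed
  then have "differential f c x = \<eta>"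
    by (simp add: differential_def inner_axis vec_eq_iff)
  ultimately show thesis by (rule that)
qed

lemma smooth_on_vec:
  fixes f :: "'v::real_normed_vector \<Rightarrow> real^'n"
  assumes "open S" "\<And>j. smooth_on S (\<lambda>x. f x $ j)"
  shows "smooth_on S f"
  unfolding smooth_on_def
proof
  fix k
  have "Ck_on k S (\<lambda>x. \<Sum>j\<in>UNIV. (f x $ j) *\<^sub>R axis j (1::real))"
    by (intro Ck_on_sum Ck_on_scaleR Ck_on_const assms(1)) (use assms(2) in \<open>simp add: smooth_on_def\<close>)
  moreover have "(\<Sum>j\<in>UNIV. (f x $ j) *\<^sub>R axis j (1::real)) = f x" for x
    by (metis (no_types) basis_expansion scalar_mult_eq_scaleR)
  ultimately show "Ck_on k S f" by (simp only:)
qed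

lemma linear_vec_expand:
  assumes "linear (L :: real^'n \<Rightarrow> real)"
  shows "L u = (\<Sum>j\<in>UNIV. u $ j * L (axis j 1))"
proof -
  have "L (\<Sum>j\<in>UNIV. (u $ j) *\<^sub>R axis j 1) = (\<Sum>j\<in>UNIV. u $ j * L (axis j 1))"
    by (simp add: linear_sum[OF assms] linear_scale[OF assms])
  moreover have "(\<Sum>j\<in>UNIV. (u $ j) *\<^sub>R axis j 1) = u"
    by (metis (no_types) basis_expansion scalar_mult_eq_scaleR)
  ultimately show ?thesis by (simp only:)
qed

lemma inner_sharp:
  assumes "alternating 2 P"
  shows "\<beta> \<bullet> sharp P \<eta> = eval2 P \<eta> \<beta>"
  using linear_vec_expand[OF alternating_2_linear(2)[OF assms], of \<eta> \<beta>]
  by (simp add: sharp_def inner_vec_def)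

lemma smooth_on_sharp:
  fixes P :: "'v::real_normed_vector \<Rightarrow> (real^'n) altmap" and \<eta> :: "'v \<Rightarrow> real^'n"
  assumes S: "open S" and P: "\<And>x. x \<in> S \<Longrightarrow> alternating 2 (P x)" "\<And>\<xi>. smooth_on S (\<lambda>x. P x \<xi>)"
    and \<eta>: "\<And>i. smooth_on S (\<lambda>x. \<eta> x $ i)"
  shows "smooth_on S (\<lambda>x. sharp (P x) (\<eta> x))"
proof (rule smooth_on_vec[OF S])
  fix j
  have "sharp (P x) (\<eta> x) $ j = (\<Sum>i\<in>UNIV. \<eta> x $ i *\<^sub>R eval2 (P x) (axis i 1) (axis j 1))" if "x \<in> S" for x
    using linear_vec_expand[OF alternating_2_linear(1)[OF P(1)[OF that]], of "\<eta> x" "axis j 1"]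
    by (simp add: sharp_def)
  moreover have "Ck_on k S (\<lambda>x. \<Sum>i\<in>UNIV. \<eta> x $ i *\<^sub>R eval2 (P x) (axis i 1) (axis j 1))" for k
    using P(2) \<eta> unfolding smooth_on_def by (intro Ck_on_sum Ck_on_scaleR S) auto
  ultimately show "smooth_on S (\<lambda>x. sharp (P x) (\<eta> x) $ j)"
    unfolding smooth_on_def using Ck_on_cong[OF S] by (metis (no_types, lifting))
qed

text \<open>
Under a change of charts with Jacobian \<open>J\<close> the differential of \<open>f\<close> and the arguments of the bivector are
both pulled back by the adjoint of \<open>J\<close>; hence the vector obtained from them is pushed forward by \<open>J\<close>.
\<close>

lemma hamiltonian_vector_field:
  assumes A: "smooth_atlas A" and \<Lambda>: "multivector_field A 2 \<Lambda>" and f: "smooth_function A f"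
  shows "vector_field A UNIV (hamiltonian_vf \<Lambda> f)"
  unfolding vector_field_def
proof (intro conjI ballI)
  fix c assume c: "c \<in> A"
  note chart = smooth_atlasD[OF A c]
  have smooth_f: "smooth_on (coords c UNIV) (f \<circ> inv_into (fst c) (snd c))"
    using f c by (simp add: smooth_function_def)
  have op: "open (coords c UNIV)" by (rule open_coords[OF chart(1) open_UNIV])
  show "smooth_on (coords c UNIV) (hamiltonian_vf \<Lambda> f c)"
    unfolding hamiltonian_vf_def
  proof (rule smooth_on_sharp[OF op])
    show "alternating 2 (\<Lambda> c x)" if "x \<in> coords c UNIV" for x
      using \<Lambda> c that by (simp add: multivector_field_def)
    show "smooth_on (coords c UNIV) (\<lambda>x. \<Lambda> c x \<xi>)" for \<xi>
      using \<Lambda> c by (simp add: multivector_field_def)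
    show "smooth_on (coords c UNIV) (\<lambda>x. differential f c x $ i)" for i
      using smooth_on_fderiv[OF smooth_f] by (simp add: differential_def)
  qed
  fix d x assume d: "d \<in> A" and x: "x \<in> coords c (fst d \<inter> UNIV)"
  let ?\<tau> = "transition c d" and ?J = "jac c d x"
  note d_chart = smooth_atlasD[OF A d]
  let ?F = "\<lambda>c. f \<circ> inv_into (fst c) (snd c)"
  have xd: "x \<in> coords c (fst d)" using x by simp
  have x': "x \<in> coords c UNIV" using x coords_subset by blast
  have \<tau>x: "?\<tau> x \<in> coords d UNIV" using transition_in_coords[OF chart(1) x] coords_subset by blast
  have alt: "alternating 2 (\<Lambda> c x)" "alternating 2 (\<Lambda> d (?\<tau> x))"
    using \<Lambda> c d x' \<tau>x by (simp_all add: multivector_field_def)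
  have J: "(?\<tau> has_derivative ?J) (at x)"
    using smooth_on_differentiable[OF chart(2)[OF d] xd] by (simp add: frechet_derivative_works)
  then have lin: "linear ?J" by (rule has_derivative_linear)
  have Fd: "(?F d has_derivative fderiv (?F d) (?\<tau> x)) (at (?\<tau> x))"
    using smooth_on_differentiable[OF _ \<tau>x, of "?F d"] f d
    by (simp add: smooth_function_def frechet_derivative_works)
  have pull: "fderiv (?F c) x v = fderiv (?F d) (?\<tau> x) (?J v)" for v
  proof -
    have "((\<lambda>y. ?F d (?\<tau> y)) has_derivative (\<lambda>v. fderiv (?F d) (?\<tau> x) (?J v))) (at x)"
      by (rule has_derivative_compose[OF J Fd])
    moreover have "?F d (?\<tau> y) = ?F c y" if "y \<in> coords c (fst d)" for y
      using coords_memD[OF chart(1) that] chart_inv[OF d_chart(1)] by (simp add: transition_def)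
    ultimately have "(?F c has_derivative (\<lambda>v. fderiv (?F d) (?\<tau> x) (?J v))) (at x)"
      by (rule has_derivative_transform_within_open[OF _ open_coords[OF chart(1) chart_open[OF d_chart(1)]] xd])
    then show ?thesis by (simp add: frechet_derivative_at[symmetric])
  qed
  have grad: "fderiv (?F d) (?\<tau> x) u = differential f d (?\<tau> x) \<bullet> u" for u
    using linear_vec_expand[OF has_derivative_linear[OF Fd], of u]
    by (simp add: differential_def inner_vec_def mult.commute)
  have diff_c: "differential f c x = adjoint ?J (differential f d (?\<tau> x))"
  proof (rule vec_eq_iff[THEN iffD2], rule allI)
    fix i
    have "differential f c x $ i = differential f d (?\<tau> x) \<bullet> ?J (axis i 1)"
      unfolding grad[symmetric] pull[symmetric] by (simp add: differential_def)
    also have "\<dots> = axis i 1 \<bullet> adjoint ?J (differential f d (?\<tau> x))"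
      by (simp add: adjoint_works[OF lin] inner_commute)
    also have "\<dots> = adjoint ?J (differential f d (?\<tau> x)) $ i" by (simp add: inner_axis')
    finally show "differential f c x $ i = adjoint ?J (differential f d (?\<tau> x)) $ i" .
  qed
  have "\<beta> \<bullet> hamiltonian_vf \<Lambda> f d (?\<tau> x) = \<beta> \<bullet> ?J (hamiltonian_vf \<Lambda> f c x)" for \<beta>
  proof -
    have "\<beta> \<bullet> hamiltonian_vf \<Lambda> f d (?\<tau> x) = eval2 (\<Lambda> d (?\<tau> x)) (differential f d (?\<tau> x)) \<beta>"
      by (simp add: hamiltonian_vf_def inner_sharp[OF alt(2)])
    also have "\<dots> = \<Lambda> c x (\<lambda>i. adjoint ?J (case_nat (differential f d (?\<tau> x)) (\<lambda>_. \<beta>) i))"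
      using \<Lambda> c d xd by (simp add: multivector_field_def)
    also have "\<dots> = eval2 (\<Lambda> c x) (differential f c x) (adjoint ?J \<beta>)"
      using alternating_2_eval[OF alt(1), of "\<lambda>i. adjoint ?J (case_nat (differential f d (?\<tau> x)) (\<lambda>_. \<beta>) i)"]
      diff_c by simp
    also have "\<dots> = adjoint ?J \<beta> \<bullet> hamiltonian_vf \<Lambda> f c x"
      by (simp add: hamiltonian_vf_def inner_sharp[OF alt(1)])
    finally show ?thesis using adjoint_works[OF lin, of "hamiltonian_vf \<Lambda> f c x" \<beta>] by (simp add: inner_commute)
  qed
  then show "hamiltonian_vf \<Lambda> f d (?\<tau> x) = ?J (hamiltonian_vf \<Lambda> f c x)"
    by (metis vector_eq_ldot)
qed

section \<open>Lie derivatives in a chart\<close>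

lemma derivative_of_linear_family:
  fixes L :: "'v::real_normed_vector \<Rightarrow> 'w::real_vector \<Rightarrow> real"
  assumes S: "open S" "x \<in> S" and lin: "\<And>y. y \<in> S \<Longrightarrow> linear (L y)"
    and diff: "\<And>u. (\<lambda>y. L y u) differentiable at x"
  shows "linear (\<lambda>u. fderiv (\<lambda>y. L y u) x h)"
proof (rule linearI)
  have D: "((\<lambda>y. L y u) has_derivative fderiv (\<lambda>y. L y u) x) (at x)" for u
    using diff by (simp add: frechet_derivative_works)
  fix u1 u2 and t :: real
  have "((\<lambda>y. L y (u1 + u2)) has_derivative (\<lambda>h. fderiv (\<lambda>y. L y u1) x h + fderiv (\<lambda>y. L y u2) x h)) (at x)"
    by (rule has_derivative_transform_within_open[OF has_derivative_add[OF D D] S]) (simp add: linear_add[OF lin])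
  then show "fderiv (\<lambda>y. L y (u1 + u2)) x h = fderiv (\<lambda>y. L y u1) x h + fderiv (\<lambda>y. L y u2) x h"
    by (simp add: frechet_derivative_at[symmetric])
  have "((\<lambda>y. L y (t *\<^sub>R u1)) has_derivative (\<lambda>h. t *\<^sub>R fderiv (\<lambda>y. L y u1) x h)) (at x)"
    by (rule has_derivative_transform_within_open[OF has_derivative_scaleR_right[OF D] S]) (simp add: linear_scale[OF lin])
  then show "fderiv (\<lambda>y. L y (t *\<^sub>R u1)) x h = t *\<^sub>R fderiv (\<lambda>y. L y u1) x h"
    by (simp add: frechet_derivative_at[symmetric])
qed

text \<open>
A product rule for tensor fields applied to vector fields: the value at \<open>y\<close> depends on \<open>y\<close> through the
tensor and through its argument.
\<close>

lemma has_derivative_linear_family: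
  fixes L :: "'v::real_normed_vector \<Rightarrow> real^'n \<Rightarrow> real"
  assumes S: "open S" "x \<in> S" and lin: "\<And>y. y \<in> S \<Longrightarrow> linear (L y)"
    and diff: "\<And>u. (\<lambda>y. L y u) differentiable at x"
    and f: "(f has_derivative f') (at x)"
  shows "((\<lambda>y. L y (f y)) has_derivative (\<lambda>h. fderiv (\<lambda>y. L y (f x)) x h + L x (f' h))) (at x)"
proof -
  have D: "((\<lambda>y. L y u) has_derivative fderiv (\<lambda>y. L y u) x) (at x)" for u
    using diff by (simp add: frechet_derivative_works)
  have fj: "((\<lambda>y. f y $ j) has_derivative (\<lambda>h. f' h $ j)) (at x)" for j
    by (rule bounded_linear.has_derivative[OF bounded_linear_vec_nth f])
  have "((\<lambda>y. \<Sum>j\<in>UNIV. f y $ j * L y (axis j 1)) has_derivative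
      (\<lambda>h. \<Sum>j\<in>UNIV. f x $ j * fderiv (\<lambda>y. L y (axis j 1)) x h + f' h $ j * L x (axis j 1))) (at x)"
    by (intro has_derivative_sum has_derivative_mult fj D)
  moreover have "(\<lambda>h. \<Sum>j\<in>UNIV. f x $ j * fderiv (\<lambda>y. L y (axis j 1)) x h + f' h $ j * L x (axis j 1))
      = (\<lambda>h. fderiv (\<lambda>y. L y (f x)) x h + L x (f' h))"
  proof
    fix h
    show "(\<Sum>j\<in>UNIV. f x $ j * fderiv (\<lambda>y. L y (axis j 1)) x h + f' h $ j * L x (axis j 1))
        = fderiv (\<lambda>y. L y (f x)) x h + L x (f' h)"
      using linear_vec_expand[OF derivative_of_linear_family[OF S lin diff], of "f x" h]
        linear_vec_expand[OF lin[OF S(2)], of "f' h"] by (simp add: sum.distrib)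
  qed
  ultimately have "((\<lambda>y. \<Sum>j\<in>UNIV. f y $ j * L y (axis j 1)) has_derivative
      (\<lambda>h. fderiv (\<lambda>y. L y (f x)) x h + L x (f' h))) (at x)" by (simp only:)
  then show ?thesis
    by (rule has_derivative_transform_within_open[OF _ S]) (simp add: linear_vec_expand[OF lin, symmetric])
qed

lemma has_derivative_eval2:
  fixes \<omega> :: "real^'n \<Rightarrow> (real^'n) altmap"
  assumes S: "open S" "x \<in> S" and alt: "\<And>y. y \<in> S \<Longrightarrow> alternating 2 (\<omega> y)"
    and diff: "\<And>v. (\<lambda>y. \<omega> y v) differentiable at x"
    and f: "(f has_derivative f') (at x)" and g: "(g has_derivative g') (at x)"
  shows "((\<lambda>y. eval2 (\<omega> y) (f y) (g y)) has_derivative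
    (\<lambda>h. fderiv (\<lambda>y. eval2 (\<omega> y) (f x) (g x)) x h + eval2 (\<omega> x) (f x) (g' h) + eval2 (\<omega> x) (f' h) (g x))) (at x)"
proof -
  have G: "((\<lambda>y. eval2 (\<omega> y) u (g y)) has_derivative
      (\<lambda>h. fderiv (\<lambda>y. eval2 (\<omega> y) u (g x)) x h + eval2 (\<omega> x) u (g' h))) (at x)" for u
    by (rule has_derivative_linear_family[OF S _ diff g]) (rule alternating_2_linear(2)[OF alt])
  have "((\<lambda>y. (\<lambda>u. eval2 (\<omega> y) u (g y)) (f y)) has_derivative
      (\<lambda>h. fderiv (\<lambda>y. eval2 (\<omega> y) (f x) (g y)) x h + eval2 (\<omega> x) (f' h) (g x))) (at x)"
    by (rule has_derivative_linear_family[OF S _ _ f])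
      (rule alternating_2_linear(1)[OF alt], assumption, rule differentiableI[OF G])
  then show ?thesis by (simp add: frechet_derivative_at[OF G, symmetric])
qed

text \<open>
Let \<open>q \<eta>\<close> be the Lie derivative of \<open>y \<mapsto> sharp (\<Lambda> y) \<eta>\<close> along \<open>X\<close> as a field of maps, so that
\<open>\<beta> \<bullet> q \<eta>\<close> is the Lie derivative of \<open>\<Lambda>\<close> on \<open>\<eta>\<close> and \<open>\<beta>\<close>. It is tangent to the kernel of the \<open>\<alpha> i\<close>, and the
Lie derivative of \<open>\<Lambda>(\<eta>, \<beta>) = \<omega>(sharp \<Lambda> \<eta>, sharp \<Lambda> \<beta>)\<close> then reads \<open>\<beta> \<bullet> q \<eta> = 2 (\<beta> \<bullet> q \<eta>)\<close>.
\<close>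

lemma lie_derivative_of_inverse_zero:
  fixes \<omega> \<Lambda> :: "real^'n \<Rightarrow> (real^'n) altmap" and \<alpha> :: "nat \<Rightarrow> real^'n \<Rightarrow> (real^'n) altmap"
  assumes S: "open S" "x \<in> S"
    and \<omega>: "\<And>y. y \<in> S \<Longrightarrow> alternating 2 (\<omega> y)" "\<And>v. (\<lambda>y. \<omega> y v) differentiable at x"
    and \<Lambda>: "\<And>y. y \<in> S \<Longrightarrow> alternating 2 (\<Lambda> y)" "\<And>\<eta>. (\<lambda>y. sharp (\<Lambda> y) \<eta>) differentiable at x"
    and \<alpha>: "\<And>i y. i < k \<Longrightarrow> y \<in> S \<Longrightarrow> alternating 1 (\<alpha> i y)" "\<And>i v. i < k \<Longrightarrow> (\<lambda>y. \<alpha> i y v) differentiable at x"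
    and X: "X differentiable at x"
    and tangent: "\<And>y i \<eta>. y \<in> S \<Longrightarrow> i < k \<Longrightarrow> \<alpha> i y (\<lambda>_. sharp (\<Lambda> y) \<eta>) = 0"
    and inverse: "\<And>y u \<xi>. y \<in> S \<Longrightarrow> (\<And>i. i < k \<Longrightarrow> \<alpha> i y (\<lambda>_. u) = 0) \<Longrightarrow> eval2 (\<omega> y) u (sharp (\<Lambda> y) \<xi>) = \<xi> \<bullet> u"
    and L\<alpha>: "\<And>i u. i < k \<Longrightarrow> (\<And>i. i < k \<Longrightarrow> \<alpha> i x (\<lambda>_. u) = 0) \<Longrightarrow>
      fderiv (\<lambda>y. \<alpha> i y (\<lambda>_. u)) x (X x) + \<alpha> i x (\<lambda>_. fderiv X x u) = 0"
    and L\<omega>: "\<And>u v. (\<And>i. i < k \<Longrightarrow> \<alpha> i x (\<lambda>_. u) = 0) \<Longrightarrow> (\<And>i. i < k \<Longrightarrow> \<alpha> i x (\<lambda>_. v) = 0) \<Longrightarrow>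
      fderiv (\<lambda>y. eval2 (\<omega> y) u v) x (X x) + eval2 (\<omega> x) (fderiv X x u) v + eval2 (\<omega> x) u (fderiv X x v) = 0"
  shows "fderiv (\<lambda>y. eval2 (\<Lambda> y) \<eta> \<beta>) x (X x)
    = eval2 (\<Lambda> x) (adjoint (fderiv X x) \<eta>) \<beta> + eval2 (\<Lambda> x) \<eta> (adjoint (fderiv X x) \<beta>)"
proof -
  let ?J = "fderiv X x" and ?h = "X x"
  have linJ: "linear ?J" using X by (simp add: frechet_derivative_works has_derivative_linear)
  have Jadj: "adjoint ?J \<xi> \<bullet> u = \<xi> \<bullet> ?J u" for \<xi> u
    using adjoint_works[OF linJ, of u \<xi>] by (simp add: inner_commute)
  define p where "p \<eta> y = sharp (\<Lambda> y) \<eta>" for \<eta> y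
  define p' where "p' \<eta> = fderiv (p \<eta>) x ?h" for \<eta>
  have pD: "(p \<eta> has_derivative fderiv (p \<eta>) x) (at x)" for \<eta>
    using \<Lambda>(2)[of \<eta>] by (simp add: frechet_derivative_works p_def[abs_def])
  have pair: "\<beta> \<bullet> p \<eta> y = eval2 (\<Lambda> y) \<eta> \<beta>" if "y \<in> S" for y \<eta> \<beta>
    unfolding p_def by (rule inner_sharp[OF \<Lambda>(1)[OF that]])
  have antisym: "\<beta> \<bullet> p \<eta> y = - (\<eta> \<bullet> p \<beta> y)" if "y \<in> S" for y \<eta> \<beta>
    using alternating_2_swap[OF \<Lambda>(1)[OF that], of \<beta> \<eta>] by (simp add: pair[OF that])
  have \<Lambda>': "fderiv (\<lambda>y. eval2 (\<Lambda> y) \<eta> \<beta>) x ?h = \<beta> \<bullet> p' \<eta>" for \<eta> \<beta>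
  proof -
    have "((\<lambda>y. \<beta> \<bullet> p \<eta> y) has_derivative (\<lambda>h. \<beta> \<bullet> fderiv (p \<eta>) x h)) (at x)"
      by (rule bounded_linear.has_derivative[OF bounded_linear_inner_right pD])
    then have "((\<lambda>y. eval2 (\<Lambda> y) \<eta> \<beta>) has_derivative (\<lambda>h. \<beta> \<bullet> fderiv (p \<eta>) x h)) (at x)"
      by (rule has_derivative_transform_within_open[OF _ S]) (rule pair)
    then show ?thesis by (simp add: frechet_derivative_at[symmetric] p'_def)
  qed
  have ker: "\<alpha> i y (\<lambda>_. p \<eta> y) = 0" if "i < k" "y \<in> S" for i y \<eta>
    unfolding p_def using tangent that by blast
  \<comment> \<open>The three terms are the derivative along the flow and the transport of the covector and of the vector.\<close>
  define q where "q \<eta> = p' \<eta> - p (adjoint ?J \<eta>) x - ?J (p \<eta> x)" for \<eta>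
  have Lq: "\<beta> \<bullet> q \<eta> = fderiv (\<lambda>y. eval2 (\<Lambda> y) \<eta> \<beta>) x ?h - eval2 (\<Lambda> x) (adjoint ?J \<eta>) \<beta> - eval2 (\<Lambda> x) \<eta> (adjoint ?J \<beta>)" for \<eta> \<beta>
    by (simp add: q_def inner_diff_right \<Lambda>' pair[OF S(2), symmetric] Jadj)
  have q_antisym: "\<beta> \<bullet> q \<eta> = - (\<eta> \<bullet> q \<beta>)" for \<eta> \<beta>
  proof -
    have "((\<lambda>y. \<beta> \<bullet> p \<eta> y) has_derivative (\<lambda>h. - (\<eta> \<bullet> fderiv (p \<beta>) x h))) (at x)"
      by (rule has_derivative_transform_within_open[OF has_derivative_minus[OF bounded_linear.has_derivative[OF bounded_linear_inner_right pD]] S])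
        (simp add: antisym[symmetric])
    moreover have "((\<lambda>y. \<beta> \<bullet> p \<eta> y) has_derivative (\<lambda>h. \<beta> \<bullet> fderiv (p \<eta>) x h)) (at x)"
      by (rule bounded_linear.has_derivative[OF bounded_linear_inner_right pD])
    ultimately have "(\<lambda>h. - (\<eta> \<bullet> fderiv (p \<beta>) x h)) = (\<lambda>h. \<beta> \<bullet> fderiv (p \<eta>) x h)"
      by (rule has_derivative_unique)
    then have "\<beta> \<bullet> p' \<eta> = - (\<eta> \<bullet> p' \<beta>)" unfolding p'_def by metis
    moreover have "\<beta> \<bullet> p (adjoint ?J \<eta>) x = - (\<eta> \<bullet> ?J (p \<beta> x))" "\<beta> \<bullet> ?J (p \<eta> x) = - (\<eta> \<bullet> p (adjoint ?J \<beta>) x)"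
      using antisym[OF S(2), of \<beta> "adjoint ?J \<eta>"] antisym[OF S(2), of "adjoint ?J \<beta>" \<eta>] by (simp_all add: Jadj)
    ultimately show ?thesis by (simp add: q_def inner_diff_right)
  qed
  have q_tangent: "\<alpha> i x (\<lambda>_. q \<eta>) = 0" if i: "i < k" for i \<eta>
  proof -
    have lin: "linear (\<lambda>u. \<alpha> i x (\<lambda>_. u))" by (rule alternating_1_linear[OF \<alpha>(1)[OF i S(2)]])
    have "((\<lambda>y. \<alpha> i y (\<lambda>_. p \<eta> y)) has_derivative
        (\<lambda>h. fderiv (\<lambda>y. \<alpha> i y (\<lambda>_. p \<eta> x)) x h + \<alpha> i x (\<lambda>_. fderiv (p \<eta>) x h))) (at x)"
      using has_derivative_linear_family[OF S alternating_1_linear[OF \<alpha>(1)[OF i]] \<alpha>(2)[OF i] pD] .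
    moreover have "((\<lambda>y. \<alpha> i y (\<lambda>_. p \<eta> y)) has_derivative (\<lambda>h. 0)) (at x)"
      by (rule has_derivative_transform_within_open[OF has_derivative_const S]) (simp add: ker i)
    ultimately have "(\<lambda>h. fderiv (\<lambda>y. \<alpha> i y (\<lambda>_. p \<eta> x)) x h + \<alpha> i x (\<lambda>_. fderiv (p \<eta>) x h)) = (\<lambda>h. 0)"
      by (rule has_derivative_unique)
    then have "fderiv (\<lambda>y. \<alpha> i y (\<lambda>_. p \<eta> x)) x ?h + \<alpha> i x (\<lambda>_. p' \<eta>) = 0" unfolding p'_def by metis
    moreover have "fderiv (\<lambda>y. \<alpha> i y (\<lambda>_. p \<eta> x)) x ?h + \<alpha> i x (\<lambda>_. ?J (p \<eta> x)) = 0"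
      by (rule L\<alpha>[OF i]) (rule ker[OF _ S(2)])
    ultimately show ?thesis
      unfolding q_def by (simp add: linear_diff[OF lin] ker[OF i S(2)])
  qed
  have bil: "linear (\<lambda>u. eval2 (\<omega> x) u v)" "linear (eval2 (\<omega> x) u)" for u v
    using alternating_2_linear[OF \<omega>(1)[OF S(2)]] by auto
  have inv: "eval2 (\<omega> x) u (p \<xi> x) = \<xi> \<bullet> u" if "\<And>i. i < k \<Longrightarrow> \<alpha> i x (\<lambda>_. u) = 0" for u \<xi>
    unfolding p_def by (rule inverse[OF S(2) that])
  have inv': "eval2 (\<omega> x) (p \<xi> x) u = - (\<xi> \<bullet> u)" if "\<And>i. i < k \<Longrightarrow> \<alpha> i x (\<lambda>_. u) = 0" for u \<xi>
    using inv[OF that, where \<xi>=\<xi>] alternating_2_swap[OF \<omega>(1)[OF S(2)], of "p \<xi> x" u] by simp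
  have "((\<lambda>y. eval2 (\<omega> y) (p \<eta> y) (p \<beta> y)) has_derivative
      (\<lambda>h. fderiv (\<lambda>y. eval2 (\<omega> y) (p \<eta> x) (p \<beta> x)) x h + eval2 (\<omega> x) (p \<eta> x) (fderiv (p \<beta>) x h)
        + eval2 (\<omega> x) (fderiv (p \<eta>) x h) (p \<beta> x))) (at x)"
    by (rule has_derivative_eval2[OF S \<omega> pD pD])
  moreover have "((\<lambda>y. eval2 (\<omega> y) (p \<eta> y) (p \<beta> y)) has_derivative (\<lambda>h. \<beta> \<bullet> fderiv (p \<eta>) x h)) (at x)"
    by (rule has_derivative_transform_within_open[OF bounded_linear.has_derivative[OF bounded_linear_inner_right pD] S])
      (unfold p_def, rule inverse[symmetric], auto intro: tangent)
  ultimately have "(\<lambda>h. fderiv (\<lambda>y. eval2 (\<omega> y) (p \<eta> x) (p \<beta> x)) x h + eval2 (\<omega> x) (p \<eta> x) (fderiv (p \<beta>) x h)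
        + eval2 (\<omega> x) (fderiv (p \<eta>) x h) (p \<beta> x)) = (\<lambda>h. \<beta> \<bullet> fderiv (p \<eta>) x h)"
    by (rule has_derivative_unique)
  then have "fderiv (\<lambda>y. eval2 (\<omega> y) (p \<eta> x) (p \<beta> x)) x ?h + eval2 (\<omega> x) (p \<eta> x) (p' \<beta>)
        + eval2 (\<omega> x) (p' \<eta>) (p \<beta> x) = \<beta> \<bullet> p' \<eta>"
    unfolding p'_def by metis
  moreover have "fderiv (\<lambda>y. eval2 (\<omega> y) (p \<eta> x) (p \<beta> x)) x ?h + eval2 (\<omega> x) (?J (p \<eta> x)) (p \<beta> x)
      + eval2 (\<omega> x) (p \<eta> x) (?J (p \<beta> x)) = 0"
    by (rule L\<omega>) (auto intro: ker S(2))
  moreover have "p' \<eta> = q \<eta> + p (adjoint ?J \<eta>) x + ?J (p \<eta> x)" "p' \<beta> = q \<beta> + p (adjoint ?J \<beta>) x + ?J (p \<beta> x)"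
    by (simp_all add: q_def)
  ultimately have "eval2 (\<omega> x) (p \<eta> x) (q \<beta>) + eval2 (\<omega> x) (p \<eta> x) (p (adjoint ?J \<beta>) x)
      + eval2 (\<omega> x) (q \<eta>) (p \<beta> x) + eval2 (\<omega> x) (p (adjoint ?J \<eta>) x) (p \<beta> x)
      = \<beta> \<bullet> (q \<eta> + p (adjoint ?J \<eta>) x + ?J (p \<eta> x))"
    by (simp add: linear_add[OF bil(1)] linear_add[OF bil(2)])
  moreover have "eval2 (\<omega> x) (p \<eta> x) (q \<beta>) = - (\<eta> \<bullet> q \<beta>)" by (rule inv') (rule q_tangent)
  moreover have "eval2 (\<omega> x) (q \<eta>) (p \<beta> x) = \<beta> \<bullet> q \<eta>" by (rule inv) (rule q_tangent)
  moreover have "eval2 (\<omega> x) (p \<eta> x) (p (adjoint ?J \<beta>) x) = \<beta> \<bullet> ?J (p \<eta> x)"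
    by (subst inv) (auto intro: ker S(2) simp: Jadj)
  moreover have "eval2 (\<omega> x) (p (adjoint ?J \<eta>) x) (p \<beta> x) = \<beta> \<bullet> p (adjoint ?J \<eta>) x"
    by (rule inv) (auto intro: ker S(2))
  ultimately have "\<beta> \<bullet> q \<eta> = 0"
    using q_antisym[of \<beta> \<eta>] by (simp add: inner_add_right)
  then show ?thesis by (simp add: Lq)
qed

lemma fderiv_eval2_swap:
  assumes alt: "\<And>y. y \<in> S \<Longrightarrow> alternating 2 (\<omega> y)" and S: "open S" "x \<in> S"
    and diff: "\<And>\<xi>. (\<lambda>y. \<omega> y \<xi>) differentiable at x"
  shows "fderiv (\<lambda>y. eval2 (\<omega> y) v u) x h = - fderiv (\<lambda>y. eval2 (\<omega> y) u v) x h"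
proof -
  have "((\<lambda>y. eval2 (\<omega> y) u v) has_derivative fderiv (\<lambda>y. eval2 (\<omega> y) u v) x) (at x)"
    using diff by (simp add: frechet_derivative_works)
  then have "((\<lambda>y. eval2 (\<omega> y) v u) has_derivative (\<lambda>h. - fderiv (\<lambda>y. eval2 (\<omega> y) u v) x h)) (at x)"
    by (intro has_derivative_transform_within_open[OF has_derivative_minus S])
      (auto simp: alternating_2_swap[OF alt, symmetric])
  then show ?thesis by (simp add: frechet_derivative_at[symmetric])
qed

text \<open>
The right-hand side is minus the Lie derivative of \<open>\<Lambda>\<close> along \<open>X\<close>, evaluated on covectors with constant
coordinates.
\<close>

lemma schouten_vector_field:
  assumes alt: "\<And>y. y \<in> S \<Longrightarrow> alternating 2 (\<Lambda> c y)" and S: "open S" "x \<in> S"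
    and diff: "\<And>\<xi>. (\<lambda>y. \<Lambda> c y \<xi>) differentiable at x" and X: "X c differentiable at x"
  shows "schouten 2 1 \<Lambda> (vfield_multivector X) c x \<xi>
    = eval2 (\<Lambda> c x) (adjoint (fderiv (X c) x) (\<xi> 0)) (\<xi> 1) + eval2 (\<Lambda> c x) (\<xi> 0) (adjoint (fderiv (X c) x) (\<xi> 1))
      - fderiv (\<lambda>y. eval2 (\<Lambda> c y) (\<xi> 0) (\<xi> 1)) x (X c x)"
proof -
  let ?J = "fderiv (X c) x" and ?P = "eval2 (\<Lambda> c x)"
  let ?D = "\<lambda>\<eta> h. fderiv (\<lambda>y. \<Lambda> c y \<eta>) x h"
  have XD: "(X c has_derivative ?J) (at x)" using X by (simp add: frechet_derivative_works)
  have linJ: "linear ?J" by (rule has_derivative_linear[OF XD])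
  have D2: "?D \<eta> = fderiv (\<lambda>y. eval2 (\<Lambda> c y) (\<eta> 0) (\<eta> 1)) x" for \<eta>
    by (rule frechet_derivative_transform_within_open[OF diff S]) (rule alternating_2_eval[OF alt])
  have Dswap: "fderiv (\<lambda>y. eval2 (\<Lambda> c y) v u) x h = - fderiv (\<lambda>y. eval2 (\<Lambda> c y) u v) x h" for u v h
    by (rule fderiv_eval2_swap[where \<omega>="\<Lambda> c", OF alt S diff])
  have pairD: "fderiv (\<lambda>y. vfield_multivector X c y \<eta>) x h = \<eta> 0 \<bullet> ?J h" for \<eta> h
    using frechet_derivative_at[OF bounded_linear.has_derivative[OF bounded_linear_inner_right XD, of "\<eta> 0"]]
    by (simp add: vfield_multivector_def fun_eq_iff)
  have loc: "contract_alt u (\<Lambda> c x) w = ?P u (w 0)" for u w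
    unfolding contract_alt_def by (subst alternating_2_eval[OF alt[OF S(2)]]) simp
  have t: "Transposition.transpose 0 (Suc 0) 0 = Suc 0" "Transposition.transpose 0 (Suc 0) (Suc 0) = 0" by simp_all
  have w11: "wedge_alt 1 1 (contract_alt u (\<Lambda> c x)) (\<lambda>\<eta>. fderiv (\<lambda>y. vfield_multivector X c y \<eta>) x h) \<xi>
      = ?P u (\<xi> 0) * (\<xi> 1 \<bullet> ?J h) - ?P u (\<xi> 1) * (\<xi> 0 \<bullet> ?J h)" for u h
  proof -
    have "wedge_alt 1 1 (contract_alt u (\<Lambda> c x)) (\<lambda>\<eta>. fderiv (\<lambda>y. vfield_multivector X c y \<eta>) x h) \<xi>
        = alternate 2 (\<lambda>w. ?P u (w 0) * (w 1 \<bullet> ?J h)) \<xi>"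
      unfolding wedge_alt_def alternate_def pairD loc by (simp add: numeral_2_eq_2 mult.assoc)
    then show ?thesis by (simp add: alternate_2 t)
  qed
  have w02: "wedge_alt 0 2 (contract_alt u (vfield_multivector X c x)) (\<lambda>\<eta>. ?D \<eta> h) \<xi>
      = (u \<bullet> X c x) * fderiv (\<lambda>y. eval2 (\<Lambda> c y) (\<xi> 0) (\<xi> 1)) x h" for u h
  proof -
    have "(\<lambda>\<eta>. ?D \<eta> h) = (\<lambda>\<eta>. fderiv (\<lambda>y. eval2 (\<Lambda> c y) (\<eta> 0) (\<eta> 1)) x h)"
      by (rule ext) (rule fun_cong[OF D2])
    then have "wedge_alt 0 2 (contract_alt u (vfield_multivector X c x)) (\<lambda>\<eta>. ?D \<eta> h) \<xi>
        = wedge_alt 0 2 (contract_alt u (vfield_multivector X c x))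
            (\<lambda>\<eta>. fderiv (\<lambda>y. eval2 (\<Lambda> c y) (\<eta> 0) (\<eta> 1)) x h) \<xi>"
      by (rule arg_cong[where f="\<lambda>b. wedge_alt 0 2 (contract_alt u (vfield_multivector X c x)) b \<xi>"])
    also have "\<dots> = alternate 2 (\<lambda>w. (u \<bullet> X c x) * fderiv (\<lambda>y. eval2 (\<Lambda> c y) (w 0) (w 1)) x h) \<xi> / 2"
      unfolding wedge_alt_def alternate_def by (simp add: contract_alt_def vfield_multivector_def mult.assoc numeral_2_eq_2)
    finally show ?thesis
      using Dswap[of "\<xi> 1" "\<xi> 0" h] by (simp add: alternate_2 t)
  qed
  have linP: "linear (\<lambda>u. ?P u v)" for v by (rule alternating_2_linear(1)[OF alt[OF S(2)]])
  have adj: "(\<Sum>l\<in>UNIV. ?P (axis l 1) v * (\<xi> \<bullet> ?J (axis l 1))) = ?P (adjoint ?J \<xi>) v" for v \<xi>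
  proof -
    have "adjoint ?J \<xi> $ l = \<xi> \<bullet> ?J (axis l 1)" for l
      using adjoint_works[OF linJ, of "axis l 1" \<xi>] by (simp add: inner_axis' inner_commute)
    then show ?thesis using linear_vec_expand[OF linP[of v], of "adjoint ?J \<xi>"] by (simp add: mult.commute)
  qed
  have linD: "linear (fderiv (\<lambda>y. eval2 (\<Lambda> c y) (\<xi> 0) (\<xi> 1)) x)"
    by (rule has_derivative_linear[OF frechet_derivative_works[THEN iffD1, OF diff]])
  have "schouten 2 1 \<Lambda> (vfield_multivector X) c x \<xi> = (\<Sum>l\<in>UNIV.
      - (?P (axis l 1) (\<xi> 0) * (\<xi> 1 \<bullet> ?J (axis l 1)) - ?P (axis l 1) (\<xi> 1) * (\<xi> 0 \<bullet> ?J (axis l 1)))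
      - (axis l 1 \<bullet> X c x) * fderiv (\<lambda>y. eval2 (\<Lambda> c y) (\<xi> 0) (\<xi> 1)) x (axis l 1))"
    unfolding schouten_def using w11 w02 by (simp add: numeral_2_eq_2)
  also have "\<dots> = ?P (adjoint ?J (\<xi> 0)) (\<xi> 1) - ?P (adjoint ?J (\<xi> 1)) (\<xi> 0)
      - fderiv (\<lambda>y. eval2 (\<Lambda> c y) (\<xi> 0) (\<xi> 1)) x (X c x)"
    using linear_vec_expand[OF linD, of "X c x"]
    by (simp add: sum_subtractf sum.distrib sum_negf adj inner_axis')
  finally show ?thesis
    using alternating_2_swap[OF alt[OF S(2)], of "\<xi> 0" "adjoint ?J (\<xi> 1)"] by simp
qed

lemma ext_deriv_2:
  assumes alt: "\<And>y. y \<in> S \<Longrightarrow> alternating 2 (\<omega> c y)" and S: "open S" "x \<in> S"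
    and diff: "\<And>\<xi>. (\<lambda>y. \<omega> c y \<xi>) differentiable at x"
  shows "ext_deriv 2 \<omega> c x v = fderiv (\<lambda>y. eval2 (\<omega> c y) (v 1) (v 2)) x (v 0)
    - fderiv (\<lambda>y. eval2 (\<omega> c y) (v 0) (v 2)) x (v 1) + fderiv (\<lambda>y. eval2 (\<omega> c y) (v 0) (v 1)) x (v 2)"
proof -
  have D2: "fderiv (\<lambda>y. \<omega> c y \<eta>) x = fderiv (\<lambda>y. eval2 (\<omega> c y) (\<eta> 0) (\<eta> 1)) x" for \<eta>
    by (rule frechet_derivative_transform_within_open[OF diff S]) (rule alternating_2_eval[OF alt])
  have "fderiv (\<lambda>y. \<omega> c y (\<lambda>j. if j < i then v j else v (Suc j))) x (v i)
      = fderiv (\<lambda>y. eval2 (\<omega> c y) (if 0 < i then v 0 else v 1) (if 1 < i then v 1 else v 2)) x (v i)" for i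
    using fun_cong[OF D2[of "\<lambda>j. if j < i then v j else v (Suc j)"]] by (simp add: numeral_2_eq_2)
  then show ?thesis unfolding ext_deriv_def by (simp add: numeral_2_eq_2)
qed

lemma alternate_prod_kernel:
  assumes i: "i < k" and zero: "\<And>m. m < k \<Longrightarrow> a m (v i) = (0::real)"
  shows "alternate k (\<lambda>w. \<Prod>m<k. a m (w m)) v = 0"
  unfolding alternate_def
proof (rule sum.neutral, rule ballI)
  fix \<sigma> assume "\<sigma> \<in> {\<sigma>. \<sigma> permutes {..<k}}"
  then have \<sigma>: "\<sigma> permutes {..<k}" by simp
  obtain m where m: "m < k" "\<sigma> m = i" using permutes_image[OF \<sigma>] i by (metis imageE lessThan_iff)
  then have "(\<Prod>m<k. a m (v (\<sigma> m))) = 0" using zero[OF m(1)] by (intro prod_zero bexI[of _ m]) auto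
  then show "of_int (sign \<sigma>) * (\<Prod>m<k. a m (v (\<sigma> m))) = 0" by simp
qed

text \<open>
With \<open>b i\<close> the Lie derivative of \<open>a i\<close>, the alternated sum is the Lie derivative of the wedge product of
the \<open>a i\<close>. Evaluation on the dual frame with its \<open>l\<close>-th member replaced by \<open>u\<close> isolates \<open>b l u\<close>: any
permutation other than the identity moves two indices, so that besides the factor \<open>b i\<close> some factor
\<open>a m\<close> receives a vector of its kernel; for the identity, so does \<open>a l\<close> in all terms but the \<open>l\<close>-th.
\<close>

lemma alternate_replaced_factor:
  assumes dual: "\<And>i j. i < k \<Longrightarrow> j < k \<Longrightarrow> a i (X j) = (if i = j then 1 else (0::real))"
    and u: "\<And>m. m < k \<Longrightarrow> a m u = 0" and l: "l < k"
  shows "alternate k (\<lambda>w. \<Sum>i<k. b i (w i) * (\<Prod>m\<in>{..<k} - {i}. a m (w m))) (X(l := u)) = b l u"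
proof -
  let ?w = "X(l := u)"
  let ?G = "\<lambda>\<sigma>. \<Sum>i<k. b i (?w (\<sigma> i)) * (\<Prod>m\<in>{..<k} - {i}. a m (?w (\<sigma> m)))"
  have moved: "?G \<sigma> = 0" if \<sigma>: "\<sigma> permutes {..<k}" and ne: "\<sigma> \<noteq> id" for \<sigma>
  proof (intro sum.neutral ballI)
    fix i assume "i \<in> {..<k}"
    obtain m1 where m1: "\<sigma> m1 \<noteq> m1" using ne by (auto simp: fun_eq_iff)
    obtain m where m: "m \<noteq> i" "\<sigma> m \<noteq> m"
    proof (cases "m1 = i")
      case True
      then have "\<sigma> i \<noteq> i" using m1 by simp
      moreover have "\<sigma> (\<sigma> i) \<noteq> \<sigma> i" using calculation permutes_inj[OF \<sigma>] by (simp add: inj_eq)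
      ultimately show thesis by (rule that)
    qed (use m1 that in blast)
    have mk: "m < k" using m(2) permutes_not_in[OF \<sigma>, of m] by auto
    then have "\<sigma> m < k" using permutes_in_image[OF \<sigma>, of m] by simp
    then have "a m (?w (\<sigma> m)) = 0" using dual[OF mk, of "\<sigma> m"] u[OF mk] m(2) by simp
    then have "(\<Prod>m\<in>{..<k} - {i}. a m (?w (\<sigma> m))) = 0"
      using mk m(1) by (intro prod_zero bexI[of _ m]) auto
    then show "b i (?w (\<sigma> i)) * (\<Prod>m\<in>{..<k} - {i}. a m (?w (\<sigma> m))) = 0" by simp
  qed
  have "alternate k (\<lambda>w. \<Sum>i<k. b i (w i) * (\<Prod>m\<in>{..<k} - {i}. a m (w m))) ?w
      = (\<Sum>\<sigma> | \<sigma> permutes {..<k}. of_int (sign \<sigma>) * ?G \<sigma>)"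
    by (simp add: alternate_def)
  also have "\<dots> = (\<Sum>\<sigma>\<in>{id}. of_int (sign \<sigma>) * ?G \<sigma>)"
  proof (rule sum.mono_neutral_right)
    show "\<forall>\<sigma>\<in>{\<sigma>. \<sigma> permutes {..<k}} - {id}. of_int (sign \<sigma>) * ?G \<sigma> = 0"
      using moved by (intro ballI mult_eq_0_iff[THEN iffD2] disjI2) simp
  qed (auto simp: finite_permutations permutes_id)
  also have "\<dots> = (\<Sum>i<k. b i (?w i) * (\<Prod>m\<in>{..<k} - {i}. a m (?w m)))" by simp
  also have "\<dots> = (\<Sum>i\<in>{l}. b i (?w i) * (\<Prod>m\<in>{..<k} - {i}. a m (?w m)))"
  proof (rule sum.mono_neutral_right)
    show "\<forall>i\<in>{..<k} - {l}. b i (?w i) * (\<Prod>m\<in>{..<k} - {i}. a m (?w m)) = 0"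
    proof
      fix i assume "i \<in> {..<k} - {l}"
      then have "(\<Prod>m\<in>{..<k} - {i}. a m (?w m)) = 0"
        using l u by (intro prod_zero bexI[of _ l]) auto
      then show "b i (?w i) * (\<Prod>m\<in>{..<k} - {i}. a m (?w m)) = 0" by simp
    qed
  qed (use l in auto)
  also have "\<dots> = b l u * (\<Prod>m\<in>{..<k} - {l}. a m (?w m))" by simp
  also have "(\<Prod>m\<in>{..<k} - {l}. a m (?w m)) = 1" by (rule prod.neutral) (auto simp: dual)
  finally show ?thesis by (simp only: mult_1_right)
qed

lemma alternate_prod_dual:
  assumes dual: "\<And>i j. i < k \<Longrightarrow> j < k \<Longrightarrow> a i (X j) = (if i = j then 1 else (0::real))"
  shows "alternate k (\<lambda>w. \<Prod>m<k. a m (w m)) X = 1"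
proof -
  have "(\<Prod>m<k. a m (X (\<sigma> m))) = 0" if \<sigma>: "\<sigma> permutes {..<k}" and ne: "\<sigma> \<noteq> id" for \<sigma>
  proof -
    obtain m where m: "\<sigma> m \<noteq> m" using ne by (auto simp: fun_eq_iff)
    have mk: "m < k" using m permutes_not_in[OF \<sigma>, of m] by auto
    then have "\<sigma> m < k" using permutes_in_image[OF \<sigma>, of m] by simp
    then have "a m (X (\<sigma> m)) = 0" using dual[OF mk, of "\<sigma> m"] m by simp
    then show ?thesis using mk by (intro prod_zero bexI[of _ m]) auto
  qed
  then have "alternate k (\<lambda>w. \<Prod>m<k. a m (w m)) X
      = (\<Sum>\<sigma>\<in>{id}. of_int (sign \<sigma>) * (\<Prod>m<k. a m (X (\<sigma> m))))"
    unfolding alternate_def by (intro sum.mono_neutral_right) (auto simp: finite_permutations permutes_id)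
  also have "\<dots> = 1" by (simp add: dual)
  finally show ?thesis .
qed

lemma lie_deriv_wedge_family:
  assumes S: "open S" "x \<in> S" and alt: "\<And>i y. i < k \<Longrightarrow> y \<in> S \<Longrightarrow> alternating 1 (\<alpha> i c y)"
    and diff: "\<And>i v. i < k \<Longrightarrow> (\<lambda>y. \<alpha> i c y v) differentiable at x"
  shows "lie_deriv k Y (wedge_family k \<alpha>) c x v = alternate k (\<lambda>w. \<Sum>i<k.
      (fderiv (\<lambda>y. \<alpha> i c y (\<lambda>_. w i)) x (Y c x) + \<alpha> i c x (\<lambda>_. fderiv (Y c) x (w i))) *
      (\<Prod>m\<in>{..<k} - {i}. \<alpha> m c x (\<lambda>_. w m))) v"
proof -
  let ?J = "fderiv (Y c) x" and ?h = "Y c x"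
  let ?g = "\<lambda>y w. \<Prod>m<k. \<alpha> m c y (\<lambda>_. w m)"
  let ?r = "\<lambda>i w. \<Prod>m\<in>{..<k} - {i}. \<alpha> m c x (\<lambda>_. w m)"
  have D: "((\<lambda>y. \<alpha> i c y v) has_derivative fderiv (\<lambda>y. \<alpha> i c y v) x) (at x)" if "i < k" for i v
    using diff[OF that] by (simp add: frechet_derivative_works)
  have \<mu>: "wedge_family k \<alpha> c y = alternate k (?g y)" if "y \<in> S" for y
    by (rule wedge_family_alternate) (rule alt[OF _ that])
  have prodD: "((\<lambda>y. ?g y w) has_derivative (\<lambda>h. \<Sum>i<k. fderiv (\<lambda>y. \<alpha> i c y (\<lambda>_. w i)) x h * ?r i w)) (at x)" for w
    by (rule has_derivative_prod) (rule D, simp)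
  have "((\<lambda>y. alternate k (?g y) v) has_derivative
      (\<lambda>h. alternate k (\<lambda>w. \<Sum>i<k. fderiv (\<lambda>y. \<alpha> i c y (\<lambda>_. w i)) x h * ?r i w) v)) (at x)"
    unfolding alternate_def by (intro has_derivative_sum has_derivative_mult_right prodD)
  then have "((\<lambda>y. wedge_family k \<alpha> c y v) has_derivative
      (\<lambda>h. alternate k (\<lambda>w. \<Sum>i<k. fderiv (\<lambda>y. \<alpha> i c y (\<lambda>_. w i)) x h * ?r i w) v)) (at x)"
    by (rule has_derivative_transform_within_open[OF _ S]) (simp add: \<mu>)
  then have 1: "fderiv (\<lambda>y. wedge_family k \<alpha> c y v) x ?h
      = alternate k (\<lambda>w. \<Sum>i<k. fderiv (\<lambda>y. \<alpha> i c y (\<lambda>_. w i)) x ?h * ?r i w) v"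
    by (simp add: frechet_derivative_at[symmetric])
  have "(\<Sum>i<k. alternate k (?g x) (v(i := ?J (v i)))) = alternate k (\<lambda>w. \<Sum>i<k. ?g x (w(i := ?J (w i)))) v"
    by (rule alternate_derivation)
  also have "\<dots> = alternate k (\<lambda>w. \<Sum>i<k. \<alpha> i c x (\<lambda>_. ?J (w i)) * ?r i w) v"
  proof (intro alternate_cong sum.cong refl)
    fix w i assume i: "i \<in> {..<k}"
    have "?g x (w(i := ?J (w i))) = \<alpha> i c x (\<lambda>_. (w(i := ?J (w i))) i) * ?r i (w(i := ?J (w i)))"
      by (rule prod.remove) (use i in auto)
    also have "?r i (w(i := ?J (w i))) = ?r i w" by (rule prod.cong) auto
    finally show "?g x (w(i := ?J (w i))) = \<alpha> i c x (\<lambda>_. ?J (w i)) * ?r i w" by simp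
  qed
  finally have 2: "(\<Sum>i<k. wedge_family k \<alpha> c x (v(i := ?J (v i)))) = alternate k (\<lambda>w. \<Sum>i<k. \<alpha> i c x (\<lambda>_. ?J (w i)) * ?r i w) v"
    by (simp add: \<mu>[OF S(2)])
  show ?thesis
    unfolding lie_deriv_def 1 2 alternate_def
    by (simp add: sum.distrib distrib_right distrib_left)
qed

text \<open>
For \<open>D h u v\<close> the derivative of \<open>\<omega>(u, v)\<close> in the direction \<open>h\<close>, the map \<open>e\<close> is the exterior derivative
of \<open>\<omega>\<close>.
\<close>

lemma antisymmetrized_transpose:
  fixes e :: "(nat \<Rightarrow> 'v) \<Rightarrow> real" and D :: "'v \<Rightarrow> 'v \<Rightarrow> 'v \<Rightarrow> real"
  assumes e: "\<And>v. e v = D (v 0) (v 1) (v 2) - D (v 1) (v 0) (v 2) + D (v 2) (v 0) (v 1)"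
    and D: "\<And>h u v. D h v u = - D h u v"
   and that: "a \<in> {..<3}" "b \<in> {..<3}" "a \<noteq> (b::nat)"
  shows "e (\<lambda>i. w (Transposition.transpose a b i)) = - e w"
proof -
    have "a = 0 \<and> b = 1 \<or> a = 0 \<and> b = 2 \<or> a = 1 \<and> b = 2 \<or> a = 1 \<and> b = 0 \<or> a = 2 \<and> b = 0 \<or> a = 2 \<and> b = 1"
      using that by auto
    then show ?thesis
      unfolding e using D[of "w 0" "w 1" "w 2"] D[of "w 0" "w 2" "w 1"] D[of "w 1" "w 0" "w 2"]
        D[of "w 1" "w 2" "w 0"] D[of "w 2" "w 0" "w 1"] D[of "w 2" "w 1" "w 0"]
      by (elim disjE conjE) (simp_all add: Transposition.transpose_def)
qed

lemma ext_deriv_2_permute: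
  assumes alt: "\<And>y. y \<in> S \<Longrightarrow> alternating 2 (\<omega> c y)" and S: "open S" "x \<in> S"
    and diff: "\<And>\<xi>. (\<lambda>y. \<omega> c y \<xi>) differentiable at x" and \<sigma>: "\<sigma> permutes {..<3}"
  shows "ext_deriv 2 \<omega> c x (\<lambda>i. v (\<sigma> i)) = of_int (sign \<sigma>) * ext_deriv 2 \<omega> c x v"
proof -
  have e: "ext_deriv 2 \<omega> c x v = fderiv (\<lambda>y. eval2 (\<omega> c y) (v 1) (v 2)) x (v 0)
      - fderiv (\<lambda>y. eval2 (\<omega> c y) (v 0) (v 2)) x (v 1) + fderiv (\<lambda>y. eval2 (\<omega> c y) (v 0) (v 1)) x (v 2)" for v
    by (rule ext_deriv_2[where \<omega>=\<omega> and c=c, OF alt S diff])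
  have s: "fderiv (\<lambda>y. eval2 (\<omega> c y) v u) x h = - fderiv (\<lambda>y. eval2 (\<omega> c y) u v) x h" for u v h
    by (rule fderiv_eval2_swap[where \<omega>="\<omega> c", OF alt S diff])
  have transposed: "ext_deriv 2 \<omega> c x (\<lambda>i. w (Transposition.transpose a b i)) = - ext_deriv 2 \<omega> c x w"
    if "a \<in> {..<3}" "b \<in> {..<3}" "a \<noteq> b" for a b w
    by (rule antisymmetrized_transpose[where D="\<lambda>h u v. fderiv (\<lambda>y. eval2 (\<omega> c y) u v) x h", OF e s that])
  have "\<forall>v. ext_deriv 2 \<omega> c x (\<lambda>i. v (\<sigma> i)) = of_int (sign \<sigma>) * ext_deriv 2 \<omega> c x v"
    using finite_lessThan \<sigma>
  proof (induction rule: permutes_rev_induct)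
    case id
    show ?case by simp
  next
    case (swap a b p)
    have "sign (p \<circ> Transposition.transpose a b) = - sign p"
      using swap.hyps by (subst sign_perm_compose[of _ 3]) (auto intro!: permutes_swap_id simp: sign_swap_id)
    moreover have "ext_deriv 2 \<omega> c x (\<lambda>i. v (p (Transposition.transpose a b i))) = - ext_deriv 2 \<omega> c x (\<lambda>i. v (p i))" for v
      using \<open>a \<in> {..<3}\<close> \<open>b \<in> {..<3}\<close> \<open>a \<noteq> b\<close> by (rule transposed)
    ultimately show ?case using swap.IH by (simp add: o_def)
  qed
  then show ?thesis by blast
qed

section \<open>Foliations with a transversal frame\<close>

text \<open>
The data shared by the two conclusions. The condition on \<open>L\<^sub>X\<mu>\<close> is left out: it serves to show
that the fields \<open>X j\<close> leave the forms \<open>\<alpha> i\<close> invariant along the leaves, which for the fields in the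
definition of transversal constancy follows from their preserving the foliation.
\<close>

locale foliated_poisson =
  fixes A :: "('a::t2_space, 'n::finite) chart set" and k r :: nat
    and \<alpha> :: "nat \<Rightarrow> ('a, 'n) tfield" and \<omega> \<Lambda> :: "('a, 'n) tfield" and X :: "nat \<Rightarrow> ('a, 'n) vfield"
  assumes atlas: "smooth_atlas A"
    and dimension: "CARD('n) = k + 2 * r"
    and form_\<alpha>: "\<And>i. i < k \<Longrightarrow> form A 1 (\<alpha> i)"
    and vector_field_X: "\<And>j. j < k \<Longrightarrow> vector_field A UNIV (X j)"
    and dual: "\<And>i j. i < k \<Longrightarrow> j < k \<Longrightarrow> tensor_eq A UNIV (contract (X j) (\<alpha> i)) (\<lambda>c x v. if i = j then 1 else 0)"
    and form_\<omega>: "form A 2 \<omega>"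
    and volume: "volume_form A (wedge k (2 * r) (wedge_family k \<alpha>) (wedge_power r \<omega>))"
    and transverse: "\<And>j. j < k \<Longrightarrow> tensor_eq A UNIV (contract (X j) \<omega>) zero_tensor"
    and bivector: "multivector_field A 2 \<Lambda>"
    and characteristic: "\<And>c x. c \<in> A \<Longrightarrow> x \<in> coords c UNIV \<Longrightarrow> characteristic_distr \<Lambda> c x = kernel_distr k \<alpha> c x"
    and contraction: "tensor_eq A UNIV
           (contract_bivector \<Lambda> (wedge k (2 * r) (wedge_family k \<alpha>) (wedge_power r \<omega>)))
           (\<lambda>c x v. real r * wedge k (2 * (r - 1)) (wedge_family k \<alpha>) (wedge_power (r - 1) \<omega>) c x v)"
    and relatively_closed: "\<And>j. j < k \<Longrightarrow> tensor_eq A UNIV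
           (wedge (k - 1) 3 (contract (X j) (wedge_family k \<alpha>)) (ext_deriv 2 \<omega>)) zero_tensor"
begin

context
  fixes c :: "('a, 'n) chart" assumes c: "c \<in> A"
begin

lemma chart: "is_chart c" by (rule smooth_atlasD(1)[OF atlas c])

lemma open_U: "open (coords c UNIV)" by (rule open_coords[OF chart open_UNIV])

lemma alternating_fields:
  assumes "x \<in> coords c UNIV"
  shows "i < k \<Longrightarrow> alternating 1 (\<alpha> i c x)" "alternating 2 (\<omega> c x)" "alternating 2 (\<Lambda> c x)"
  using form_\<alpha>[of i] form_\<omega> bivector c assms by (simp_all add: form_def multivector_field_def)

lemma differentiable_fields:
  assumes "x \<in> coords c UNIV"
  shows "i < k \<Longrightarrow> (\<lambda>y. \<alpha> i c y v) differentiable at x" "(\<lambda>y. \<omega> c y v) differentiable at x"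
    "(\<lambda>y. \<Lambda> c y v) differentiable at x" "(\<lambda>y. sharp (\<Lambda> c y) \<eta>) differentiable at x"
proof -
  show "i < k \<Longrightarrow> (\<lambda>y. \<alpha> i c y v) differentiable at x" "(\<lambda>y. \<omega> c y v) differentiable at x"
    "(\<lambda>y. \<Lambda> c y v) differentiable at x"
    using form_\<alpha>[of i] form_\<omega> bivector c assms
    by (auto intro!: smooth_on_differentiable[of "coords c UNIV"] simp: form_def multivector_field_def)
  have "smooth_on (coords c UNIV) (\<lambda>y. sharp (\<Lambda> c y) \<eta>)"
    by (rule smooth_on_sharp[OF open_U])
      (use bivector c in \<open>auto simp: multivector_field_def smooth_on_def Ck_on_const\<close>)
  then show "(\<lambda>y. sharp (\<Lambda> c y) \<eta>) differentiable at x" by (rule smooth_on_differentiable[OF _ assms])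
qed

lemma dual_values:
  assumes "x \<in> coords c UNIV" "i < k" "j < k"
  shows "\<alpha> i c x (\<lambda>_. X j c x) = (if i = j then 1 else 0)"
proof -
  have "\<alpha> i c x (case_nat (X j c x) (\<lambda>_. X j c x)) = (if i = j then 1 else 0)"
    using dual[OF assms(2,3)] c assms(1) unfolding tensor_eq_def contract_def contract_alt_def by meson
  moreover have "\<alpha> i c x (case_nat (X j c x) (\<lambda>_. X j c x)) = \<alpha> i c x (\<lambda>_. X j c x)"
    by (rule alternating_local[OF alternating_fields(1)[OF assms(1,2)]]) simp
  ultimately show ?thesis by simp
qed

lemma \<omega>_transverse:
  assumes "x \<in> coords c UNIV" "j < k"
  shows "eval2 (\<omega> c x) (X j c x) v = 0"
  using transverse[OF assms(2)] c assms(1) unfolding tensor_eq_def contract_def contract_alt_def by meson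

lemma sharp_in_kernel:
  assumes "x \<in> coords c UNIV" shows "sharp (\<Lambda> c x) \<eta> \<in> kernel_distr k \<alpha> c x"
  using characteristic[OF c assms] by (auto simp: characteristic_distr_def)

text \<open>
The leaf directions form the image of \<open>\<Lambda>\<^sup>#\<close>, and every covector is the differential of a global
smooth function.
\<close>

lemma hamiltonian_through:
  assumes "x \<in> coords c UNIV" "u \<in> kernel_distr k \<alpha> c x"
  obtains f where "smooth_function A f" "hamiltonian_vf \<Lambda> f c x = u"
proof -
  obtain \<eta> where "u = sharp (\<Lambda> c x) \<eta>"
    using assms characteristic[OF c assms(1)] by (auto simp: characteristic_distr_def)
  moreover obtain f where "smooth_function A f" "differential f c x = \<eta>"
    by (rule smooth_function_with_differential[OF atlas c assms(1)])
  ultimately show thesis using that by (simp add: hamiltonian_vf_def)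
qed

lemma inverse_on_leaves:
  assumes x: "x \<in> coords c UNIV" and u: "u \<in> kernel_distr k \<alpha> c x"
  shows "eval2 (\<omega> c x) u (sharp (\<Lambda> c x) \<xi>) = \<xi> \<bullet> u"
proof -
  note alt = alternating_fields[OF x]
  let ?a = "\<lambda>i u. \<alpha> i c x (\<lambda>_. u)" and ?b = "\<lambda>u v. eval2 (\<omega> c x) u v / 2"
  have top: "wedge k (2 * s) (wedge_family k \<alpha>) (wedge_power s \<omega>) c x = alternate (k + 2 * s) (block k s ?a ?b)" for s
    by (rule top_form_alternate, erule alt(1), rule alt(2))
  obtain v where v: "alternate (k + 2 * r) (block k r ?a ?b) v \<noteq> 0"
    using volume c x unfolding volume_form_def top[symmetric] by blast
  have "2 * (\<Sum>j\<in>UNIV. eval2 (\<Lambda> c x) \<xi> (axis j 1) * ?b u (axis j 1)) = \<xi> \<bullet> u"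
  proof (rule inverse_on_kernel[where a="?a" and b="?b" and P="eval2 (\<Lambda> c x)" and v=v and k=k and r=r])
    show "CARD('n) = k + 2 * r" by (rule dimension)
    show "alternating (k + 2 * r) (alternate (k + 2 * r) (block k r ?a ?b))"
      using volume c x dimension unfolding volume_form_def form_def top[symmetric] by simp
    show "alternate (k + 2 * r) (block k r ?a ?b) v \<noteq> 0" by (rule v)
    show "linear (?b u)" for u
      using linear_compose[OF alternating_2_linear(2)[OF alt(2), of u], of "\<lambda>t. t / 2"]
      by (simp add: o_def linear_iff field_simps)
    show "?b v u = - ?b u v" for u v using alternating_2_swap[OF alt(2), of v u] by simp
    show "linear (eval2 (\<Lambda> c x) \<eta>)" for \<eta> by (rule alternating_2_linear(2)[OF alt(3)])
    show "eval2 (\<Lambda> c x) \<beta> \<eta> = - eval2 (\<Lambda> c x) \<eta> \<beta>" for \<eta> \<beta>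
      by (rule alternating_2_swap[OF alt(3)])
    show "linear (?a i)" if "i < k" for i by (rule alternating_1_linear[OF alt(1)[OF that]])
    show "?a i u = 0" if "i < k" for i using u that by (simp add: kernel_distr_def)
    fix v
    have "contract_bivector \<Lambda> (wedge k (2 * r) (wedge_family k \<alpha>) (wedge_power r \<omega>)) c x v
        = real r * wedge k (2 * (r - 1)) (wedge_family k \<alpha>) (wedge_power (r - 1) \<omega>) c x v"
      using contraction c x unfolding tensor_eq_def by meson
    then show "(\<Sum>i\<in>UNIV. \<Sum>j\<in>UNIV. eval2 (\<Lambda> c x) (axis i 1) (axis j 1) *
        alternate (k + 2 * r) (block k r ?a ?b) (case_nat (axis i 1) (case_nat (axis j 1) v)))
      = 2 * (real r * alternate (k + 2 * (r - 1)) (block k (r - 1) ?a ?b) v)"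
      unfolding contract_bivector_def contract_alt_def top by simp
  qed
  moreover have "eval2 (\<omega> c x) u (sharp (\<Lambda> c x) \<xi>) = (\<Sum>j\<in>UNIV. sharp (\<Lambda> c x) \<xi> $ j * eval2 (\<omega> c x) u (axis j 1))"
    by (rule linear_vec_expand[OF alternating_2_linear(2)[OF alt(2)]])
  ultimately show ?thesis by (simp add: sharp_def sum_distrib_left)
qed

abbreviation d\<omega> :: "real^'n \<Rightarrow> real^'n \<Rightarrow> real^'n \<Rightarrow> real^'n \<Rightarrow> real" where
  "d\<omega> x h u v \<equiv> fderiv (\<lambda>y. eval2 (\<omega> c y) u v) x h
    - fderiv (\<lambda>y. eval2 (\<omega> c y) h v) x u + fderiv (\<lambda>y. eval2 (\<omega> c y) h u) x v"

text \<open>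
The form \<open>i\<^sub>X\<mu>\<close> with \<open>X = X j\<close> vanishes when one of its arguments is \<open>X j\<close> or tangent to the leaves,
and does not vanish on the other members of the frame. So in the relation
\<open>i\<^sub>X\<mu> \<and> d\<omega> = 0\<close>, evaluated on these members followed by \<open>X j\<close>, \<open>u\<close>, \<open>v\<close>, the factors separate.
\<close>

lemma d\<omega>_transverse:
  assumes x: "x \<in> coords c UNIV" and j: "j < k"
    and u: "u \<in> kernel_distr k \<alpha> c x" and v: "v \<in> kernel_distr k \<alpha> c x"
  shows "d\<omega> x (X j c x) u v = 0"
proof -
  let ?\<mu> = "wedge_family k \<alpha> c x"
  let ?Xj = "X j c x"
  \<comment> \<open>The frame without \<open>X j\<close>: transposing \<open>0\<close> and \<open>j\<close> and dropping the first entry removes \<open>X j\<close>.\<close>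
  define w where "w i = (if i < k - 1 then X (Transposition.transpose 0 j (Suc i)) c x
    else if i = k - 1 then ?Xj else if i = k then u else v)" for i
  note dual_x = dual_values[OF x]
  have \<mu>: "?\<mu> = alternate k (\<lambda>w. \<Prod>m<k. \<alpha> m c x (\<lambda>_. w m))"
    by (rule wedge_family_alternate) (rule alternating_fields(1)[OF x])
  have \<mu>_kernel: "?\<mu> z = 0" if "i < k" "z i \<in> kernel_distr k \<alpha> c x" for z i
    unfolding \<mu> by (rule alternate_prod_kernel[OF that(1)]) (use that(2) in \<open>auto simp: kernel_distr_def\<close>)
  have \<mu>_local: "?\<mu> z = ?\<mu> z'" if "\<And>i. i < k \<Longrightarrow> z i = z' i" for z z'
    unfolding \<mu> by (rule alternate_local[OF _ that]) (auto intro: prod.cong)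
  let ?a = "contract (X j) (wedge_family k \<alpha>) c x" and ?b = "ext_deriv 2 \<omega> c x"
  have b: "?b z = d\<omega> x (z 0) (z 1) (z 2)" for z
    by (rule ext_deriv_2[where \<omega>=\<omega> and c=c, OF alternating_fields(2) open_U x differentiable_fields(2)[OF x]])
  have a: "?a z = ?\<mu> (case_nat ?Xj z)" for z by (simp add: contract_def contract_alt_def)
  have "?a w * ?b (\<lambda>i. w (k - 1 + i)) = 0"
  proof (rule wedge_alt_zero_factor[where a="?a" and b="?b" and p="k - 1" and q=3 and w=w])
    fix \<sigma> z assume \<sigma>: "\<sigma> permutes {..<k - 1}"
    have "case_nat ?Xj (\<lambda>i. z (\<sigma> i)) = (\<lambda>i. case_nat ?Xj z (shift_perm 1 \<sigma> i))"
      by (auto simp: fun_eq_iff shift_perm_def split: nat.split)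
    moreover have "shift_perm 1 \<sigma> permutes {..<k}" using shift_perm(1)[OF \<sigma>, of 1] j by simp
    ultimately show "?a (\<lambda>i. z (\<sigma> i)) = of_int (sign \<sigma>) * ?a z"
      unfolding a \<mu> using alternate_permute[of "shift_perm 1 \<sigma>" k] shift_perm(2)[OF \<sigma>, of 1] by simp
  next
    fix z z' :: "nat \<Rightarrow> real^'n" assume "\<And>i. i < k - 1 \<Longrightarrow> z i = z' i"
    then show "?a z = ?a z'" unfolding a by (intro \<mu>_local) (auto split: nat.split)
  next
    fix \<sigma> z assume \<sigma>: "\<sigma> permutes {..<3::nat}"
    show "?b (\<lambda>i. z (\<sigma> i)) = of_int (sign \<sigma>) * ?b z"
      by (rule ext_deriv_2_permute[where \<omega>=\<omega> and c=c and v=z and \<sigma>=\<sigma>, OF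
            alternating_fields(2) open_U x differentiable_fields(2)[OF x] \<sigma>])
  next
    fix z z' :: "nat \<Rightarrow> real^'n" assume "\<And>i. i < 3 \<Longrightarrow> z i = z' i"
    then show "?b z = ?b z'"
      unfolding b by simp
  next
    fix \<sigma> i assume i: "i < k - 1" "k - 1 \<le> \<sigma> i" and \<sigma>: "\<sigma> permutes {..<k - 1 + 3}"
    let ?z = "case_nat ?Xj (\<lambda>i. w (\<sigma> i))"
    show "?a (\<lambda>i. w (\<sigma> i)) = 0"
    proof (cases "\<sigma> i = k - 1")
      case True
      then have "?z 0 = ?z (Suc i)" by (simp add: w_def)
      then show ?thesis unfolding a \<mu> using i by (intro alternate_repeated[of 0 k "Suc i"]) auto
    next
      case False
      then have "?z (Suc i) \<in> kernel_distr k \<alpha> c x" using i u v by (simp add: w_def)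
      then show ?thesis unfolding a using i by (intro \<mu>_kernel[of "Suc i"]) auto
    qed
  next
    show "wedge_alt (k - 1) 3 ?a ?b w = 0"
      using relatively_closed[OF j] c x unfolding tensor_eq_def wedge_def by meson
  qed
  moreover have "?a w \<noteq> 0"
  proof -
    have "?a w = ?\<mu> (\<lambda>i. X (Transposition.transpose 0 j i) c x)"
      unfolding a by (rule \<mu>_local) (auto simp: w_def split: nat.split)
    also have "\<dots> = of_int (sign (Transposition.transpose 0 j)) * ?\<mu> (\<lambda>i. X i c x)"
      unfolding \<mu> using j by (intro alternate_permute[of _ k _ "\<lambda>i. X i c x"] permutes_swap_id) auto
    also have "?\<mu> (\<lambda>i. X i c x) = 1"
      unfolding \<mu> by (rule alternate_prod_dual) (rule dual_x)
    finally show ?thesis by simp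
  qed
  ultimately have "?b (\<lambda>i. w (k - 1 + i)) = 0" by simp
  moreover have "w (k - 1 + 0) = ?Xj" "w (k - 1 + 1) = u" "w (k - 1 + 2) = v" using j by (auto simp: w_def)
  ultimately show ?thesis
    unfolding b by simp
qed

end

text \<open>
At each point \<open>Y\<close> is a linear combination of the \<open>X j\<close>, so \<open>i\<^sub>Y\<omega> = 0\<close>, and \<open>d\<omega>(Y, u, v) = 0\<close> for leaf
vectors \<open>u\<close> and \<open>v\<close>. By Cartan's formula this makes \<open>\<omega>\<close> invariant along the leaves; the invariance of
the \<open>\<alpha> i\<close> is assumed, and \<open>lie_derivative_of_inverse_zero\<close> applies.
\<close>

lemma poisson_vector_field_if_leafwise_invariant:
  assumes W: "open W" and Y: "vector_field A W Y"
    and transversal: "vfield_in A W Y (\<lambda>c x. span ((\<lambda>j. X j c x) ` {..<k}))"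
    and L\<alpha>: "\<And>c x i u. c \<in> A \<Longrightarrow> x \<in> coords c W \<Longrightarrow> i < k \<Longrightarrow> u \<in> kernel_distr k \<alpha> c x \<Longrightarrow>
      fderiv (\<lambda>y. \<alpha> i c y (\<lambda>_. u)) x (Y c x) + \<alpha> i c x (\<lambda>_. fderiv (Y c) x u) = 0"
  shows "poisson_vector_field A W \<Lambda> Y"
  unfolding poisson_vector_field_def tensor_eq_def
proof (intro conjI Y ballI ext)
  fix c x and \<xi> :: "nat \<Rightarrow> real^'n" assume c: "c \<in> A" and x: "x \<in> coords c W"
  let ?S = "coords c W" and ?J = "fderiv (Y c) x"
  have S: "open ?S" "x \<in> ?S" using open_coords[OF chart[OF c] W] x by auto
  have sub: "y \<in> coords c UNIV" if "y \<in> ?S" for y using that coords_subset by blast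
  note alt = alternating_fields[OF c sub] and diff = differentiable_fields[OF c sub[OF x]]
  have Yd: "Y c differentiable at x"
    using Y c x by (auto simp: vector_field_def intro: smooth_on_differentiable)
  then have YD: "(Y c has_derivative ?J) (at x)" by (simp add: frechet_derivative_works)
  have \<omega>Y: "eval2 (\<omega> c y) (Y c y) v = 0" if "y \<in> ?S" for y v
  proof (rule linear_eq_0_on_span[OF alternating_2_linear(1)[OF alt(2)[OF that]]])
    show "Y c y \<in> span ((\<lambda>j. X j c y) ` {..<k})" using transversal c that by (simp add: vfield_in_def)
  qed (use \<omega>_transverse[OF c sub[OF that]] in auto)
  \<comment> \<open>Differentiating \<open>\<omega>(Y, v) = 0\<close> trades derivatives of \<open>\<omega>\<close> for derivatives of \<open>Y\<close>.\<close>
  have move: "fderiv (\<lambda>y. eval2 (\<omega> c y) (Y c x) v) x h + eval2 (\<omega> c x) (?J h) v = 0" for h v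
  proof -
    have "((\<lambda>y. eval2 (\<omega> c y) (Y c y) v) has_derivative
        (\<lambda>h. fderiv (\<lambda>y. eval2 (\<omega> c y) (Y c x) v) x h + eval2 (\<omega> c x) (?J h) v)) (at x)"
      using has_derivative_linear_family[OF S alternating_2_linear(1)[OF alt(2)] diff(2) YD] .
    moreover have "((\<lambda>y. eval2 (\<omega> c y) (Y c y) v) has_derivative (\<lambda>h. 0)) (at x)"
      by (rule has_derivative_transform_within_open[OF has_derivative_const S]) (simp add: \<omega>Y)
    ultimately have "(\<lambda>h. fderiv (\<lambda>y. eval2 (\<omega> c y) (Y c x) v) x h + eval2 (\<omega> c x) (?J h) v) = (\<lambda>h. 0)"
      by (rule has_derivative_unique)
    then show ?thesis by metis
  qed
  have d\<omega>Y: "d\<omega> c x (Y c x) u v = 0"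
    if u: "u \<in> kernel_distr k \<alpha> c x" and v: "v \<in> kernel_distr k \<alpha> c x" for u v
  proof (rule linear_eq_0_on_span[where f="\<lambda>h. d\<omega> c x h u v"])
    have 1: "linear (\<lambda>h. fderiv (\<lambda>y. eval2 (\<omega> c y) h v) x u)" for u v
      by (rule derivative_of_linear_family[OF S alternating_2_linear(1)[OF alt(2)] diff(2)])
    have 2: "linear (fderiv (\<lambda>y. eval2 (\<omega> c y) u v) x)"
      by (rule has_derivative_linear[OF frechet_derivative_works[THEN iffD1, OF diff(2)]])
    show "linear (\<lambda>h. d\<omega> c x h u v)"
      using linear_compose_add[OF linear_compose_sub[OF 2 1] 1] .
    show "Y c x \<in> span ((\<lambda>j. X j c x) ` {..<k})" using transversal c x by (simp add: vfield_in_def)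
  qed (use d\<omega>_transverse[OF c sub[OF x] _ u v] in auto)
  have L\<omega>: "fderiv (\<lambda>y. eval2 (\<omega> c y) u v) x (Y c x) + eval2 (\<omega> c x) (?J u) v + eval2 (\<omega> c x) u (?J v) = 0"
    if "\<And>i. i < k \<Longrightarrow> \<alpha> i c x (\<lambda>_. u) = 0" "\<And>i. i < k \<Longrightarrow> \<alpha> i c x (\<lambda>_. v) = 0" for u v
    using d\<omega>Y[of u v] move[of v u] move[of u v] alternating_2_swap[OF alt(2)[OF x], of u "?J v"] that
    by (simp add: kernel_distr_def)
  have "fderiv (\<lambda>y. eval2 (\<Lambda> c y) (\<xi> 0) (\<xi> 1)) x (Y c x)
      = eval2 (\<Lambda> c x) (adjoint ?J (\<xi> 0)) (\<xi> 1) + eval2 (\<Lambda> c x) (\<xi> 0) (adjoint ?J (\<xi> 1))"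
  proof (rule lie_derivative_of_inverse_zero[where \<omega>="\<omega> c" and \<alpha>="\<lambda>i. \<alpha> i c" and k=k, OF S])
    show "\<alpha> i c y (\<lambda>_. sharp (\<Lambda> c y) \<eta>) = 0" if "y \<in> ?S" "i < k" for y i \<eta>
      using sharp_in_kernel[OF c sub[OF that(1)]] that(2) by (auto simp: kernel_distr_def)
    show "eval2 (\<omega> c y) u (sharp (\<Lambda> c y) \<xi>) = \<xi> \<bullet> u" if "y \<in> ?S" "\<And>i. i < k \<Longrightarrow> \<alpha> i c y (\<lambda>_. u) = 0" for y u \<xi>
      using inverse_on_leaves[OF c sub[OF that(1)]] that(2) by (auto simp: kernel_distr_def)
    show "fderiv (\<lambda>y. \<alpha> i c y (\<lambda>_. u)) x (Y c x) + \<alpha> i c x (\<lambda>_. ?J u) = 0"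
      if "i < k" "\<And>i. i < k \<Longrightarrow> \<alpha> i c x (\<lambda>_. u) = 0" for i u
      using that by (intro L\<alpha>[OF c x]) (auto simp: kernel_distr_def)
  qed (use alt diff Yd L\<omega> in auto)
  then show "schouten 2 1 \<Lambda> (vfield_multivector Y) c x \<xi> = 0"
    by (subst schouten_vector_field[where \<Lambda>=\<Lambda> and c=c and X=Y, OF alt(3) S diff(3) Yd]) simp_all
qed

text \<open>
Since \<open>u\<close> is a Hamiltonian vector, \<open>L\<^sub>Y\<mu>\<close> vanishes as soon as one argument is \<open>u\<close>; its value on the
frame with \<open>X i\<close> replaced by \<open>u\<close> is \<open>(L\<^sub>Y\<alpha>\<^sub>i)(u)\<close>.
\<close>

lemma leafwise_invariant_if_lie_deriv_\<mu>:
  assumes a: "\<And>f. smooth_function A f \<Longrightarrow>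
      tensor_eq A UNIV (contract (hamiltonian_vf \<Lambda> f) (lie_deriv k Y (wedge_family k \<alpha>))) zero_tensor"
    and c: "c \<in> A" and x: "x \<in> coords c UNIV" and i: "i < k" and u: "u \<in> kernel_distr k \<alpha> c x"
  shows "fderiv (\<lambda>y. \<alpha> i c y (\<lambda>_. u)) x (Y c x) + \<alpha> i c x (\<lambda>_. fderiv (Y c) x u) = 0"
proof -
  let ?G = "\<lambda>w. \<Sum>i<k.
      (fderiv (\<lambda>y. \<alpha> i c y (\<lambda>_. w i)) x (Y c x) + \<alpha> i c x (\<lambda>_. fderiv (Y c) x (w i))) *
      (\<Prod>m\<in>{..<k} - {i}. \<alpha> m c x (\<lambda>_. w m))"
  have L: "lie_deriv k Y (wedge_family k \<alpha>) c x v = alternate k ?G v" for v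
    by (rule lie_deriv_wedge_family[OF open_U[OF c] x], rule alternating_fields(1)[OF c], assumption, assumption,
      rule differentiable_fields(1)[OF c x], assumption)
  obtain f where f: "smooth_function A f" "hamiltonian_vf \<Lambda> f c x = u"
    by (rule hamiltonian_through[OF c x u])
  have zero: "alternate k ?G (case_nat u v) = 0" for v
    using a[OF f(1)] c x unfolding tensor_eq_def contract_def contract_alt_def f(2) L by (metis f(2) L)
  let ?w = "(\<lambda>j. X j c x)(i := u)"
  \<comment> \<open>The transposition moves \<open>u\<close> into the first slot, where the hypothesis applies.\<close>
  let ?t = "Transposition.transpose 0 i"
  have "(\<lambda>m. ?w (?t m)) = case_nat u (\<lambda>m. ?w (?t (Suc m)))"
    by (auto simp: fun_eq_iff split: nat.split)
  then have "alternate k ?G (\<lambda>m. ?w (?t m)) = 0" using zero by simp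
  moreover have "alternate k ?G (\<lambda>m. ?w (?t m)) = of_int (sign ?t) * alternate k ?G ?w"
    using i by (intro alternate_permute permutes_swap_id) auto
  ultimately have "alternate k ?G ?w = 0" by simp
  moreover have "alternate k ?G ?w = fderiv (\<lambda>y. \<alpha> i c y (\<lambda>_. u)) x (Y c x) + \<alpha> i c x (\<lambda>_. fderiv (Y c) x u)"
    by (rule alternate_replaced_factor[where a="\<lambda>m u. \<alpha> m c x (\<lambda>_. u)"
        and b="\<lambda>i u. fderiv (\<lambda>y. \<alpha> i c y (\<lambda>_. u)) x (Y c x) + \<alpha> i c x (\<lambda>_. fderiv (Y c) x u)"])
      (use u i dual_values[OF c x] in \<open>auto simp: kernel_distr_def\<close>)
  ultimately show ?thesis by simp
qed

text \<open>
Extend \<open>u\<close> to a Hamiltonian vector field \<open>Z\<close>. It is tangent to the leaves, hence so is \<open>[Y, Z]\<close>, and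
\<open>(L\<^sub>Y\<alpha>\<^sub>i)(Z) = Y(\<alpha>\<^sub>i(Z)) - \<alpha>\<^sub>i([Y, Z]) = 0\<close>.
\<close>

lemma leafwise_invariant_if_preserves:
  assumes W: "open W" and Y: "vector_field A W Y" and pres: "preserves A W Y (characteristic_distr \<Lambda>)"
    and c: "c \<in> A" and x: "x \<in> coords c W" and i: "i < k" and u: "u \<in> kernel_distr k \<alpha> c x"
  shows "fderiv (\<lambda>y. \<alpha> i c y (\<lambda>_. u)) x (Y c x) + \<alpha> i c x (\<lambda>_. fderiv (Y c) x u) = 0"
proof -
  have x': "x \<in> coords c UNIV" using x coords_subset by blast
  obtain f where f: "smooth_function A f" "hamiltonian_vf \<Lambda> f c x = u"
    by (rule hamiltonian_through[OF c x' u])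
  let ?Z = "hamiltonian_vf \<Lambda> f"
  have Z: "vector_field A UNIV ?Z" by (rule hamiltonian_vector_field[OF atlas bivector f(1)])
  have "vector_field A W ?Z"
    unfolding vector_field_def
  proof (intro conjI ballI)
    fix d assume d: "d \<in> A"
    show "smooth_on (coords d W) (?Z d)"
      by (rule smooth_on_subset[OF _ coords_subset]) (use Z d in \<open>simp add: vector_field_def\<close>)
    fix e z assume "e \<in> A" "z \<in> coords d (fst e \<inter> W)"
    moreover then have "z \<in> coords d (fst e \<inter> UNIV)" by (auto simp: coords_def)
    ultimately show "?Z e (transition d e z) = jac d e z (?Z d z)"
      using Z d by (simp add: vector_field_def)
  qed
  moreover have "vfield_in A W ?Z (characteristic_distr \<Lambda>)"
    by (simp add: vfield_in_def characteristic_distr_def hamiltonian_vf_def)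
  ultimately have "lie_bracket Y ?Z c x \<in> characteristic_distr \<Lambda> c x"
    using pres c x by (auto simp: preserves_def vfield_in_def)
  then have bracket: "\<alpha> i c x (\<lambda>_. fderiv (?Z c) x (Y c x) - fderiv (Y c) x u) = 0"
    using characteristic[OF c x'] i by (simp add: kernel_distr_def lie_bracket_def f(2))
  have "(?Z c has_derivative fderiv (?Z c) x) (at x)"
    using Z c x' by (auto simp: vector_field_def frechet_derivative_works[symmetric] intro: smooth_on_differentiable)
  from has_derivative_linear_family[OF open_U[OF c] x' alternating_1_linear[OF alternating_fields(1)[OF c _ i]]
      differentiable_fields(1)[OF c x' i] this]
  have "((\<lambda>y. \<alpha> i c y (\<lambda>_. ?Z c y)) has_derivative
      (\<lambda>h. fderiv (\<lambda>y. \<alpha> i c y (\<lambda>_. ?Z c x)) x h + \<alpha> i c x (\<lambda>_. fderiv (?Z c) x h))) (at x)" .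
  moreover have "((\<lambda>y. \<alpha> i c y (\<lambda>_. ?Z c y)) has_derivative (\<lambda>h. 0)) (at x)"
  proof (rule has_derivative_transform_within_open[OF has_derivative_const open_U[OF c] x'])
    show "0 = \<alpha> i c y (\<lambda>_. ?Z c y)" if "y \<in> coords c UNIV" for y
      using sharp_in_kernel[OF c that] i by (simp add: hamiltonian_vf_def kernel_distr_def)
  qed
  ultimately have "(\<lambda>h. fderiv (\<lambda>y. \<alpha> i c y (\<lambda>_. ?Z c x)) x h + \<alpha> i c x (\<lambda>_. fderiv (?Z c) x h)) = (\<lambda>h. 0)"
    by (rule has_derivative_unique)
  then have "fderiv (\<lambda>y. \<alpha> i c y (\<lambda>_. u)) x (Y c x) + \<alpha> i c x (\<lambda>_. fderiv (?Z c) x (Y c x)) = 0"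
    unfolding f(2) by metis
  then show ?thesis
    using bracket linear_diff[OF alternating_1_linear[OF alternating_fields(1)[OF c x' i]]] by simp
qed

lemma dim_transversal:
  assumes c: "c \<in> A" and x: "x \<in> coords c UNIV"
  shows "dim (span ((\<lambda>j. X j c x) ` {..<k})) = k"
proof -
  let ?B = "(\<lambda>j. X j c x) ` {..<k}"
  note val = dual_values[OF c x]
  have inj: "inj_on (\<lambda>j. X j c x) {..<k}"
  proof (rule inj_onI)
    fix i j assume "i \<in> {..<k}" "j \<in> {..<k}" "X i c x = X j c x"
    then show "i = j" using val[of i i] val[of i j] by (auto split: if_splits)
  qed
  have "independent ?B"
    unfolding independent_explicit
  proof (intro conjI allI impI ballI)
    fix t v assume t: "(\<Sum>v\<in>?B. t v *\<^sub>R v) = 0" and "v \<in> ?B"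
    then obtain i where i: "i < k" "v = X i c x" by auto
    have lin: "linear (\<lambda>u. \<alpha> i c x (\<lambda>_. u))" by (rule alternating_1_linear[OF alternating_fields(1)[OF c x i(1)]])
    have "(\<Sum>j<k. t (X j c x) *\<^sub>R X j c x) = 0" using t by (simp add: sum.reindex[OF inj])
    then have "0 = \<alpha> i c x (\<lambda>_. \<Sum>j<k. t (X j c x) *\<^sub>R X j c x)"
      using linear_0[OF lin] by (simp only:)
    also have "\<dots> = (\<Sum>j<k. t (X j c x) * \<alpha> i c x (\<lambda>_. X j c x))"
      by (simp only: linear_sum[OF lin] linear_scale[OF lin] real_scaleR_def)
    also have "\<dots> = (\<Sum>j<k. if i = j then t (X j c x) else 0)"
      by (rule sum.cong) (auto simp: val[OF i(1)])
    also have "\<dots> = t v" using i by simp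
    finally show "t v = 0" by simp
  qed simp
  then show ?thesis by (simp add: dim_span dim_eq_card_independent card_image[OF inj])
qed

lemma transversal_span:
  "transversal A (characteristic_distr \<Lambda>) (\<lambda>c x. span ((\<lambda>j. X j c x) ` {..<k}))"
  unfolding transversal_def
proof (intro conjI ballI)
  show "distribution A (\<lambda>c x. span ((\<lambda>j. X j c x) ` {..<k}))"
    unfolding distribution_def
    by (intro exI[of _ k] allI exI[of _ UNIV] exI[of _ X]) (auto simp: vector_field_X dim_transversal simp del: dim_span)
next
  fix c x assume c: "c \<in> A" and x: "x \<in> coords c UNIV"
  let ?B = "(\<lambda>j. X j c x) ` {..<k}"
  note lin = alternating_1_linear[OF alternating_fields(1)[OF c x]]
  note val = dual_values[OF c x]
  \<comment> \<open>The projection onto the span of the frame along the leaves.\<close>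
  define \<pi> where "\<pi> v = (\<Sum>j<k. \<alpha> j c x (\<lambda>_. v) *\<^sub>R X j c x)" for v
  have \<pi>_span: "\<pi> v \<in> span ?B" for v
    unfolding \<pi>_def by (intro span_sum span_scale span_base) auto
  have \<alpha>\<pi>: "\<alpha> i c x (\<lambda>_. \<pi> v) = \<alpha> i c x (\<lambda>_. v)" if i: "i < k" for i v
  proof -
    have "\<alpha> i c x (\<lambda>_. \<pi> v) = (\<Sum>j<k. \<alpha> j c x (\<lambda>_. v) * \<alpha> i c x (\<lambda>_. X j c x))"
      by (simp only: \<pi>_def linear_sum[OF lin[OF i]] linear_scale[OF lin[OF i]] real_scaleR_def)
    also have "\<dots> = (\<Sum>j<k. if i = j then \<alpha> j c x (\<lambda>_. v) else 0)"
      by (rule sum.cong) (auto simp: val[OF i])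
    finally show ?thesis using i by simp
  qed
  have fix_\<pi>: "\<pi> v = v" if "v \<in> span ?B" for v
  proof -
    have lin_\<pi>: "linear (\<lambda>v. \<pi> v - v)"
      unfolding \<pi>_def
      by (intro linear_compose_sub linear_compose_sum linear_id[unfolded id_def] ballI)
        (auto intro!: linearI simp: linear_add[OF lin] linear_scale[OF lin] scaleR_add_left)
    have "\<pi> v - v = 0"
    proof (rule linear_eq_0_on_span[OF lin_\<pi> _ that])
      fix b assume "b \<in> ?B"
      then obtain i where i: "i < k" "b = X i c x" by auto
      have "\<pi> b = (\<Sum>j<k. if j = i then X j c x else 0)"
        unfolding \<pi>_def i(2) by (rule sum.cong) (auto simp: val i(1))
      then show "\<pi> b - b = 0" using i by simp
    qed
    then show ?thesis by simp
  qed
  show "characteristic_distr \<Lambda> c x \<inter> span ?B = {0}"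
  proof -
    have "v = 0" if "v \<in> kernel_distr k \<alpha> c x" "v \<in> span ?B" for v
      using fix_\<pi>[OF that(2)] that(1) by (simp add: \<pi>_def kernel_distr_def)
    moreover have "0 \<in> kernel_distr k \<alpha> c x" using linear_0[OF lin] by (simp add: kernel_distr_def)
    ultimately show ?thesis using characteristic[OF c x] span_zero by auto
  qed
  have "v \<in> {u + w | u w. u \<in> characteristic_distr \<Lambda> c x \<and> w \<in> span ?B}" for v
  proof -
    have "v - \<pi> v \<in> kernel_distr k \<alpha> c x"
      using linear_diff[OF lin] \<alpha>\<pi> by (simp add: kernel_distr_def)
    then show ?thesis
      using \<pi>_span[of v] characteristic[OF c x]
      by (intro CollectI exI[of _ "v - \<pi> v"] exI[of _ "\<pi> v"]) simp
  qed
  then show "{u + w | u w. u \<in> characteristic_distr \<Lambda> c x \<and> w \<in> span ?B} = UNIV" by blast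
qed

end

theorem theorem13:
  fixes A :: "('a::{t2_space,second_countable_topology}, 'n::finite) chart set"
    and k r :: nat
    and \<alpha> :: "nat \<Rightarrow> ('a, 'n) tfield"
    and \<mu> \<omega> \<Lambda> :: "('a, 'n) tfield"
    and X :: "nat \<Rightarrow> ('a, 'n) vfield"
  assumes "smooth_atlas A"
    and "orientable A"
    and "CARD('n) = k + 2 * r"
    and "foliation_generators A k \<alpha>"
    and "\<mu> = wedge_family k \<alpha>"
    and "\<forall>j<k. vector_field A UNIV (X j)"
    and "\<forall>i<k. \<forall>j<k. tensor_eq A UNIV (contract (X j) (\<alpha> i)) (\<lambda>c x v. if i = j then 1 else 0)"
    and "compatible_form A k r \<mu> \<omega>"
    and "\<forall>j<k. tensor_eq A UNIV (contract (X j) \<omega>) zero_tensor"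
    and "regular_poisson_tensor A \<Lambda>"
    and "\<forall>c\<in>A. \<forall>x\<in>coords c UNIV. characteristic_distr \<Lambda> c x = kernel_distr k \<alpha> c x"
    and "tensor_eq A UNIV
           (contract_bivector \<Lambda> (wedge k (2 * r) \<mu> (wedge_power r \<omega>)))
           (\<lambda>c x v. real r * wedge k (2 * (r - 1)) \<mu> (wedge_power (r - 1) \<omega>) c x v)"
    and "\<forall>j<k. \<forall>f. smooth_function A f \<longrightarrow>
           tensor_eq A UNIV (contract (hamiltonian_vf \<Lambda> f) (lie_deriv k (X j) \<mu>)) zero_tensor"
    and "\<forall>j<k. tensor_eq A UNIV
           (wedge (k - 1) 3 (contract (X j) \<mu>) (ext_deriv 2 \<omega>)) zero_tensor"
  shows "(\<forall>j<k. poisson_vector_field A UNIV \<Lambda> (X j)) \<and> transversally_constant A \<Lambda>"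
proof -
  note \<mu> = \<open>\<mu> = wedge_family k \<alpha>\<close>
  interpret foliated_poisson A k r \<alpha> \<omega> \<Lambda> X
    using assms(1,3,4,6-12,14) unfolding \<mu>
    by unfold_locales (simp_all add: foliation_generators_def compatible_form_def
        regular_poisson_tensor_def poisson_tensor_def)
  have "poisson_vector_field A UNIV \<Lambda> (X j)" if j: "j < k" for j
  proof (rule poisson_vector_field_if_leafwise_invariant[OF open_UNIV vector_field_X[OF j]])
    show "vfield_in A UNIV (X j) (\<lambda>c x. span ((\<lambda>j. X j c x) ` {..<k}))"
      using j by (auto simp: vfield_in_def intro: span_base)
    show "fderiv (\<lambda>y. \<alpha> i c y (\<lambda>_. u)) x (X j c x) + \<alpha> i c x (\<lambda>_. fderiv (X j c) x u) = 0"
      if "c \<in> A" "x \<in> coords c UNIV" "i < k" "u \<in> kernel_distr k \<alpha> c x" for c x i u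
      using _ that by (rule leafwise_invariant_if_lie_deriv_\<mu>) (use assms(13) j \<mu> in blast)
  qed
  moreover have "poisson_vector_field A W \<Lambda> Y"
    if "open W" "vector_field A W Y" "vfield_in A W Y (\<lambda>c x. span ((\<lambda>j. X j c x) ` {..<k}))"
      "preserves A W Y (characteristic_distr \<Lambda>)" for W Y
    using that(1-3) leafwise_invariant_if_preserves[OF that(1,2,4)] by (rule poisson_vector_field_if_leafwise_invariant)
  ultimately show ?thesis
    unfolding transversally_constant_def using assms(10) transversal_span by blast
qed

end
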